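(* Every invariant random subgroup of the lamplighter group $\mathbb{Z}_2 \wr \mathbb{Z}$ is co-sofic, and so the group $\mathbb{Z}_2 \wr \mathbb{Z}$ is permutation stable.
   Context: $\mathbb{Z}_2\wr\mathbb{Z}=\mathbb{Z}\ltimes\bigoplus_{x\in\mathbb{Z}}\mathbb{Z}/2\mathbb{Z}$, where $\mathbb{Z}$ acts by translating the coordinates. Invariant random subgroups. For a countable discrete group $G$, $\mathrm{Sub}(G)\subset\{0,1\}^G$ is the compact space of all subgroups of $G$ with the topology induced from the product topology (the Chabauty topology). $G$ acts on $\mathrm{Sub}(G)$ by conjugation. $\mathcal{P}(G)$ is the space of Borel probability measures on $\mathrm{Sub}(G)$ with the weak-$*$ topology. An invariant random subgroup of $G$ is a conjugation-invariant $\mu\in\mathcal{P}(G)$; $\mathrm{IRS}(G)$ is the set of these. $\mathrm{IRS}_{\mathrm{fi}}(G)$ is the set of $\mu\in \mathrm{IRS}(G)$ giving measure one to the set of finite index subgroups of $G$. $\mu\in\mathrm{IRS}(G)$ is co-sofic if it lies in the weak-$*$ closure of $\mathrm{IRS}_{\mathrm{fi}}(G)$. Permutation stability. Let $\mathrm{S}(n)$ be the symmetric group of degree $n$ with the metric $d_n(\sigma,\tau)=1-\frac1n|\mathrm{Fix}(\sigma^{-1}\tau)|$. An almost-homomorphism of a finitely generated group $G$ is a sequence of maps $f_n:G\to \mathrm{S}(n)$ with $d_n(f_n(g)f_n(h),f_n(gh))\to0$ as $n\to\infty$ for all $g,h\in G$. It is close to a homomorphism if there are group homomorphisms $\rho_n:G\to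 \mathrm{S}(n)$ with $d_n(\rho_n(g),f_n(g))\to0$ for all $g\in G$. $G$ is permutation stable if every almost-homomorphism of $G$ is close to a homomorphism. *)

theory Defs
  imports
    "HOL-Probability.Probability"
    "HOL-Algebra.Product_Groups"
    "HOL-Algebra.Sym_Groups"
begin

section \<open>The lamplighter group\<close>

text \<open>The group \<open>K \<ltimes> N\<close>, where \<open>\<phi>\<close> is a left action of \<open>K\<close> on \<open>N\<close> by automorphisms; in
  \<open>K \<ltimes> N\<close> one has \<open>(k, 1) (1, n) (k, 1)\<inverse> = (1, \<phi> k n)\<close>.\<close>

definition semidirect_product ::
  "('k, 'c) monoid_scheme \<Rightarrow> ('k \<Rightarrow> 'n \<Rightarrow> 'n) \<Rightarrow> ('n, 'd) monoid_scheme \<Rightarrow> ('k \<times> 'n) monoid"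
  where "semidirect_product K \<phi> N =
    \<lparr>carrier = carrier K \<times> carrier N,
     mult = (\<lambda>(k, n) (k', n'). (k \<otimes>\<^bsub>K\<^esub> k', n \<otimes>\<^bsub>N\<^esub> \<phi> k n')),
     one = (\<one>\<^bsub>K\<^esub>, \<one>\<^bsub>N\<^esub>)\<rparr>"

definition lamp_group :: "(int \<Rightarrow> int) monoid"
  where "lamp_group = sum_group (UNIV :: int set) (\<lambda>_. integer_mod_group 2)"

definition shift :: "int \<Rightarrow> (int \<Rightarrow> int) \<Rightarrow> int \<Rightarrow> int"
  where "shift k f = (\<lambda>x. f (x - k))"

definition lamplighter :: "(int \<times> (int \<Rightarrow> int)) monoid"
  where "lamplighter = semidirect_product integer_group shift lamp_group"


section \<open>Invariant random subgroups\<close>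

definition Sub :: "('a, 'c) monoid_scheme \<Rightarrow> 'a set set"
  where "Sub G = {H. subgroup H G}"

text \<open>A subset \<open>H\<close> of the carrier is identified with its indicator function, a point of the product
  of discrete two-point spaces indexed by the carrier.\<close>

definition chabauty :: "('a, 'c) monoid_scheme \<Rightarrow> 'a set topology"
  where "chabauty G =
    pullback_topology (Sub G) (\<lambda>H. \<lambda>x\<in>carrier G. x \<in> H)
      (product_topology (\<lambda>_. discrete_topology (UNIV :: bool set)) (carrier G))"

definition chabauty_borel :: "('a, 'c) monoid_scheme \<Rightarrow> 'a set measure"
  where "chabauty_borel G = sigma (Sub G) {U. openin (chabauty G) U}"

definition prob_measures :: "('a, 'c) monoid_scheme \<Rightarrow> 'a set measure set"
  where "prob_measures G = {\<mu>. sets \<mu> = sets (chabauty_borel G) \<and> prob_space \<mu>}"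

text \<open>The coarsest topology on the space of probability measures for which integration against each
  continuous real function on the compact space \<open>Sub G\<close> is continuous.\<close>

definition weak_star :: "('a, 'c) monoid_scheme \<Rightarrow> 'a set measure topology"
  where "weak_star G =
    (let C = {f :: 'a set \<Rightarrow> real. continuous_map (chabauty G) euclideanreal f}
     in pullback_topology (prob_measures G) (\<lambda>\<mu>. \<lambda>f\<in>C. \<integral>H. f H \<partial>\<mu>)
          (product_topology (\<lambda>_. euclideanreal) C))"

definition conj_subgroup :: "('a, 'c) monoid_scheme \<Rightarrow> 'a \<Rightarrow> 'a set \<Rightarrow> 'a set"
  where "conj_subgroup G g H = (g <#\<^bsub>G\<^esub> H) #>\<^bsub>G\<^esub> (inv\<^bsub>G\<^esub> g)"

definition IRS :: "('a, 'c) monoid_scheme \<Rightarrow> 'a set measure set"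
  where "IRS G = {\<mu> \<in> prob_measures G. \<forall>g\<in>carrier G. distr \<mu> \<mu> (conj_subgroup G g) = \<mu>}"

definition finite_index :: "('a, 'c) monoid_scheme \<Rightarrow> 'a set set"
  where "finite_index G = {H \<in> Sub G. finite (rcosets\<^bsub>G\<^esub> H)}"

definition IRS_fi :: "('a, 'c) monoid_scheme \<Rightarrow> 'a set measure set"
  where "IRS_fi G = {\<mu> \<in> IRS G. measure \<mu> (finite_index G) = 1}"

definition co_sofic :: "('a, 'c) monoid_scheme \<Rightarrow> 'a set measure \<Rightarrow> bool"
  where "co_sofic G \<mu> \<longleftrightarrow> \<mu> \<in> IRS G \<and> \<mu> \<in> weak_star G closure_of IRS_fi G"


section \<open>Permutation stability\<close>

text \<open>The fixed points are counted in \<open>{1..n}\<close>, since elements of \<open>sym_group n\<close> are functions on all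
  natural numbers that are the identity outside \<open>{1..n}\<close>. The value at \<open>n = 0\<close> is irrelevant below,
  where only limits as \<open>n\<close> tends to infinity occur.\<close>

definition perm_dist :: "nat \<Rightarrow> (nat \<Rightarrow> nat) \<Rightarrow> (nat \<Rightarrow> nat) \<Rightarrow> real"
  where "perm_dist n \<sigma> \<tau> =
    1 - real (card {x \<in> {1..n}. (inv\<^bsub>sym_group n\<^esub> \<sigma> \<otimes>\<^bsub>sym_group n\<^esub> \<tau>) x = x}) / real n"

definition almost_hom :: "('a, 'c) monoid_scheme \<Rightarrow> (nat \<Rightarrow> 'a \<Rightarrow> nat \<Rightarrow> nat) \<Rightarrow> bool"
  where "almost_hom G f \<longleftrightarrow>
    (\<forall>n. f n \<in> carrier G \<rightarrow> carrier (sym_group n)) \<and>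
    (\<forall>g\<in>carrier G. \<forall>h\<in>carrier G.
      (\<lambda>n. perm_dist n (f n g \<otimes>\<^bsub>sym_group n\<^esub> f n h) (f n (g \<otimes>\<^bsub>G\<^esub> h))) \<longlonglongrightarrow> 0)"

definition close_to_hom :: "('a, 'c) monoid_scheme \<Rightarrow> (nat \<Rightarrow> 'a \<Rightarrow> nat \<Rightarrow> nat) \<Rightarrow> bool"
  where "close_to_hom G f \<longleftrightarrow>
    (\<exists>\<rho>. (\<forall>n. \<rho> n \<in> hom G (sym_group n)) \<and>
      (\<forall>g\<in>carrier G. (\<lambda>n. perm_dist n (\<rho> n g) (f n g)) \<longlonglongrightarrow> 0))"

definition permutation_stable :: "('a, 'c) monoid_scheme \<Rightarrow> bool"
  where "permutation_stable G \<longleftrightarrow> (\<forall>f. almost_hom G f \<longrightarrow> close_to_hom G f)"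


section \<open>Basic facts\<close>

lemma topspace_chabauty: "topspace (chabauty G) = Sub G"
  unfolding chabauty_def by (auto simp: topspace_pullback_topology)

lemma topspace_weak_star: "topspace (weak_star G) = prob_measures G"
  unfolding weak_star_def Let_def by (auto simp: topspace_pullback_topology)

lemma openin_chabauty_subset: "openin (chabauty G) U \<Longrightarrow> U \<subseteq> Sub G"
  using openin_subset[of "chabauty G" U] by (simp add: topspace_chabauty)

lemma space_chabauty_borel: "space (chabauty_borel G) = Sub G"
  unfolding chabauty_borel_def
  by (intro space_measure_of) (auto dest: openin_chabauty_subset)

lemma sets_chabauty_borel:
  "sets (chabauty_borel G) = sigma_sets (Sub G) {U. openin (chabauty G) U}"
  unfolding chabauty_borel_def
  by (intro sets_measure_of) (auto dest: openin_chabauty_subset)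

lemma group_lamp_group: "group lamp_group"
  unfolding lamp_group_def by (rule sum_group) auto

lemma carrier_lamp_group: "carrier lamp_group = {f. range f \<subseteq> {0, 1} \<and> finite {x. f x \<noteq> 0}}"
proof -
  have "{0..<2} = {0, 1 :: int}" by auto
  then show ?thesis
    by (auto simp: lamp_group_def carrier_sum_group carrier_integer_mod_group PiE_def Pi_def)
qed

lemma mult_lamp_group: "f \<otimes>\<^bsub>lamp_group\<^esub> g = (\<lambda>x. (f x + g x) mod 2)"
  by (simp add: lamp_group_def integer_mod_group_def fun_eq_iff)

lemma one_lamp_group: "\<one>\<^bsub>lamp_group\<^esub> = (\<lambda>_. 0)"
  by (simp add: lamp_group_def fun_eq_iff)

lemma shift_in_lamp_group:
  assumes "f \<in> carrier lamp_group" shows "shift k f \<in> carrier lamp_group"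
proof -
  have "{x. shift k f x \<noteq> 0} = (+) k ` {x. f x \<noteq> 0}"
    by (force simp: shift_def image_iff intro: exI[of _ "_ - k"])
  then show ?thesis
    using assms by (auto simp: carrier_lamp_group shift_def)
qed

lemma carrier_lamplighter: "carrier lamplighter = UNIV \<times> carrier lamp_group"
  by (simp add: lamplighter_def semidirect_product_def)

lemma mult_lamplighter:
  "(k, f) \<otimes>\<^bsub>lamplighter\<^esub> (k', f') = (k + k', f \<otimes>\<^bsub>lamp_group\<^esub> shift k f')"
  by (simp add: lamplighter_def semidirect_product_def)

lemma one_lamplighter: "\<one>\<^bsub>lamplighter\<^esub> = (0, \<one>\<^bsub>lamp_group\<^esub>)"
  by (simp add: lamplighter_def semidirect_product_def)

lemma group_lamplighter: "group lamplighter"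
proof (rule groupI)
  interpret N: group lamp_group by (rule group_lamp_group)
  show "x \<otimes>\<^bsub>lamplighter\<^esub> y \<in> carrier lamplighter"
    if "x \<in> carrier lamplighter" "y \<in> carrier lamplighter" for x y
    using that by (cases x; cases y) (auto simp: carrier_lamplighter mult_lamplighter shift_in_lamp_group)
  show "\<one>\<^bsub>lamplighter\<^esub> \<in> carrier lamplighter"
    by (simp add: carrier_lamplighter one_lamplighter)
  show "x \<otimes>\<^bsub>lamplighter\<^esub> y \<otimes>\<^bsub>lamplighter\<^esub> z = x \<otimes>\<^bsub>lamplighter\<^esub> (y \<otimes>\<^bsub>lamplighter\<^esub> z)" for x y z
    by (cases x; cases y; cases z)
      (auto simp: mult_lamplighter mult_lamp_group shift_def fun_eq_iff mod_simps algebra_simps)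
  show "\<one>\<^bsub>lamplighter\<^esub> \<otimes>\<^bsub>lamplighter\<^esub> x = x" if "x \<in> carrier lamplighter" for x
    using that by (cases x) (auto simp: carrier_lamplighter one_lamplighter mult_lamplighter shift_def)
  show "\<exists>y\<in>carrier lamplighter. y \<otimes>\<^bsub>lamplighter\<^esub> x = \<one>\<^bsub>lamplighter\<^esub>"
    if "x \<in> carrier lamplighter" for x
  proof (cases x)
    case (Pair k f)
    then show ?thesis
      using that by (intro bexI[of _ "(- k, inv\<^bsub>lamp_group\<^esub> (shift (- k) f))"])
        (auto simp: carrier_lamplighter mult_lamplighter one_lamplighter shift_in_lamp_group)
  qed
qed

lemma countable_lamplighter: "countable (carrier lamplighter)"
proof -
  have "inj_on (\<lambda>f. {x. f x \<noteq> 0}) (carrier lamp_group)"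
  proof (rule inj_onI, rule ext)
    fix f g :: "int \<Rightarrow> int" and x
    assume f: "f \<in> carrier lamp_group" and g: "g \<in> carrier lamp_group"
      and eq: "{x. f x \<noteq> 0} = {x. g x \<noteq> 0}"
    have "f x \<in> {0, 1}" "g x \<in> {0, 1}"
      using f g by (simp_all only: carrier_lamp_group mem_Collect_eq image_subset_iff UNIV_I)
    moreover have "f x \<noteq> 0 \<longleftrightarrow> g x \<noteq> 0"
      using eq by (simp add: set_eq_iff)
    ultimately show "f x = g x" by auto
  qed
  moreover have "countable ((\<lambda>f. {x. f x \<noteq> 0}) ` carrier lamp_group)"
    by (rule countable_subset[OF _ countable_Collect_finite]) (auto simp: carrier_lamp_group)
  ultimately have "countable (carrier lamp_group)"
    using countable_image_inj_on by blast
  then show ?thesis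
    by (simp add: carrier_lamplighter)
qed

end

theory Submission
  imports Defs
begin

text \<open>Let \<open>B\<close> be the group of lamp configurations and \<open>t\<close> the generator of \<open>\<int>\<close>. The key observation is that
  if \<open>t ^ p b\<close> with \<open>p > 0\<close> fixes a point, then its conjugates by the elements of \<open>B\<close> fix the translated
  points, and these conjugates are pairwise different; so in a measure preserving action almost every
  such point has a finite \<open>B\<close>-orbit, and then a finite orbit.

  For stability, consider a finite set with an almost action. Up to few points it consists of small
  orbits, on which the action is exact, and of points that are not moved back by \<open>t ^ p b\<close> at a large
  scale. The latter are almost covered by almost disjoint Folner tiles as in the Ornstein-Weiss
  quasi-tiling theorem. A tile consists of the translates \<open>t ^ j Q\<close>, \<open>j < m\<close>, of an orbit \<open>Q\<close> of the lamps in a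
  window; closing it up by \<open>t ^ m = 1\<close> gives an exact action that differs only on the last translate.

  For an invariant random subgroup \<open>\<mu>\<close>, the same observation shows that almost every subgroup not
  contained in \<open>B\<close> has finite index. A subgroup \<open>H\<close> of \<open>B\<close> is replaced by the periodic subgroup
  determined by its configurations in a window of length \<open>m\<close>; averaging over the \<open>m\<close> windows that contain
  the origin gives a conjugation-invariant measure on finite index subgroups that converges to \<open>\<mu>\<close>.\<close>


section \<open>Words in the lamplighter group\<close>

text \<open>The quantitative form of the observation serves both halves. Let \<open>I\<close> be a
  window and \<open>J\<close> the positions that remain in \<open>I\<close> after a shift by
  \<open>p\<close>. Conjugation by \<open>S \<subseteq> J\<close> multiplies \<open>(p, b)\<close>
  by the commutator \<open>S + (S + p)\<close>, from which the finite set \<open>S\<close> can be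
  recovered. If a point is reached by many translates of points fixed by \<open>(p, b)\<close>, as
  many commutators stabilise it, whereas an orbit of at least \<open>K\<close> points under the
  lamps of \<open>I\<close> leaves at most \<open>2 ^ card I / K\<close> of them. Double counting
  over the \<open>2 ^ card J\<close> translates bounds the density of such points by
  \<open>2 ^ p / K\<close>, independently of the window. So \<open>K\<close> is chosen from the
  scale alone, and then a window so long that an orbit with fewer than \<open>K\<close> points must
  stop growing inside it. The group has no finite presentation: an exact action satisfies
  commutation relations at all distances, an almost action controls finitely many. Therefore exact
  pieces are built in which far relations hold for a structural reason, periodicity in the cursor,
  and they are compared with the given maps on the two generators only.\<close>

text \<open>The pair \<open>(k, S)\<close> stands for \<open>(k, indicator of S)\<close> in the lamplighter group; the operation is
  that of the unrestricted wreath product, as \<open>S\<close> may be infinite.\<close>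

definition sd :: "'a set \<Rightarrow> 'a set \<Rightarrow> 'a set"
  where "sd A B = {x. (x \<in> A) \<noteq> (x \<in> B)}"

definition tr :: "int \<Rightarrow> int set \<Rightarrow> int set"
  where "tr k S = {x. x - k \<in> S}"

definition lmul :: "int \<times> int set \<Rightarrow> int \<times> int set \<Rightarrow> int \<times> int set"  (infixl "\<odot>" 70)
  where "g \<odot> h = (fst g + fst h, sd (snd g) (tr (fst g) (snd h)))"

definition linv :: "int \<times> int set \<Rightarrow> int \<times> int set"
  where "linv g = (- fst g, tr (- fst g) (snd g))"

text \<open>The boxes replace the balls of a word metric: radii add under products, and inversion at
  most doubles the radius because it also moves the lamps by the cursor.\<close>

definition wbox :: "nat \<Rightarrow> (int \<times> int set) set"
  where "wbox N = {- int N..int N} \<times> Pow {- int N..int N}"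

lemma mem_sd [simp]: "x \<in> sd A B \<longleftrightarrow> (x \<in> A) \<noteq> (x \<in> B)"
  by (simp add: sd_def)

lemma mem_tr [simp]: "x \<in> tr k S \<longleftrightarrow> x - k \<in> S"
  by (simp add: tr_def)

lemma sd_simps [simp]: "sd A {} = A" "sd {} A = A" "sd A A = {}" "sd A (sd A B) = B"
  by (auto simp: set_eq_iff)

lemma tr_simps [simp]: "tr 0 S = S" "tr k {} = {}" "tr k (tr l S) = tr (k + l) S"
  "tr k {i} = {i + k}"
  by (auto simp: set_eq_iff algebra_simps)

lemma sd_assoc: "sd (sd A B) C = sd A (sd B C)"
  and sd_commute: "sd A B = sd B A"
  and sd_left_commute: "sd A (sd B C) = sd B (sd A C)"
  by (auto simp: set_eq_iff)

lemma tr_sd: "tr k (sd A B) = sd (tr k A) (tr k B)"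
  by (auto simp: set_eq_iff)

lemma tr_conv_image: "tr k S = (+) k ` S"
  by (auto simp: set_eq_iff image_iff intro: bexI[of _ "_ - k"])

lemma finite_tr [simp]: "finite (tr k S) \<longleftrightarrow> finite S"
  by (simp add: tr_conv_image finite_image_iff)

lemma finite_sd [simp]: "finite A \<Longrightarrow> finite B \<Longrightarrow> finite (sd A B)"
  by (rule finite_subset[of _ "A \<union> B"]) auto

lemma sd_subset: "A \<subseteq> C \<Longrightarrow> B \<subseteq> C \<Longrightarrow> sd A B \<subseteq> C"
  by auto

lemma sd_eq_empty_iff [simp]: "sd A B = {} \<longleftrightarrow> A = B"
  by (auto simp: set_eq_iff)

lemma lmul_simp [simp]: "(k, S) \<odot> (l, T) = (k + l, sd S (tr k T))"
  by (simp add: lmul_def)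

lemma linv_simp [simp]: "linv (k, S) = (- k, tr (- k) S)"
  by (simp add: linv_def)

lemma lmul_assoc: "g \<odot> h \<odot> k = g \<odot> (h \<odot> k)"
  by (cases g; cases h; cases k) (simp add: tr_sd sd_assoc add.assoc)

lemma lmul_one [simp]: "g \<odot> (0, {}) = g" "(0, {}) \<odot> g = g"
  by (cases g; simp)+

lemma lmul_linv [simp]: "g \<odot> linv g = (0, {})" "linv g \<odot> g = (0, {})"
  by (cases g; simp)+

lemma finite_wbox [simp]: "finite (wbox N)"
  by (simp add: wbox_def)

lemma wbox_mono: "M \<le> N \<Longrightarrow> wbox M \<subseteq> wbox N"
  by (force simp: wbox_def)

lemma pair_in_wbox: "(k, S) \<in> wbox N \<longleftrightarrow> \<bar>k\<bar> \<le> int N \<and> (\<forall>x\<in>S. \<bar>x\<bar> \<le> int N)"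
  by (auto simp: wbox_def abs_le_iff subset_iff minus_le_iff)

lemma wbox_mult: "g \<in> wbox M \<Longrightarrow> h \<in> wbox N \<Longrightarrow> g \<odot> h \<in> wbox (M + N)"
  by (cases g; cases h) (fastforce simp: pair_in_wbox)

lemma wbox_linv: "g \<in> wbox N \<Longrightarrow> linv g \<in> wbox (2 * N)"
  by (cases g) (fastforce simp: pair_in_wbox)

text \<open>Orbit-stabiliser for the lamp group of a window \<open>I\<close>: the stabiliser is \<open>K\<close> and \<open>R\<close> is a set
  of representatives.\<close>

lemma card_mult_le_power:
  assumes "finite I" "R \<subseteq> Pow I" "K \<subseteq> Pow I"
    and inj: "\<And>r r' s s'. r \<in> R \<Longrightarrow> r' \<in> R \<Longrightarrow> s \<in> K \<Longrightarrow> s' \<in> K \<Longrightarrow> sd r r' = sd s s' \<Longrightarrow> r = r'"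
  shows "card R * card K \<le> 2 ^ card I"
proof -
  have "inj_on (\<lambda>(r, s). sd r s) (R \<times> K)"
  proof (rule inj_onI, clarify)
    fix r s r' s' assume *: "r \<in> R" "r' \<in> R" "s \<in> K" "s' \<in> K" and eq: "sd r s = sd r' s'"
    have "sd r r' = sd s s'" using eq by (auto simp: set_eq_iff)
    then have "r = r'" using inj * by blast
    moreover from this have "s = s'" using eq by (auto simp: set_eq_iff)
    ultimately show "r = r' \<and> s = s'" by blast
  qed
  moreover have "(\<lambda>(r, s). sd r s) ` (R \<times> K) \<subseteq> Pow I"
    using assms(2,3) by (auto 0 3)
  ultimately have "card (R \<times> K) \<le> card (Pow I)"
    using assms(1) by (intro card_inj_on_le) auto
  then show ?thesis using assms(1) by (simp add: card_cartesian_product card_Pow)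
qed

text \<open>A lamp configuration is determined by its commutator with \<open>t ^ p\<close>.\<close>

lemma sd_tr_inject:
  assumes "finite S" "finite S'" "p > 0" "sd S (tr p S) = sd S' (tr p S')"
  shows "S = S'"
proof (rule ccontr)
  define D where "D = sd S S'"
  assume "S \<noteq> S'"
  then have "D \<noteq> {}" "finite D" using assms by (auto simp: D_def)
  moreover have "D = tr p D"
    using assms(4) unfolding D_def by (auto simp: set_eq_iff)
  then have "Min D - p \<in> D"
    using Min_in[of D] \<open>D \<noteq> {}\<close> \<open>finite D\<close> by (metis mem_tr)
  ultimately show False using Min_le[of D "Min D - p"] assms(3) by linarith
qed


section \<open>Local actions on finite sets\<close>

text \<open>Nothing relates the permutations of different words, not even of the empty one; where
  products are respected is recorded pointwise by \<open>good\<close>.\<close>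

definition qact :: "'x set \<Rightarrow> (int \<times> int set \<Rightarrow> 'x \<Rightarrow> 'x) \<Rightarrow> bool"
  where "qact X \<phi> \<longleftrightarrow> finite X \<and> (\<forall>g. bij_betw (\<phi> g) X X)"

definition good :: "'x set \<Rightarrow> (int \<times> int set \<Rightarrow> 'x \<Rightarrow> 'x) \<Rightarrow> nat \<Rightarrow> 'x set"
  where "good X \<phi> N = {x \<in> X. \<forall>g\<in>wbox N. \<forall>h\<in>wbox N. \<phi> g (\<phi> h x) = \<phi> (g \<odot> h) x}"

definition orb :: "(int \<times> int set \<Rightarrow> 'x \<Rightarrow> 'x) \<Rightarrow> int set \<Rightarrow> 'x \<Rightarrow> 'x set"
  where "orb \<phi> I x = (\<lambda>S. \<phi> (0, S) x) ` Pow I"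

text \<open>An action of the lamplighter group is a pair of permutations \<open>a\<close>, \<open>t\<close> such that \<open>a\<close> is an
  involution commuting with all \<open>t\<^sup>-\<^sup>i a t\<^sup>i\<close>. In the last clause \<open>z = t\<^sup>-\<^sup>i a t\<^sup>i x\<close>.\<close>

definition lampact :: "'x set \<Rightarrow> ('x \<Rightarrow> 'x) \<Rightarrow> ('x \<Rightarrow> 'x) \<Rightarrow> bool"
  where "lampact P a t \<longleftrightarrow> bij_betw a P P \<and> bij_betw t P P \<and> (\<forall>x\<in>P. a (a x) = x) \<and>
    (\<forall>i. \<forall>x\<in>P. \<forall>z\<in>P. (t ^^ i) z = a ((t ^^ i) x) \<longrightarrow> (t ^^ i) (a z) = a ((t ^^ i) (a x)))"

locale local_action =
  fixes X :: "'x set" and \<phi> :: "int \<times> int set \<Rightarrow> 'x \<Rightarrow> 'x"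
  assumes qact: "qact X \<phi>"
begin

lemma finX [simp]: "finite X"
  using qact by (simp add: qact_def)

lemma closed [simp]: "x \<in> X \<Longrightarrow> \<phi> g x \<in> X"
  using qact bij_betwE[of "\<phi> g" X X] unfolding qact_def by blast

lemma inj: "x \<in> X \<Longrightarrow> y \<in> X \<Longrightarrow> \<phi> g x = \<phi> g y \<longleftrightarrow> x = y"
  using qact unfolding qact_def bij_betw_def inj_on_def by metis

lemma good_mono: "M \<le> N \<Longrightarrow> good X \<phi> N \<subseteq> good X \<phi> M"
  using wbox_mono[of M N] by (fastforce simp: good_def)

lemma good_X: "x \<in> good X \<phi> N \<Longrightarrow> x \<in> X"
  by (simp add: good_def)

lemma good_mult: "x \<in> good X \<phi> N \<Longrightarrow> g \<in> wbox N \<Longrightarrow> h \<in> wbox N \<Longrightarrow> \<phi> g (\<phi> h x) = \<phi> (g \<odot> h) x"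
  by (simp add: good_def)

text \<open>Injectivity turns the idempotence of the identity word at \<open>x\<close> into
  triviality.\<close>

lemma good_one:
  assumes "x \<in> good X \<phi> N" shows "\<phi> (0, {}) x = x"
proof -
  have "\<phi> (0, {}) (\<phi> (0, {}) x) = \<phi> (0, {}) x"
    using good_mult[OF assms, of "(0, {})" "(0, {})"] by (simp add: wbox_def)
  then show ?thesis using inj good_X[OF assms] by (metis closed)
qed

text \<open>All words are evaluated at \<open>x\<close> itself: \<open>h \<odot> k\<close> has
  radius \<open>2 * N\<close> and \<open>k \<odot> g\<close> has radius \<open>N + M\<close>, whence
  the loss.\<close>

lemma good_move:
  assumes x: "x \<in> good X \<phi> (2 * N + M)" and g: "g \<in> wbox M"
  shows "\<phi> g x \<in> good X \<phi> N"
  unfolding good_def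
proof (intro CollectI conjI ballI)
  show "\<phi> g x \<in> X" using good_X[OF x] by simp
  fix h k assume h: "h \<in> wbox N" and k: "k \<in> wbox N"
  have sub: "wbox N \<subseteq> wbox (2 * N + M)" "wbox M \<subseteq> wbox (2 * N + M)"
    "wbox (N + M) \<subseteq> wbox (2 * N + M)" "wbox (N + N) \<subseteq> wbox (2 * N + M)"
    by (intro wbox_mono; simp)+
  note sub = sub[THEN subsetD]
  have "\<phi> h (\<phi> k (\<phi> g x)) = \<phi> h (\<phi> (k \<odot> g) x)"
    using good_mult[OF x, of k g] g k sub by simp
  also have "\<dots> = \<phi> (h \<odot> (k \<odot> g)) x"
    using good_mult[OF x, of h "k \<odot> g"] h wbox_mult[OF k g] sub by simp
  also have "\<dots> = \<phi> (h \<odot> k \<odot> g) x" by (simp add: lmul_assoc)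
  also have "\<dots> = \<phi> (h \<odot> k) (\<phi> g x)"
    using good_mult[OF x, of "h \<odot> k" g] g wbox_mult[OF h k] sub by simp
  finally show "\<phi> h (\<phi> k (\<phi> g x)) = \<phi> (h \<odot> k) (\<phi> g x)" .
qed

section \<open>Orbits under the lamps of a window\<close>

lemma orb_X: "x \<in> X \<Longrightarrow> orb \<phi> I x \<subseteq> X"
  by (auto simp: orb_def)

lemma finite_orb: "x \<in> X \<Longrightarrow> finite (orb \<phi> I x)"
  using orb_X finX finite_subset by blast

lemma orb_mono: "I \<subseteq> J \<Longrightarrow> orb \<phi> I x \<subseteq> orb \<phi> J x"
  by (auto simp: orb_def)

lemma orb_self: "x \<in> good X \<phi> N \<Longrightarrow> x \<in> orb \<phi> I x"
  unfolding orb_def by (rule image_eqI[of _ _ "{}"]) (simp_all add: good_one)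

lemma orb_closed:
  assumes "x \<in> good X \<phi> N" "I \<subseteq> {- int N..int N}" "z \<in> orb \<phi> I x" "S \<subseteq> I"
  shows "\<phi> (0, S) z \<in> orb \<phi> I x"
proof -
  obtain T where T: "T \<subseteq> I" "z = \<phi> (0, T) x" using assms(3) by (auto simp: orb_def)
  have "(0, S) \<in> wbox N" "(0, T) \<in> wbox N" using assms T by (auto simp: wbox_def)
  then have "\<phi> (0, S) z = \<phi> (0, sd S T) x"
    using good_mult[OF assms(1)] T by simp
  then show ?thesis unfolding orb_def using T assms(4) by (auto intro!: imageI simp del: mem_sd simp: sd_subset)
qed

lemma orb_sym:
  assumes "x \<in> good X \<phi> N" "I \<subseteq> {- int N..int N}" "S \<subseteq> I"
  shows "\<phi> (0, S) (\<phi> (0, S) x) = x"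
  using assms good_mult[OF assms(1), of "(0, S)" "(0, S)"] good_one[OF assms(1)] by (auto simp: wbox_def)

text \<open>One configuration is kept per orbit point. Two of them that differ by a product of
  stabilising configurations send \<open>x\<close> to the same point, so
  \<open>card_mult_le_power\<close> applies.\<close>

lemma stab_orb:
  assumes x: "x \<in> good X \<phi> N" and I: "I \<subseteq> {- int N..int N}"
  shows "card (orb \<phi> I x) * card {S. S \<subseteq> I \<and> \<phi> (0, S) x = x} \<le> 2 ^ card I"
proof -
  have fI: "finite I" using I finite_subset by blast
  have b: "S \<subseteq> I \<Longrightarrow> (0, S) \<in> wbox N" for S using I by (auto simp: wbox_def)
  obtain R where R: "R \<subseteq> Pow I" "inj_on (\<lambda>S. \<phi> (0, S) x) R" "orb \<phi> I x = (\<lambda>S. \<phi> (0, S) x) ` R"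
    unfolding orb_def using subset_image_inj[of "(\<lambda>S. \<phi> (0, S) x) ` Pow I" "\<lambda>S. \<phi> (0, S) x" "Pow I"] by auto
  have "card R * card {S. S \<subseteq> I \<and> \<phi> (0, S) x = x} \<le> 2 ^ card I"
  proof (rule card_mult_le_power[OF fI R(1)])
    fix r r' s s' assume *: "r \<in> R" "r' \<in> R" "s \<in> {S. S \<subseteq> I \<and> \<phi> (0, S) x = x}"
      "s' \<in> {S. S \<subseteq> I \<and> \<phi> (0, S) x = x}" and eq: "sd r r' = sd s s'"
    have "\<phi> (0, sd s s') x = x"
      using good_mult[OF x, of "(0, s)" "(0, s')"] b * by simp
    then have 1: "\<phi> (0, sd r r') x = x" using eq by simp
    have "sd r r' \<subseteq> I" using R(1) * by (intro sd_subset) auto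
    have "\<phi> (0, r') x = \<phi> (0, r') (\<phi> (0, sd r r') x)" using 1 by simp
    also have "\<dots> = \<phi> (0, sd r' (sd r r')) x"
      using good_mult[OF x, of "(0, r')" "(0, sd r r')"] b[OF \<open>sd r r' \<subseteq> I\<close>] b[of r'] * R(1) by auto
    also have "sd r' (sd r r') = r" by (auto simp: set_eq_iff)
    finally show "r = r'" using R(2) * by (auto simp: inj_on_def)
  qed auto
  then show ?thesis using R(2,3) by (simp add: card_image)
qed

text \<open>Pairs of a set \<open>S\<close> inside \<open>J\<close> and a point \<open>z\<close> of
  the translate of \<open>E\<close> by \<open>S\<close> are counted twice: each translate has
  \<open>card E\<close> points, each \<open>z\<close> lies on at most \<open>2 ^ card I / K\<close>
  translates, and \<open>card I - card J = p\<close>.\<close>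

lemma card_exceptional:
  fixes K :: nat
  assumes p: "0 < p" "p \<le> int k" and pb: "(p, b) \<in> wbox k"
  defines "E \<equiv> {x \<in> good X \<phi> (5 * k). \<phi> (p, b) x = x \<and> K \<le> card (orb \<phi> {- int k..int k} x)}"
  shows "card E * K \<le> 2 ^ nat p * card X"
proof -
  define I where "I = {- int k..int k}"
  define J where "J = {- int k..int k - p}"
  define c where "c S = sd S (tr p S)" for S
  have EX: "E \<subseteq> X" by (auto simp: E_def good_def)
  have fJ: "finite J" by (simp add: J_def)
  have JI: "J \<subseteq> I" using p by (auto simp: J_def I_def)
  have cI: "c S \<subseteq> I" if "S \<subseteq> J" for S using that p by (fastforce simp: c_def J_def I_def)
  have bI: "b \<subseteq> I" using pb by (auto simp: wbox_def I_def)
  have bx: "(0, S) \<in> wbox (2*k)" "(p, S) \<in> wbox (2*k)" if "S \<subseteq> I" for S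
    using that p by (auto simp: wbox_def I_def)
  have E_good: "x \<in> good X \<phi> (5 * k)" if "x \<in> E" for x using that by (simp add: E_def)
  have bx5: "(0, S) \<in> wbox (5*k)" "(p, S) \<in> wbox (5*k)" if "S \<subseteq> I" for S
    using that p by (auto simp: wbox_def I_def)
  \<comment> \<open>The word is the conjugate of \<open>(p, b)\<close> by the lamps
    \<open>S\<close>.\<close>
  have fix_z: "\<phi> (p, sd b (c S)) (\<phi> (0, S) x) = \<phi> (0, S) x" if "x \<in> E" "S \<subseteq> J" for x S
  proof -
    have "\<phi> (p, sd b (c S)) (\<phi> (0, S) x) = \<phi> (p, sd b S) x"
      using good_mult[OF E_good[OF that(1)], of "(p, sd b (c S))" "(0, S)"]
        bx5[of S] bx5[OF sd_subset[OF bI cI[OF that(2)]]] that JI by (auto simp: c_def sd_assoc)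
    also have "\<dots> = \<phi> (0, S) (\<phi> (p, b) x)"
      using good_mult[OF E_good[OF that(1)], of "(0, S)" "(p, b)"] bx5[of S] bx5[OF bI] that JI
      by (auto simp: sd_commute)
    finally show ?thesis using that by (simp add: E_def)
  qed
  have P: "card {S \<in> Pow J. z \<in> \<phi> (0, S) ` E} * K \<le> 2 ^ card I" for z
  proof (cases "{S \<in> Pow J. z \<in> \<phi> (0, S) ` E} = {}")
    case False
    then obtain S0 x where S0: "S0 \<subseteq> J" "x \<in> E" "z = \<phi> (0, S0) x" by auto
    \<comment> \<open>\<open>5 * k = 2 * (2 * k) + k\<close>: after a move by lamps within
      \<open>k\<close>, products of words of radius \<open>2 * k\<close> are still respected, which
      suffices for the commutators below.\<close>
    have zg: "z \<in> good X \<phi> (2 * k)"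
      using good_move[of x "2 * k" k "(0, S0)"] E_good[OF S0(2)] S0 JI by (auto simp: wbox_def I_def)
    \<comment> \<open>Relative to the fixed translate \<open>S0\<close>: the conjugates for
      \<open>S\<close> and for \<open>S0\<close> both fix \<open>z\<close>, so their quotient
      \<open>c (sd S S0)\<close> does, and it determines \<open>S\<close>.\<close>
    have "card {S \<in> Pow J. z \<in> \<phi> (0, S) ` E} \<le> card {S. S \<subseteq> I \<and> \<phi> (0, S) x = x}"
    proof (rule card_inj_on_le)
      show "inj_on (\<lambda>S. c (sd S S0)) {S \<in> Pow J. z \<in> \<phi> (0, S) ` E}"
      proof (rule inj_onI)
        fix S T assume "S \<in> {S \<in> Pow J. z \<in> \<phi> (0, S) ` E}" "T \<in> {S \<in> Pow J. z \<in> \<phi> (0, S) ` E}"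
          and "c (sd S S0) = c (sd T S0)"
        then have "sd S S0 = sd T S0"
          using sd_tr_inject[of "sd S S0" "sd T S0" p] p finite_subset[OF _ fJ] S0 by (auto simp: c_def)
        then show "S = T" by (auto simp: set_eq_iff)
      qed
      show "finite {S. S \<subseteq> I \<and> \<phi> (0, S) x = x}"
        by (rule finite_subset[of _ "Pow I"]) (auto simp: I_def)
      show "(\<lambda>S. c (sd S S0)) ` {S \<in> Pow J. z \<in> \<phi> (0, S) ` E} \<subseteq> {S. S \<subseteq> I \<and> \<phi> (0, S) x = x}"
      proof clarify
        fix S x' assume S: "S \<subseteq> J" "x' \<in> E" "z = \<phi> (0, S) x'"
        have 1: "c (sd S S0) \<subseteq> I" using S S0 by (intro cI sd_subset)
        have cc: "c (sd S S0) = sd (c S) (c S0)" by (auto simp: c_def tr_sd)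
        have "\<phi> (0, c (sd S S0)) z = \<phi> (0, c (sd S S0)) (\<phi> (p, sd b (c S0)) z)"
          using fix_z[OF S0(2,1)] S0(3) by simp
        also have "\<dots> = \<phi> (p, sd b (c S)) z"
          using good_mult[OF zg, of "(0, c (sd S S0))" "(p, sd b (c S0))"] bx[OF 1]
            bx[OF sd_subset[OF bI cI[OF S0(1)]]]
          by (simp add: cc sd_assoc) (simp add: sd_left_commute sd_commute)
        also have "\<dots> = z" using fix_z[OF S(2,1)] S(3) by simp
        finally have 2: "\<phi> (0, c (sd S S0)) (\<phi> (0, S0) x) = \<phi> (0, S0) x" using S0(3) by simp
        have S0I: "S0 \<subseteq> I" using S0 JI by simp
        \<comment> \<open>Lamps commute, so a configuration that fixes the translate of
          \<open>x\<close> by \<open>S0\<close> also fixes \<open>x\<close>.\<close>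
        have "\<phi> (0, S0) (\<phi> (0, c (sd S S0)) x) = \<phi> (0, c (sd S S0)) (\<phi> (0, S0) x)"
          using good_mult[OF E_good[OF S0(2)], of "(0, S0)" "(0, c (sd S S0))"]
            good_mult[OF E_good[OF S0(2)], of "(0, c (sd S S0))" "(0, S0)"] bx5[OF 1] bx5[OF S0I]
          by (simp add: sd_commute)
        then have "\<phi> (0, c (sd S S0)) x = x"
          using 2 inj[of "\<phi> (0, c (sd S S0)) x" x "(0, S0)"] S0(2) EX by auto
        with 1 show "c (sd S S0) \<subseteq> I \<and> \<phi> (0, c (sd S S0)) x = x" by simp
      qed
    qed
    then have "card {S \<in> Pow J. z \<in> \<phi> (0, S) ` E} * K \<le>
        card {S. S \<subseteq> I \<and> \<phi> (0, S) x = x} * card (orb \<phi> I x)"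
      using S0(2) by (intro mult_le_mono) (auto simp: E_def I_def)
    also have "\<dots> \<le> 2 ^ card I"
      using stab_orb[OF E_good[OF S0(2)], of I] by (auto simp: I_def mult.commute)
    finally show ?thesis .
  next
    case True then show ?thesis by (metis card.empty mult_0 zero_le)
  qed
  have "2 ^ card J * card E = (\<Sum>S\<in>Pow J. card (\<phi> (0, S) ` E))"
  proof -
    have "card (\<phi> (0, S) ` E) = card E" for S
      using EX inj by (intro card_image inj_onI) blast
    then show ?thesis using fJ by (simp add: card_Pow)
  qed
  also have "\<dots> = (\<Sum>S\<in>Pow J. \<Sum>z\<in>X. if z \<in> \<phi> (0, S) ` E then 1 else 0)"
  proof (rule sum.cong[OF refl])
    fix S
    have "\<phi> (0, S) ` E = {z \<in> X. z \<in> \<phi> (0, S) ` E}" using EX by auto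
    then have "card (\<phi> (0, S) ` E) = card {z \<in> X. z \<in> \<phi> (0, S) ` E}" by simp
    then show "card (\<phi> (0, S) ` E) = (\<Sum>z\<in>X. if z \<in> \<phi> (0, S) ` E then 1 else 0)"
      by (simp add: sum.If_cases Int_def)
  qed
  also have "\<dots> = (\<Sum>z\<in>X. card {S \<in> Pow J. z \<in> \<phi> (0, S) ` E})"
    using fJ by (subst sum.swap) (simp add: sum.If_cases Int_def)
  finally have "2 ^ card J * card E * K = (\<Sum>z\<in>X. card {S \<in> Pow J. z \<in> \<phi> (0, S) ` E} * K)"
    by (simp add: sum_distrib_right)
  also have "\<dots> \<le> (\<Sum>z\<in>X. 2 ^ card I)" by (rule sum_mono) (rule P)
  also have "\<dots> = 2 ^ card J * (2 ^ nat p * card X)"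
  proof -
    have "card I = card J + nat p" using p by (simp add: I_def J_def)
    then show ?thesis by (simp add: power_add)
  qed
  finally show ?thesis by (simp add: mult.assoc)
qed

end

section \<open>Exact actions\<close>

lemma bij_betw_funpow_self: "bij_betw t P P \<Longrightarrow> bij_betw (t ^^ i) P P"
proof (induction i)
  case (Suc i) then show ?case using bij_betw_trans[of "t ^^ i" P P t P] by (simp add: comp_def)
qed simp

lemma funpow_mem: "bij_betw t P P \<Longrightarrow> x \<in> P \<Longrightarrow> (t ^^ i) x \<in> P"
  using bij_betw_funpow_self[of t P i] bij_betwE by blast

lemma lampactD:
  assumes "lampact P a t" "x \<in> P"
  shows "a x \<in> P" "t x \<in> P" "(t ^^ i) x \<in> P" "a (a x) = x"
  using assms bij_betwE[of a P P] bij_betwE[of t P P] funpow_mem[of t P x i]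
  by (simp_all add: lampact_def)

text \<open>Serves for the points left over by all pieces.\<close>

lemma lampact_id: "lampact P (\<lambda>x. x) (\<lambda>x. x)"
proof -
  have "((\<lambda>x. x) ^^ i) y = y" for i and y :: 'a by (induction i) auto
  then show ?thesis by (auto simp: lampact_def bij_betw_def)
qed

lemma lampact_transport:
  assumes L: "lampact P a t" and \<pi>: "bij_betw \<pi> P Q"
    and a': "\<And>x. x \<in> P \<Longrightarrow> a' (\<pi> x) = \<pi> (a x)" and t': "\<And>x. x \<in> P \<Longrightarrow> t' (\<pi> x) = \<pi> (t x)"
  shows "lampact Q a' t'"
proof -
  have Q: "Q = \<pi> ` P" and inj: "inj_on \<pi> P" using \<pi> by (auto simp: bij_betw_def)
  have ba: "bij_betw a P P" and bt: "bij_betw t P P" using L by (auto simp: lampact_def)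
  note aP = lampactD[OF L]
  have tr: "bij_betw f' Q Q" if "bij_betw f P P" "\<And>x. x \<in> P \<Longrightarrow> f' (\<pi> x) = \<pi> (f x)" for f f'
  proof -
    have "bij_betw (f' \<circ> \<pi>) P Q"
      using bij_betw_trans[OF that(1) \<pi>] that(2) by (subst bij_betw_cong[of _ _ "\<pi> \<circ> f"]) auto
    then show ?thesis using bij_betw_comp_iff[OF \<pi>, of f' Q] by simp
  qed
  have pw: "(t' ^^ i) (\<pi> x) = \<pi> ((t ^^ i) x)" if "x \<in> P" for x i
    using that by (induction i) (simp_all add: t' aP)
  show ?thesis
    unfolding lampact_def
  proof (intro conjI allI ballI impI)
    show "bij_betw a' Q Q" "bij_betw t' Q Q" by (rule tr[OF ba a'] tr[OF bt t'], assumption)+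
    show "a' (a' x) = x" if "x \<in> Q" for x
      using that L by (auto simp: Q a' aP lampact_def)
    fix i x z assume "x \<in> Q" "z \<in> Q" and eq: "(t' ^^ i) z = a' ((t' ^^ i) x)"
    then obtain u v where uv: "u \<in> P" "v \<in> P" "x = \<pi> u" "z = \<pi> v" by (auto simp: Q)
    then have "\<pi> ((t ^^ i) v) = \<pi> (a ((t ^^ i) u))" using eq by (simp add: pw a' aP)
    then have "(t ^^ i) v = a ((t ^^ i) u)" using inj uv aP by (simp add: inj_on_def)
    then have "(t ^^ i) (a v) = a ((t ^^ i) (a u))" using L uv by (auto simp: lampact_def)
    then show "(t' ^^ i) (a' z) = a' ((t' ^^ i) (a' x))" using uv by (simp add: pw a' aP)
  qed
qed

lemma lampact_cong:
  assumes "lampact P a t" "\<And>x. x \<in> P \<Longrightarrow> a' x = a x" "\<And>x. x \<in> P \<Longrightarrow> t' x = t x"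
  shows "lampact P a' t'"
  using assms lampact_transport[of P a t "\<lambda>x. x" P a' t'] by (auto simp: bij_betw_def)

text \<open>Small orbits may overlap, so the point \<open>z\<close> of the commutation clause may
  come from another member than \<open>x\<close>; injectivity of \<open>t ^^ i\<close> on the union
  identifies it with the preimage found inside the member containing \<open>x\<close>.\<close>

lemma lampact_Union:
  assumes L: "\<And>P. P \<in> \<P> \<Longrightarrow> lampact P a t" and inj: "inj_on t (\<Union>\<P>)"
  shows "lampact (\<Union>\<P>) a t"
proof -
  note aP = lampactD[OF L]
  have sur: "\<exists>y\<in>P. (t ^^ i) y = x" if "P \<in> \<P>" "x \<in> P" for P x i
    using bij_betw_funpow_self[of t P i] L[OF that(1)] that(2) unfolding lampact_def bij_betw_def by (metis imageE)
  have b: "bij_betw t (\<Union>\<P>) (\<Union>\<P>)"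
    unfolding bij_betw_def
  proof (intro conjI inj equalityI subsetI)
    fix x assume "x \<in> \<Union>\<P>"
    then show "x \<in> t ` \<Union>\<P>" using sur[of _ x 1] by force
  qed (use aP(2) in blast)
  have injn: "inj_on (t ^^ i) (\<Union>\<P>)" for i
    using bij_betw_funpow_self[OF b] by (simp add: bij_betw_def)
  show ?thesis
    unfolding lampact_def
  proof (intro conjI allI ballI impI b)
    show "bij_betw a (\<Union>\<P>) (\<Union>\<P>)"
      by (rule bij_betw_byWitness[where f' = a]) (use aP(1,4) in blast)+
    show "a (a x) = x" if "x \<in> \<Union>\<P>" for x using that aP(4) by blast
    fix i x z assume "x \<in> \<Union>\<P>" "z \<in> \<Union>\<P>" and eq: "(t ^^ i) z = a ((t ^^ i) x)"
    then obtain P where P: "P \<in> \<P>" "x \<in> P" by blast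
    obtain z' where z': "z' \<in> P" "(t ^^ i) z' = a ((t ^^ i) x)" using sur[OF P(1) aP(1)[OF P(1) aP(3)[OF P]]] by blast
    then have "z = z'" using injn[of i] eq P \<open>z \<in> \<Union>\<P>\<close> by (auto simp: inj_on_def)
    then show "(t ^^ i) (a z) = a ((t ^^ i) (a x))"
      using z' P L[OF P(1)] by (auto simp: lampact_def)
  qed
qed

text \<open>The action of the quotient \<open>\<int>/2 \<wr> \<int>/m\<close> induced from an action of its lamp group.\<close>

lemma lampact_induced:
  assumes m: "0 < m" and eQ: "\<And>j q. j < m \<Longrightarrow> q \<in> Q \<Longrightarrow> e j q \<in> Q"
    and inv: "\<And>j q. j < m \<Longrightarrow> q \<in> Q \<Longrightarrow> e j (e j q) = q"
    and comm: "\<And>i j q. i < m \<Longrightarrow> j < m \<Longrightarrow> q \<in> Q \<Longrightarrow> e i (e j q) = e j (e i q)"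
  shows "lampact (Q \<times> {..<m}) (\<lambda>(q, j). (e j q, j)) (\<lambda>(q, j). (q, Suc j mod m))"
proof -
  define t :: "'a \<times> nat \<Rightarrow> 'a \<times> nat" where "t = (\<lambda>(q, j). (q, Suc j mod m))"
  have pw: "(t ^^ i) (q, j) = (q, (j + i) mod m)" if "j < m" for q j i
    using that by (induction i) (simp_all add: t_def mod_Suc_eq)
  have pm: "(t ^^ m) x = x" if "x \<in> Q \<times> {..<m}" for x
    using that by (cases x) (simp add: pw)
  \<comment> \<open>The inverse of \<open>t\<close> is \<open>t ^^ (m - 1)\<close>.\<close>
  have m1: "m = Suc (m - 1)" using m by simp
  have cl: "(t ^^ i) x \<in> Q \<times> {..<m}" if "x \<in> Q \<times> {..<m}" for x i
    using that m by (cases x) (simp add: pw)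
  have "bij_betw t (Q \<times> {..<m}) (Q \<times> {..<m})"
  proof (rule bij_betw_byWitness[where f' = "t ^^ (m - 1)"])
    show "\<forall>x\<in>Q \<times> {..<m}. (t ^^ (m - 1)) (t x) = x"
      using pm by (metis comp_apply funpow.simps(2) funpow_swap1 m1)
    show "\<forall>x\<in>Q \<times> {..<m}. t ((t ^^ (m - 1)) x) = x"
      using pm by (metis comp_apply funpow.simps(2) m1)
    show "t ` (Q \<times> {..<m}) \<subseteq> Q \<times> {..<m}" using m by (auto simp: t_def)
    show "(t ^^ (m - 1)) ` (Q \<times> {..<m}) \<subseteq> Q \<times> {..<m}" using cl by blast
  qed
  moreover have "bij_betw (\<lambda>(q, j). (e j q, j)) (Q \<times> {..<m}) (Q \<times> {..<m})"
    by (rule bij_betw_byWitness[where f' = "\<lambda>(q, j). (e j q, j)"]) (auto simp: inv eQ)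
  ultimately show ?thesis
    unfolding lampact_def t_def[symmetric]
  proof (intro conjI allI ballI impI)
    show "(case (case x of (q, j) \<Rightarrow> (e j q, j)) of (q, j) \<Rightarrow> (e j q, j)) = x" if "x \<in> Q \<times> {..<m}" for x
      using that by (auto simp: inv)
    fix i x z assume "x \<in> Q \<times> {..<m}" "z \<in> Q \<times> {..<m}"
      and eq: "(t ^^ i) z = (case (t ^^ i) x of (q, j) \<Rightarrow> (e j q, j))"
    then obtain q j q' j' where x: "x = (q, j)" "q \<in> Q" "j < m" and z: "z = (q', j')" "q' \<in> Q" "j' < m"
      by auto
    define l where "l = (j + i) mod m"
    have l: "l < m" using m by (simp add: l_def)
    have q': "q' = e l q" and "(j' + i) mod m = (j + i) mod m" using eq by (auto simp: x z pw l_def)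
    \<comment> \<open>Adding \<open>m * i - i\<close> completes the shift by \<open>i\<close> to a
      multiple of \<open>m\<close>, which cancels it within the natural numbers.\<close>
    then have "(j' + i + (m * i - i)) mod m = (j + i + (m * i - i)) mod m"
      by (metis mod_add_left_eq)
    moreover have "n + i + (m * i - i) = n + m * i" for n using m by (cases m) auto
    ultimately have "j' = j" using x z by simp
    then show "(t ^^ i) (case z of (q, j) \<Rightarrow> (e j q, j)) =
      (case (t ^^ i) (case x of (q, j) \<Rightarrow> (e j q, j)) of (q, j) \<Rightarrow> (e j q, j))"
      using x z l by (simp add: pw q' comm flip: l_def)
  qed
qed

lemma (in local_action) funpow_phi:
  assumes "x \<in> good X \<phi> N" "i \<le> N"
  shows "(\<phi> (1, {}) ^^ i) x = \<phi> (int i, {}) x"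
  using assms(2)
proof (induction i)
  case 0 then show ?case using good_one[OF assms(1)] by simp
next
  case (Suc i)
  then have "(\<phi> (1, {}) ^^ Suc i) x = \<phi> (1, {}) (\<phi> (int i, {}) x)" by simp
  also have "\<dots> = \<phi> (int (Suc i), {}) x"
    using good_mult[OF assms(1), of "(1, {})" "(int i, {})"] Suc.prems by (simp add: pair_in_wbox)
  finally show ?case .
qed

lemma exists_period:
  assumes "finite P" "card P \<le> R" "bij_betw t P P" "x \<in> P"
  shows "\<exists>d\<in>{1..R}. (t ^^ d) x = x"
proof -
  have "\<not> inj_on (\<lambda>i. (t ^^ i) x) {0..R}"
  proof
    assume "inj_on (\<lambda>i. (t ^^ i) x) {0..R}"
    then have "card {0..R} \<le> card P"
      by (rule card_inj_on_le) (use funpow_mem assms in \<open>auto\<close>)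
    then show False using assms(2) by simp
  qed
  then obtain i j where ij: "i < j" "j \<le> R" "(t ^^ i) x = (t ^^ j) x"
    unfolding inj_on_def by (metis atLeastAtMost_iff linorder_neqE_nat)
  then have "(t ^^ i) ((t ^^ (j - i)) x) = (t ^^ i) x"
    by (metis comp_apply funpow_add le_add_diff_inverse less_imp_le)
  then have "(t ^^ (j - i)) x = x"
    using bij_betw_funpow_self[OF assms(3), of i] funpow_mem[OF assms(3,4)] assms(4)
    by (meson bij_betw_imp_inj_on inj_onD)
  then show ?thesis using ij by (intro bexI[of _ "j - i"]) auto
qed

text \<open>\<open>fact R\<close> is a common period for all permutations of sets with at most
  \<open>R\<close> points; it reduces arbitrary powers of the generator to exponents within a fixed
  box.\<close>

lemma funpow_fact:
  assumes "finite P" "card P \<le> R" "bij_betw t P P" "x \<in> P"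
  shows "(t ^^ i) x = (t ^^ (i mod fact R)) x"
proof -
  obtain d where d: "d \<in> {1..R}" "(t ^^ d) x = x" using exists_period[OF assms] by blast
  then have "d dvd fact R" by (intro dvd_fact) auto
  then have "(i mod fact R) mod d = i mod d" by (simp add: mod_mod_cancel)
  then show ?thesis using funpow_mod_eq[OF d(2), of i] funpow_mod_eq[OF d(2), of "i mod fact R"] by simp
qed


section \<open>Small orbits\<close>

context local_action
begin

text \<open>Only forward closure under the two generators is asked; finiteness adds their inverses
  and thereby all words of the box.\<close>

definition small_orbit :: "nat \<Rightarrow> nat \<Rightarrow> 'x set \<Rightarrow> bool"
  where "small_orbit N R C \<longleftrightarrow> C \<subseteq> good X \<phi> N \<and> card C \<le> R \<and>
    \<phi> (0, {0}) ` C \<subseteq> C \<and> \<phi> (1, {}) ` C \<subseteq> C"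

definition fin_part :: "nat \<Rightarrow> nat \<Rightarrow> 'x set"
  where "fin_part N R = \<Union>{C. small_orbit N R C}"

lemma small_orbit_finite: "small_orbit N R C \<Longrightarrow> finite C"
  unfolding small_orbit_def using good_X finX by (meson finite_subset subsetI subset_iff)

lemma fin_part_good: "fin_part N R \<subseteq> good X \<phi> N"
  by (auto simp: fin_part_def small_orbit_def)

lemma small_orbit_bij:
  assumes "small_orbit N R C" shows "bij_betw (\<phi> (1, {})) C C" "bij_betw (\<phi> (0, {0})) C C"
proof -
  have i: "inj_on (\<phi> g) C" for g
    using assms inj good_X unfolding small_orbit_def by (meson inj_onI subsetD)
  have "bij_betw (\<phi> g) C C" if "\<phi> g ` C \<subseteq> C" for g
    unfolding bij_betw_def using endo_inj_surj[OF small_orbit_finite[OF assms] that i] i by simp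
  then show "bij_betw (\<phi> (1, {})) C C" "bij_betw (\<phi> (0, {0})) C C"
    using assms unfolding small_orbit_def by simp_all
qed

text \<open>Each word of the box is built from the generators without leaving the box: inverses by
  finiteness, the lamp at \<open>i\<close> as the conjugate of the lamp at \<open>0\<close> by
  \<open>t ^ i\<close>, a configuration lamp by lamp.\<close>

lemma small_orbit_closed:
  assumes so: "small_orbit N R C" and N: "1 \<le> N" and g: "g \<in> wbox N" and z: "z \<in> C"
  shows "\<phi> g z \<in> C"
proof -
  have OG: "z \<in> good X \<phi> N" if "z \<in> C" for z using so that by (auto simp: small_orbit_def)
  have a: "\<phi> (0, {0}) z \<in> C" and t: "\<phi> (1, {}) z \<in> C" if "z \<in> C" for z
    using so that by (auto simp: small_orbit_def)
  have t': "\<phi> (-1, {}) z \<in> C" if z: "z \<in> C" for z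
  proof -
    obtain w where w: "w \<in> C" "z = \<phi> (1, {}) w"
      using small_orbit_bij(1)[OF so] z by (auto simp: bij_betw_def)
    then have "\<phi> (-1, {}) z = w"
      using good_mult[OF OG[OF w(1)], of "(-1, {})" "(1, {})"] good_one[OF OG[OF w(1)]] N
      by (simp add: pair_in_wbox)
    then show ?thesis using w by simp
  qed
  have tk: "\<phi> (int k, {}) z \<in> C \<and> \<phi> (- int k, {}) z \<in> C" if "k \<le> N" "z \<in> C" for k z
    using that
  proof (induction k)
    case 0 then show ?case using good_one[OF OG] by simp
  next
    case (Suc k)
    have "\<phi> (int (Suc k), {}) z = \<phi> (1, {}) (\<phi> (int k, {}) z)"
      "\<phi> (- int (Suc k), {}) z = \<phi> (-1, {}) (\<phi> (- int k, {}) z)"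
      using good_mult[OF OG[OF Suc.prems(2)], of "(1, {})" "(int k, {})"]
        good_mult[OF OG[OF Suc.prems(2)], of "(-1, {})" "(- int k, {})"] Suc.prems(1) N
      by (simp_all add: pair_in_wbox)
    then show ?case using Suc t t' by simp
  qed
  have tk: "\<phi> (k, {}) z \<in> C" if "\<bar>k\<bar> \<le> int N" "z \<in> C" for k z
    using that tk[of "nat \<bar>k\<bar>" z] by (cases "0 \<le> k") auto
  have ai: "\<phi> (0, {i}) z \<in> C" if i: "\<bar>i\<bar> \<le> int N" and z: "z \<in> C" for i z
  proof -
    have "\<phi> (0, {i}) z = \<phi> (i, {}) (\<phi> (0, {0}) (\<phi> (- i, {}) z))"
      using good_mult[OF OG[OF z], of "(0, {0})" "(- i, {})"]
        good_mult[OF OG[OF z], of "(i, {})" "(- i, {0})"] i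
      by (simp add: pair_in_wbox)
    then show ?thesis using tk[OF _ a[OF tk[OF _ z, of "- i"]], of i] i by simp
  qed
  have aS: "\<phi> (0, S) z \<in> C" if "finite S" "S \<subseteq> {- int N..int N}" "z \<in> C" for S z
    using that
  proof (induction S)
    case empty then show ?case using good_one[OF OG] by simp
  next
    case (insert i S)
    then have "sd {i} S = insert i S" by (auto simp: set_eq_iff)
    then have "\<phi> (0, insert i S) z = \<phi> (0, {i}) (\<phi> (0, S) z)"
      using good_mult[OF OG[OF insert.prems(2)], of "(0, {i})" "(0, S)"] insert.prems(1)
      by (simp add: wbox_def)
    then show ?case using ai insert by (simp add: abs_le_iff minus_le_iff)
  qed
  obtain k S where kS: "g = (k, S)" by (cases g)
  then have *: "\<bar>k\<bar> \<le> int N" "S \<subseteq> {- int N..int N}" using g by (auto simp: wbox_def)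
  then have "\<phi> (0, S) (\<phi> (k, {}) z) = \<phi> g z"
    using good_mult[OF OG[OF z], of "(0, S)" "(k, {})"] kS g by (auto simp: wbox_def)
  then show ?thesis using aS[OF _ *(2) tk[OF *(1) z]] finite_subset[OF *(2)] by simp
qed

lemma fin_part_closed: "1 \<le> N \<Longrightarrow> g \<in> wbox N \<Longrightarrow> \<phi> g ` fin_part N R \<subseteq> fin_part N R"
  unfolding fin_part_def using small_orbit_closed by blast

text \<open>The relations at all distances reduce to finitely many: on a small orbit
  \<open>t ^ i\<close> equals \<open>t ^ j\<close> with \<open>j = i mod fact R\<close>, and
  \<open>fact R \<le> N\<close> puts the relation for \<open>j\<close> into the box where products
  are respected.\<close>

lemma lampact_fin_part:
  assumes N: "fact R \<le> N" shows "lampact (fin_part N R) (\<phi> (0, {0})) (\<phi> (1, {}))"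
  unfolding fin_part_def
proof (rule lampact_Union)
  show "inj_on (\<phi> (1, {})) (\<Union>{C. small_orbit N R C})"
    using inj fin_part_good good_X unfolding fin_part_def inj_on_def by blast
  fix P assume "P \<in> {C. small_orbit N R C}"
  then have so: "small_orbit N R P" by simp
  have fN: "1 \<le> N" using N fact_ge_1[of R, where 'a = nat] by linarith
  have PG: "z \<in> good X \<phi> N" if "z \<in> P" for z using so that by (auto simp: small_orbit_def)
  show "lampact P (\<phi> (0, {0})) (\<phi> (1, {}))"
    unfolding lampact_def
  proof (intro conjI ballI allI impI small_orbit_bij[OF so])
    show aa: "\<phi> (0, {0}) (\<phi> (0, {0}) x) = x" if "x \<in> P" for x
      using good_mult[OF PG[OF that], of "(0, {0})" "(0, {0})"] good_one[OF PG[OF that]]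
      by (simp add: pair_in_wbox)
    fix i x z assume x: "x \<in> P" and z: "z \<in> P"
      and eq: "(\<phi> (1, {}) ^^ i) z = \<phi> (0, {0}) ((\<phi> (1, {}) ^^ i) x)"
    define j where "j = i mod fact R"
    have j: "j \<le> N" using N mod_less_divisor[OF fact_gt_zero, of i R] unfolding j_def by linarith
    have pw: "(\<phi> (1, {}) ^^ i) y = \<phi> (int j, {}) y" if "y \<in> P" for y
      using funpow_fact[OF small_orbit_finite[OF so] _ small_orbit_bij(1)[OF so] that, of R i]
        funpow_phi[OF PG[OF that] j] so by (simp add: j_def small_orbit_def)
    have jb: "(int j, {}) \<in> wbox N" "(- int j, {}) \<in> wbox N" "(int j, {0}) \<in> wbox N"
      "(int j, {int j}) \<in> wbox N" "(0, {0}) \<in> wbox N" "(0, {- int j}) \<in> wbox N"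
      using j by (auto simp: pair_in_wbox)
    have aP: "\<phi> (0, {0}) y \<in> P" if "y \<in> P" for y using so that by (auto simp: small_orbit_def)
    have "\<phi> (int j, {}) z = \<phi> (0, {0}) (\<phi> (int j, {}) x)" using eq pw x z by simp
    also have "\<dots> = \<phi> (int j, {}) (\<phi> (0, {- int j}) x)"
      using good_mult[OF PG[OF x]] jb by simp
    finally have zx: "z = \<phi> (0, {- int j}) x"
      using inj good_X PG x z by (metis closed)
    have "\<phi> (int j, {}) (\<phi> (0, {0}) z) = \<phi> (int j, {int j}) z"
      using good_mult[OF PG[OF z]] jb by simp
    also have "\<dots> = \<phi> (int j, sd {int j} {0}) x"
      using zx good_mult[OF PG[OF x], of "(int j, {int j})" "(0, {- int j})"] jb by simp
    also have "\<dots> = \<phi> (0, {0}) (\<phi> (int j, {}) (\<phi> (0, {0}) x))"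
      using good_mult[OF PG[OF x], of "(int j, {})" "(0, {0})"]
        good_mult[OF PG[OF x], of "(0, {0})" "(int j, {int j})"] jb by (simp add: sd_commute)
    finally show "(\<phi> (1, {}) ^^ i) (\<phi> (0, {0}) z) = \<phi> (0, {0}) ((\<phi> (1, {}) ^^ i) (\<phi> (0, {0}) x))"
      using pw x z aP by simp
  qed
qed

text \<open>If a point is fixed by some \<open>(p, b)\<close> and its orbit under the lamps of a long window is short,
  then already two consecutive windows give the same orbit \<open>Y\<close>, which \<open>t ^ p\<close> preserves.\<close>

lemma mem_fin_part:
  assumes pb: "(p, b) \<in> wbox M" "0 < p" and fix_x: "\<phi> (p, b) x = x"
    and k: "k = M * (K + 1)" and short: "card (orb \<phi> {- int k..int k} x) < K"
    and x: "x \<in> good X \<phi> (2 * N + 4 * k)"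
  shows "x \<in> fin_part N (M * K)"
proof -
  \<comment> \<open>Radii grow by \<open>M\<close>, the largest possible cursor, so that shifting a
    configuration by \<open>p\<close> moves it at most one window further; \<open>I K\<close> is the
    window of radius \<open>k\<close>.\<close>
  define I where "I i = {- int (M * (i + 1))..int (M * (i + 1))}" for i
  have mono: "I i \<subseteq> I j" if "i \<le> j" for i j
  proof -
    have "M * (i + 1) \<le> M * (j + 1)" using that by simp
    then show ?thesis by (simp only: I_def atLeastatMost_subset_iff) linarith
  qed
  have xX: "x \<in> X" using x by (rule good_X)
  \<comment> \<open>Strict growth in all \<open>K\<close> steps would force more than
    \<open>K\<close> points in the last orbit.\<close>
  have "\<exists>i<K. card (orb \<phi> (I i) x) = card (orb \<phi> (I (Suc i)) x)"
  proof (rule ccontr)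
    assume neg: "\<not> ?thesis"
    have "i + 1 \<le> card (orb \<phi> (I i) x)" if "i \<le> K" for i
      using that
    proof (induction i)
      case 0
      have "x \<in> orb \<phi> (I 0) x" using orb_self x by blast
      then show ?case using finite_orb[OF xX] by (metis One_nat_def Suc_leI add_0 card_gt_0_iff empty_iff)
    next
      case (Suc i)
      have "card (orb \<phi> (I i) x) \<le> card (orb \<phi> (I (Suc i)) x)"
        by (intro card_mono finite_orb xX orb_mono mono) simp
      then show ?case using Suc neg by (metis Suc_eq_plus1 Suc_leD Suc_le_eq Suc_leI le_neq_implies_less less_le_trans)
    qed
    from this[of K] short show False by (simp add: I_def k)
  qed
  then obtain i where i: "i < K" "card (orb \<phi> (I i) x) = card (orb \<phi> (I (Suc i)) x)" by blast
  define Y where "Y = orb \<phi> (I i) x"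
  have Y: "Y = orb \<phi> (I (Suc i)) x"
    unfolding Y_def by (rule card_subset_eq) (use i finite_orb xX orb_mono mono in auto)
  have pM: "p \<le> int M" and bM: "b \<subseteq> {- int M..int M}" using pb by (auto simp: wbox_def)
  have step: "u \<in> I (Suc i)" if "\<bar>u - v\<bar> \<le> int M" "v \<in> I i" for u v
    using that by (auto simp: I_def algebra_simps abs_le_iff)
  have IK: "I j \<subseteq> {- int k..int k}" if "j \<le> K" for j
    using mono[OF that] by (simp add: I_def k)
  have MI: "{- int M..int M} \<subseteq> I j" for j by (auto simp: I_def algebra_simps)
  have wb: "(q, S) \<in> wbox (2 * N + 4 * k)" if "\<bar>q\<bar> \<le> int k" "S \<subseteq> {- 2 * int k..2 * int k}" for q S
  proof -
    have "u \<in> S \<Longrightarrow> \<bar>u\<bar> \<le> 2 * int k" for u using that(2) by (auto simp: abs_le_iff)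
    then show ?thesis using that by (fastforce simp: pair_in_wbox)
  qed
  have Mk: "int M \<le> int k" by (simp add: k)
  have wS: "(0, S) \<in> wbox (2 * N + 4 * k)" if "S \<subseteq> I j" "j \<le> K" for S j
    using that IK[of j] by (intro wb) auto
  have wq: "(q, {}) \<in> wbox (2 * N + 4 * k)" if "0 \<le> q" "q \<le> p" for q
    using that pM Mk by (intro wb) auto
  have wqS: "(q, tr q S) \<in> wbox (2 * N + 4 * k)" if "0 \<le> q" "q \<le> p" "S \<subseteq> I j" "j \<le> K" for q S j
    using that IK[of j] pM Mk by (intro wb) (auto simp: subset_iff)
  \<comment> \<open>The levels below \<open>p\<close> suffice because \<open>t ^ p\<close> maps
    \<open>Y\<close> to itself; this gives the size bound \<open>M * K\<close>.\<close>
  define C where "C = (\<Union>q\<in>{0..<p}. \<phi> (q, {}) ` Y)"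
  \<comment> \<open>\<open>t ^ p\<close> carries \<open>S x\<close> to the shifted lamps applied to
    \<open>t ^ p x = b x\<close>; the total configuration lies in the next window, whose orbit is
    again \<open>Y\<close>.\<close>
  have tpY: "\<phi> (p, {}) y \<in> Y" if y: "y \<in> Y" for y
  proof -
    obtain S where S: "S \<subseteq> I i" "y = \<phi> (0, S) x" using y by (auto simp: Y_def orb_def)
    have bI: "b \<subseteq> I i" using bM MI by blast
    have pbw: "(p, b) \<in> wbox (2 * N + 4 * k)" using bI IK[of i] i(1) pM Mk pb(2) by (intro wb) auto
    have "\<phi> (p, {}) x = \<phi> (0, b) (\<phi> (p, b) x)"
      using good_mult[OF x, of "(0, b)" "(p, b)"] pbw wS[OF bI] i(1) by simp
    then have px: "\<phi> (p, {}) x = \<phi> (0, b) x" using fix_x by simp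
    have ST: "tr p S \<subseteq> I (Suc i)" using S(1) pM pb(2) by (auto intro!: step[of _ "_ - p"])
    have "\<phi> (p, {}) y = \<phi> (0, tr p S) (\<phi> (p, {}) x)"
      using good_mult[OF x, of "(p, {})" "(0, S)"] good_mult[OF x, of "(0, tr p S)" "(p, {})"]
        wq[of p] wS[OF S(1)] wS[OF ST] i(1) pb(2) S(2) by simp
    also have "\<dots> = \<phi> (0, sd (tr p S) b) x"
      using px good_mult[OF x, of "(0, tr p S)" "(0, b)"] wS[OF ST] wS[OF bI] i(1) by simp
    also have "\<dots> \<in> orb \<phi> (I (Suc i)) x"
      unfolding orb_def using ST bM MI[of "Suc i"] by (intro imageI PowI sd_subset) auto
    finally show ?thesis using Y by simp
  qed
  have YX: "Y \<subseteq> X" using xX orb_X by (auto simp: Y_def)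
  have Yg: "y = \<phi> (0, {}) y" if y: "y \<in> Y" for y
  proof -
    obtain S where S: "S \<subseteq> I i" "y = \<phi> (0, S) x" using y by (auto simp: Y_def orb_def)
    then show ?thesis using good_mult[OF x, of "(0, {})" "(0, S)"] wS[OF S(1)] wS[of "{}" i] i(1) by simp
  qed
  have "small_orbit N (M * K) C"
    unfolding small_orbit_def
  proof (intro conjI subsetI)
    have "card C \<le> (\<Sum>q\<in>{0..<p}. card (\<phi> (q, {}) ` Y))" unfolding C_def by (rule card_UN_le) simp
    also have "\<dots> \<le> (\<Sum>q\<in>{0..<p}. card Y)" using finite_orb[OF xX] by (intro sum_mono card_image_le) (simp add: Y_def)
    also have "\<dots> \<le> M * card Y" using pM pb(2) by (simp add: nat_le_iff)
    finally have 1: "card C \<le> M * card Y" .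
    have "card Y \<le> card (orb \<phi> {- int k..int k} x)"
      unfolding Y_def using IK[of i] i by (intro card_mono finite_orb xX orb_mono) auto
    then have "M * card Y \<le> M * K" using short by simp
    then show "card C \<le> M * K" using 1 by linarith
  next
    fix z assume "z \<in> C"
    then obtain q S where qS: "0 \<le> q" "q < p" "S \<subseteq> I i" "z = \<phi> (q, {}) (\<phi> (0, S) x)"
      by (auto simp: C_def Y_def orb_def)
    then have "z = \<phi> (q, tr q S) x" using good_mult[OF x, of "(q, {})" "(0, S)"] wq[of q] wS[OF qS(3)] i(1) by simp
    moreover have "(q, tr q S) \<in> wbox (4 * k)"
    proof -
      have "\<bar>u\<bar> \<le> int k" if "u \<in> S" for u using that qS(3) IK[of i] i by (auto simp: subset_iff abs_le_iff)
      then show ?thesis using qS pM Mk by (fastforce simp: pair_in_wbox)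
    qed
    ultimately show "z \<in> good X \<phi> N" using good_move[OF x] by simp
  next
    fix w assume "w \<in> \<phi> (0, {0}) ` C"
    then obtain q S where qS: "0 \<le> q" "q < p" "S \<subseteq> I i" "w = \<phi> (0, {0}) (\<phi> (q, {}) (\<phi> (0, S) x))"
      by (auto simp: C_def Y_def orb_def)
    \<comment> \<open>At level \<open>q\<close> the lamp under the cursor is the lamp
      \<open>- q\<close> seen from \<open>Y\<close>.\<close>
    have ST: "sd {- q} S \<subseteq> I (Suc i)"
      using qS pM MI[of "Suc i"] mono[of i "Suc i"] by (intro sd_subset) auto
    have 1: "(0, {0}) \<in> wbox (2 * N + 4 * k)" by (simp add: pair_in_wbox)
    have "w = \<phi> (q, tr q (sd {- q} S)) x"
      using good_mult[OF x, of "(q, {})" "(0, S)"] good_mult[OF x, of "(0, {0})" "(q, tr q S)"]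
        1 wq[of q] wqS[of q S i] wS[OF qS(3)] qS i(1) by (simp add: tr_sd)
    also have "\<dots> = \<phi> (q, {}) (\<phi> (0, sd {- q} S) x)"
      using good_mult[OF x, of "(q, {})" "(0, sd {- q} S)"] wq[of q] wS[OF ST] qS i(1) by simp
    finally have w: "w = \<phi> (q, {}) (\<phi> (0, sd {- q} S) x)" .
    have "\<phi> (0, sd {- q} S) x \<in> Y" unfolding Y orb_def using ST by blast
    then show "w \<in> C" unfolding w C_def using qS(1,2) by (intro UN_I[of q] imageI) auto
  next
    fix w assume "w \<in> \<phi> (1, {}) ` C"
    then obtain q y where qy: "0 \<le> q" "q < p" "y \<in> Y" "w = \<phi> (1, {}) (\<phi> (q, {}) y)"
      by (auto simp: C_def)
    then obtain S where S: "S \<subseteq> I i" "y = \<phi> (0, S) x" by (auto simp: Y_def orb_def)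
    have w: "w = \<phi> (q + 1, {}) y"
      using good_mult[OF x, of "(q, {})" "(0, S)"] good_mult[OF x, of "(1, {})" "(q, tr q S)"]
        good_mult[OF x, of "(q + 1, {})" "(0, S)"] wq[of q] wq[of 1] wq[of "q + 1"] wqS[of q S i] wS[OF S(1)] qy S i(1)
      by (simp add: add.commute)
    show "w \<in> C"
    proof (cases "q + 1 < p")
      case True then show ?thesis using w qy by (auto simp: C_def)
    next
      case False
      then have "q + 1 = p" using qy(2) by simp
      then have "w = \<phi> (p, {}) y" using w by simp
      then have "w \<in> Y" using tpY qy by simp
      then have "w \<in> \<phi> (0, {}) ` Y" using Yg by blast
      then show ?thesis unfolding C_def using pb(2) by (intro UN_I[of 0]) auto
    qed
  qed
  moreover have "x \<in> C"
  proof -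
    have "x \<in> Y" unfolding Y_def using orb_self[OF x] .
    then have "x \<in> \<phi> (0, {}) ` Y" using Yg by blast
    then show ?thesis unfolding C_def using pb(2) by (intro UN_I[of 0]) auto
  qed
  ultimately show ?thesis by (auto simp: fin_part_def)
qed

end

section \<open>Tiles\<close>

lemma lampact_transport_ex:
  assumes "lampact P a t" "bij_betw \<pi> P Q"
  shows "\<exists>a' t'. lampact Q a' t' \<and> (\<forall>x\<in>P. a' (\<pi> x) = \<pi> (a x) \<and> t' (\<pi> x) = \<pi> (t x))"
proof -
  have "inv_into P \<pi> (\<pi> x) = x" if "x \<in> P" for x
    using assms(2) that by (simp add: bij_betw_def)
  then show ?thesis
    using lampact_transport[OF assms, of "\<lambda>y. \<pi> (a (inv_into P \<pi> y))" "\<lambda>y. \<pi> (t (inv_into P \<pi> y))"]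
    by (intro exI[of _ "\<lambda>y. \<pi> (a (inv_into P \<pi> y))"] exI[of _ "\<lambda>y. \<pi> (t (inv_into P \<pi> y))"]) simp
qed

definition defect :: "(int \<times> int set \<Rightarrow> 'x \<Rightarrow> 'x) \<Rightarrow> ('x \<Rightarrow> 'x) \<Rightarrow> ('x \<Rightarrow> 'x) \<Rightarrow> 'x set \<Rightarrow> 'x set"
  where "defect \<phi> a t T = {z \<in> T. a z \<noteq> \<phi> (0, {0}) z \<or> t z \<noteq> \<phi> (1, {}) z}"

definition boundary :: "(int \<times> int set \<Rightarrow> 'x \<Rightarrow> 'x) \<Rightarrow> nat \<Rightarrow> 'x set \<Rightarrow> 'x set"
  where "boundary \<phi> r T = (\<Union>g\<in>wbox r. \<phi> g ` T) - T"

text \<open>\<open>\<beta>\<close> bounds the damage of an exact action,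
  \<open>(r, \<delta>)\<close> the boundary that later, smaller tiles must avoid, and
  \<open>R\<close> the size, so that discarding a single tile is harmless.\<close>

definition tile_ok :: "'x set \<Rightarrow> (int \<times> int set \<Rightarrow> 'x \<Rightarrow> 'x) \<Rightarrow> real \<Rightarrow> nat \<Rightarrow> real \<Rightarrow> nat \<Rightarrow> 'x set \<Rightarrow> bool"
  where "tile_ok X \<phi> \<beta> r \<delta> R T \<longleftrightarrow> T \<subseteq> X \<and> T \<noteq> {} \<and> card T \<le> R \<and>
    (\<exists>a t. lampact T a t \<and> real (card (defect \<phi> a t T)) \<le> \<beta> * real (card T)) \<and>
    real (card (boundary \<phi> r T)) \<le> \<delta> * real (card T)"

definition nonper :: "'x set \<Rightarrow> (int \<times> int set \<Rightarrow> 'x \<Rightarrow> 'x) \<Rightarrow> nat \<Rightarrow> 'x set"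
  where "nonper X \<phi> M = {x \<in> good X \<phi> M. \<forall>p b. (p, b) \<in> wbox M \<longrightarrow> 0 < p \<longrightarrow> \<phi> (p, b) x \<noteq> x}"

text \<open>The words that reach a tile from its base point \<open>y\<close> form a Folner set: lamps and cursor stay
  in a window of length \<open>m\<close>.\<close>

definition tile :: "(int \<times> int set \<Rightarrow> 'x \<Rightarrow> 'x) \<Rightarrow> nat \<Rightarrow> 'x \<Rightarrow> 'x set"
  where "tile \<phi> m y = (\<Union>j<m. \<phi> (int j, {}) ` orb \<phi> {- int m<..0} y)"

context local_action
begin

lemma nonper_mono: "M \<le> N \<Longrightarrow> nonper X \<phi> N \<subseteq> nonper X \<phi> M"
  using good_mono[of M N] wbox_mono[of M N] unfolding nonper_def by blast

context
  fixes m M :: nat and y :: 'x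
  assumes m: "0 < m" and mM: "8 * m \<le> M" and y: "y \<in> nonper X \<phi> M"
begin

text \<open>With this window the lamp under the cursor at level \<open>j < m\<close> is the lamp
  \<open>- j\<close> of the base orbit and hence available, so that the lamp generator preserves
  every level.\<close>

private abbreviation "V \<equiv> {- int m<..0}"
private abbreviation "Q \<equiv> orb \<phi> V y"

section \<open>Levels of a tile and the exact action on it\<close>

lemma yg: "y \<in> good X \<phi> M" using y by (simp add: nonper_def)

lemma yX: "y \<in> X" using yg good_X by blast

lemma wM: "\<bar>k\<bar> \<le> 4 * int m \<Longrightarrow> (\<And>u. u \<in> S \<Longrightarrow> \<bar>u\<bar> \<le> 4 * int m) \<Longrightarrow> (k, S) \<in> wbox M"
  using mM by (fastforce simp: pair_in_wbox)

lemma wV: "S \<subseteq> V \<Longrightarrow> \<bar>k\<bar> \<le> int m \<Longrightarrow> (k, S) \<in> wbox M"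
  by (rule wM) (auto simp: subset_iff abs_le_iff)

lemma wtr: "S \<subseteq> V \<Longrightarrow> \<bar>j\<bar> \<le> int m \<Longrightarrow> \<bar>k\<bar> \<le> int m \<Longrightarrow> (k, tr j S) \<in> wbox M"
  by (rule wM) (fastforce simp: subset_iff)+

lemma orb_elim:
  assumes "q \<in> Q"
  obtains S where "S \<subseteq> V" "q = \<phi> (0, S) y"
  using assms by (auto simp: orb_def)

lemma phi_level:
  assumes "S \<subseteq> V" "\<bar>j\<bar> \<le> int m" shows "\<phi> (j, {}) (\<phi> (0, S) y) = \<phi> (j, tr j S) y"
  using good_mult[OF yg, of "(j, {})" "(0, S)"] wV[of "{}" j] wV[of S 0] assms by simp

text \<open>Equal points on levels \<open>i < j\<close> give, after applying the inverse of the
  first word, a word with cursor \<open>j - i > 0\<close> that fixes \<open>y\<close>, which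
  \<open>nonper\<close> excludes.\<close>

lemma level_disjoint:
  assumes q: "q \<in> Q" "q' \<in> Q" and ij: "i < j" "j < m"
  shows "\<phi> (int i, {}) q \<noteq> \<phi> (int j, {}) q'"
proof
  assume eq: "\<phi> (int i, {}) q = \<phi> (int j, {}) q'"
  obtain S where S: "S \<subseteq> V" "q = \<phi> (0, S) y" using q(1) by (rule orb_elim)
  obtain S' where S': "S' \<subseteq> V" "q' = \<phi> (0, S') y" using q(2) by (rule orb_elim)
  define d where "d = int j - int i"
  have d: "0 < d" "d \<le> int m" using ij by (auto simp: d_def)
  have "\<phi> (- int i, S) (\<phi> (int i, tr (int i) S) y) = y"
    using good_mult[OF yg, of "(- int i, S)" "(int i, tr (int i) S)"] good_one[OF yg] ij S(1)
      wV[of S "- int i"] wtr[of S "int i" "int i"] by simp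
  moreover have "\<phi> (- int i, S) (\<phi> (int j, tr (int j) S') y) = \<phi> (d, sd S (tr d S')) y"
    using good_mult[OF yg, of "(- int i, S)" "(int j, tr (int j) S')"] ij S(1) S'(1)
      wV[of S "- int i"] wtr[of S' "int j" "int j"] by (simp add: d_def)
  moreover have "(d, sd S (tr d S')) \<in> wbox M"
  proof (rule wM)
    fix u assume "u \<in> sd S (tr d S')"
    then have "u \<in> V \<or> u - d \<in> V" using S(1) S'(1) by auto
    then show "\<bar>u\<bar> \<le> 4 * int m" using d by (auto simp: abs_le_iff)
  qed (use d in simp)
  moreover have "\<phi> (int i, tr (int i) S) y = \<phi> (int j, tr (int j) S') y"
    using eq S S' phi_level ij by simp
  ultimately show False using y d(1) by (auto simp: nonper_def)
qed

lemma bij_tile: "bij_betw (\<lambda>(q, j). \<phi> (int j, {}) q) (Q \<times> {..<m}) (tile \<phi> m y)"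
  unfolding bij_betw_def
proof
  show "inj_on (\<lambda>(q, j). \<phi> (int j, {}) q) (Q \<times> {..<m})"
  proof (rule inj_onI)
    fix x x' assume "x \<in> Q \<times> {..<m}" "x' \<in> Q \<times> {..<m}"
      and eq: "(case x of (q, j) \<Rightarrow> \<phi> (int j, {}) q) = (case x' of (q, j) \<Rightarrow> \<phi> (int j, {}) q)"
    then obtain q i q' j where x: "x = (q, i)" "x' = (q', j)" and
      *: "q \<in> Q" "i < m" "q' \<in> Q" "j < m" by auto
    have "i = j" using level_disjoint[of q q' i j] level_disjoint[of q' q j i] * eq
      by (metis x case_prod_conv linorder_neqE_nat)
    then show "x = x'" using eq x inj orb_X[OF yX] * by (auto simp: subset_iff)
  qed
qed (auto simp: tile_def)

lemma card_tile: "card (tile \<phi> m y) = m * card Q"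
  using bij_betw_same_card[OF bij_tile] by (simp add: card_cartesian_product mult.commute)

lemma card_orb_le: "card Q \<le> 2 ^ m"
proof -
  have "card Q \<le> card (Pow V)" unfolding orb_def by (intro card_image_le) simp
  then show ?thesis by (simp add: card_Pow)
qed

lemma tile_X: "tile \<phi> m y \<subseteq> X"
  using orb_X[OF yX] closed unfolding tile_def by blast

lemma self_tile: "y \<in> tile \<phi> m y"
  unfolding tile_def using m orb_self[OF yg, of V] good_one[OF yg]
  by (intro UN_I[of 0]) (auto intro!: image_eqI[of _ _ y])

lemma tile_form:
  assumes "z \<in> tile \<phi> m y"
  obtains g where "g \<in> wbox m" "z = \<phi> g y"
proof -
  obtain j q where jq: "j < m" "q \<in> Q" "z = \<phi> (int j, {}) q" using assms by (auto simp: tile_def)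
  obtain S where S: "S \<subseteq> V" "q = \<phi> (0, S) y" using jq(2) by (rule orb_elim)
  have "z = \<phi> (int j, tr (int j) S) y" using phi_level S jq by simp
  moreover have "(int j, tr (int j) S) \<in> wbox m"
  proof -
    have "\<bar>u\<bar> \<le> int m" if "u \<in> tr (int j) S" for u
    proof -
      have "u - int j \<in> V" using that S(1) by auto
      then show ?thesis using jq(1) by (simp add: abs_le_iff)
    qed
    then show ?thesis using jq(1) by (simp add: pair_in_wbox)
  qed
  ultimately show thesis using that by blast
qed

text \<open>At level \<open>j\<close> the lamp generator acts as the lamp \<open>- j\<close> on the
  orbit, its conjugate by a power of \<open>t\<close>. Both generators agree with
  \<open>\<phi>\<close> except for the return from level \<open>m - 1\<close> to level
  \<open>0\<close>, which costs one level out of \<open>m\<close>.\<close>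

lemma tile_lampact: "\<exists>a t. lampact (tile \<phi> m y) a t \<and> card (defect \<phi> a t (tile \<phi> m y)) \<le> card Q"
proof -
  have VM: "V \<subseteq> {- int M..int M}" using mM by auto
  have V: "{- int j} \<subseteq> V" if "j < m" for j using that by simp
  have "lampact (Q \<times> {..<m}) (\<lambda>(q, j). (\<phi> (0, {- int j}) q, j)) (\<lambda>(q, j). (q, Suc j mod m))"
  proof (rule lampact_induced[OF m])
    show "\<phi> (0, {- int j}) q \<in> Q" if "j < m" "q \<in> Q" for j q
      using orb_closed[OF yg VM that(2) V[OF that(1)]] .
    have *: "\<phi> (0, {- int i}) (\<phi> (0, {- int j}) q) = \<phi> (0, sd (sd {- int i} {- int j}) S) y"
      if "i < m" "j < m" "S \<subseteq> V" "q = \<phi> (0, S) y" for i j S q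
    proof -
      have "sd {- int j} S \<subseteq> V" using that V by (intro sd_subset) auto
      then show ?thesis
        using that good_mult[OF yg, of "(0, {- int j})" "(0, S)"] wV[of S 0] wV[OF V, of j 0]
          good_mult[OF yg, of "(0, {- int i})" "(0, sd {- int j} S)"] wV[OF V, of i 0] wV[of "sd {- int j} S" 0]
        by (simp add: sd_assoc)
    qed
    show "\<phi> (0, {- int j}) (\<phi> (0, {- int j}) q) = q" if jq: "j < m" "q \<in> Q" for j q
    proof -
      obtain S where S: "S \<subseteq> V" "q = \<phi> (0, S) y" using jq(2) by (rule orb_elim)
      then show ?thesis using *[OF jq(1) jq(1) S] by simp
    qed
    show "\<phi> (0, {- int i}) (\<phi> (0, {- int j}) q) = \<phi> (0, {- int j}) (\<phi> (0, {- int i}) q)"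
      if jq: "i < m" "j < m" "q \<in> Q" for i j q
    proof -
      obtain S where S: "S \<subseteq> V" "q = \<phi> (0, S) y" using jq(3) by (rule orb_elim)
      then show ?thesis using *[OF jq(1,2) S] *[OF jq(2,1) S] by (simp add: sd_commute)
    qed
  qed
  from lampact_transport_ex[OF this bij_tile] obtain a t where
    L: "lampact (tile \<phi> m y) a t" and
    at: "\<forall>x\<in>Q \<times> {..<m}. a (case x of (q, j) \<Rightarrow> \<phi> (int j, {}) q) =
        (case (case x of (q, j) \<Rightarrow> (\<phi> (0, {- int j}) q, j)) of (q, j) \<Rightarrow> \<phi> (int j, {}) q) \<and>
      t (case x of (q, j) \<Rightarrow> \<phi> (int j, {}) q) =
        (case (case x of (q, j) \<Rightarrow> (q, Suc j mod m)) of (q, j) \<Rightarrow> \<phi> (int j, {}) q)" by blast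
  have a: "a (\<phi> (int j, {}) q) = \<phi> (int j, {}) (\<phi> (0, {- int j}) q)"
    and t: "t (\<phi> (int j, {}) q) = \<phi> (int (Suc j mod m), {}) q" if "q \<in> Q" "j < m" for q j
    using at that by auto
  have "defect \<phi> a t (tile \<phi> m y) \<subseteq> \<phi> (int (m - 1), {}) ` Q"
  proof
    fix z assume z: "z \<in> defect \<phi> a t (tile \<phi> m y)"
    then obtain j q where jq: "j < m" "q \<in> Q" "z = \<phi> (int j, {}) q" by (auto simp: tile_def defect_def)
    obtain S where S: "S \<subseteq> V" "q = \<phi> (0, S) y" using jq(2) by (rule orb_elim)
    have j4: "\<bar>int j\<bar> \<le> int m" using jq by simp
    have tS: "(int j, tr (int j) S) \<in> wbox M" using S(1) jq(1) by (intro wtr) auto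
    have "a z = \<phi> (int j, {}) (\<phi> (0, sd {- int j} S) y)"
      using a[OF jq(2,1)] jq(3) S good_mult[OF yg, of "(0, {- int j})" "(0, S)"] wV[OF V, of j 0]
        wV[of S 0] jq(1) by simp
    also have "\<dots> = \<phi> (int j, tr (int j) (sd {- int j} S)) y"
      using jq(1) S(1) by (intro phi_level sd_subset) auto
    also have "\<dots> = \<phi> (0, {0}) (\<phi> (int j, tr (int j) S) y)"
      using good_mult[OF yg _ tS, of "(0, {0})"] wM[of 0 "{0}"] by (simp add: tr_sd)
    finally have az: "a z = \<phi> (0, {0}) z" using jq(3) S phi_level[OF S(1) j4] by simp
    have "t z = \<phi> (1, {}) z" if "Suc j < m"
    proof -
      have "t z = \<phi> (int (Suc j), {}) q" using t[OF jq(2,1)] jq(3) that by simp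
      also have "\<dots> = \<phi> (1 + int j, tr (1 + int j) S) y" using S phi_level[OF S(1), of "int (Suc j)"] that by simp
      also have "\<dots> = \<phi> (1, {}) (\<phi> (int j, tr (int j) S) y)"
        using good_mult[OF yg _ tS, of "(1, {})"] wM[of 1 "{}"] m by simp
      finally show ?thesis using jq(3) S phi_level[OF S(1) j4] by simp
    qed
    then have "\<not> Suc j < m" using z az by (auto simp: defect_def)
    then have "j = m - 1" using jq(1) by simp
    then show "z \<in> \<phi> (int (m - 1), {}) ` Q" using jq by blast
  qed
  then have "card (defect \<phi> a t (tile \<phi> m y)) \<le> card (\<phi> (int (m - 1), {}) ` Q)"
    by (intro card_mono) (auto intro: finite_orb[OF yX])
  also have "\<dots> \<le> card Q" by (intro card_image_le finite_orb yX)
  finally show ?thesis using L by blast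
qed

text \<open>From a level at distance \<open>2 * r\<close> from both ends, the cursor moves by at
  most \<open>r\<close> and the toggled lamps lie within \<open>r\<close> of the origin, hence
  inside the window seen from the new level. Only words applied on the outer levels, at most
  \<open>4 * r\<close> in number, can leave the tile.\<close>

lemma tile_boundary:
  assumes r: "r \<le> m" shows "card (boundary \<phi> r (tile \<phi> m y)) \<le> card (wbox r) * (4 * r) * card Q"
proof -
  define J where "J = {j. j < m \<and> (j < 2 * r \<or> m \<le> j + 2 * r)}"
  have fJ: "finite J" by (simp add: J_def)
  have "J \<subseteq> {..<2 * r} \<union> {m - 2 * r..<m}" by (auto simp: J_def)
  then have "card J \<le> card ({..<2 * r} \<union> {m - 2 * r..<m})" by (intro card_mono) auto
  also have "\<dots> \<le> 4 * r" by (rule order.trans[OF card_Un_le]) simp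
  finally have cJ: "card J \<le> 4 * r" .
  have "boundary \<phi> r (tile \<phi> m y) \<subseteq> (\<Union>g\<in>wbox r. \<Union>j\<in>J. \<phi> g ` \<phi> (int j, {}) ` Q)"
  proof
    fix w assume "w \<in> boundary \<phi> r (tile \<phi> m y)"
    then obtain g j q where g: "g \<in> wbox r" "j < m" "q \<in> Q" "w = \<phi> g (\<phi> (int j, {}) q)" "w \<notin> tile \<phi> m y"
      by (auto simp: boundary_def tile_def)
    obtain S where S: "S \<subseteq> V" "q = \<phi> (0, S) y" using g(3) by (rule orb_elim)
    obtain k T where kT: "g = (k, T)" by (cases g)
    then have k: "\<bar>k\<bar> \<le> int r" and T: "\<And>u. u \<in> T \<Longrightarrow> \<bar>u\<bar> \<le> int r" using g(1) by (auto simp: pair_in_wbox)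
    have "j \<in> J"
    proof (rule ccontr)
      assume "j \<notin> J"
      then have j: "2 * int r \<le> int j" "int j + 2 * int r < int m" using g(2) by (auto simp: J_def)
      have tS: "(int j, tr (int j) S) \<in> wbox M" using S(1) g(2) by (intro wtr) auto
      have gM: "g \<in> wbox M" using g(1) wbox_mono[of r M] r mM by auto
      define i where "i = nat (int j + k)"
      have i: "int i = k + int j" "i < m" using j k by (auto simp: i_def)
      define S' where "S' = sd (tr (- int i) T) S"
      have "tr (- int i) T \<subseteq> V"
      proof
        fix u assume "u \<in> tr (- int i) T"
        then have "\<bar>u + int i\<bar> \<le> int r" using T by simp
        then show "u \<in> V" using j k i(1) by (simp add: abs_le_iff)
      qed
      then have S': "S' \<subseteq> V" unfolding S'_def using S(1) by (intro sd_subset) auto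
      have "w = \<phi> (k + int j, sd T (tr (k + int j) S)) y"
        using g(4) kT S phi_level[OF S(1), of "int j"] g(2) good_mult[OF yg gM tS] by simp
      also have "sd T (tr (k + int j) S) = tr (int i) S'" by (simp add: S'_def tr_sd i(1))
      also have "\<phi> (k + int j, tr (int i) S') y = \<phi> (int i, {}) (\<phi> (0, S') y)"
        using phi_level[OF S', of "int i"] i by simp
      finally have "w = \<phi> (int i, {}) (\<phi> (0, S') y)" .
      moreover have "\<phi> (0, S') y \<in> Q" using S' by (auto simp: orb_def)
      ultimately have "w \<in> tile \<phi> m y" using i(2) by (auto simp: tile_def)
      then show False using g(5) by simp
    qed
    then show "w \<in> (\<Union>g\<in>wbox r. \<Union>j\<in>J. \<phi> g ` \<phi> (int j, {}) ` Q)" using g by blast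
  qed
  then have "card (boundary \<phi> r (tile \<phi> m y)) \<le> card (\<Union>g\<in>wbox r. \<Union>j\<in>J. \<phi> g ` \<phi> (int j, {}) ` Q)"
    by (intro card_mono) (auto intro!: finite_orb[OF yX] simp: fJ)
  also have "\<dots> \<le> (\<Sum>g\<in>wbox r. card (\<Union>j\<in>J. \<phi> g ` \<phi> (int j, {}) ` Q))" by (intro card_UN_le) simp
  also have "\<dots> \<le> (\<Sum>g\<in>wbox r. \<Sum>j\<in>J. card (\<phi> g ` \<phi> (int j, {}) ` Q))"
    by (intro sum_mono card_UN_le fJ)
  also have "\<dots> \<le> (\<Sum>g\<in>wbox r. \<Sum>j\<in>J. card Q)"
    by (intro sum_mono order.trans[OF card_image_le card_image_le] finite_imageI finite_orb yX)
  also have "\<dots> \<le> card (wbox r) * (4 * r) * card Q" using cJ by simp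
  finally show ?thesis .
qed

lemma tile_ok_tile:
  assumes r: "r \<le> m" and \<beta>: "1 \<le> \<beta> * real m" and \<delta>: "real (card (wbox r) * (4 * r)) \<le> \<delta> * real m"
  shows "tile_ok X \<phi> \<beta> r \<delta> (m * 2 ^ m) (tile \<phi> m y)"
  unfolding tile_ok_def
proof (intro conjI tile_X)
  show "tile \<phi> m y \<noteq> {}" using self_tile by blast
  show "card (tile \<phi> m y) \<le> m * 2 ^ m" using card_orb_le by (simp add: card_tile)
  obtain a t where at: "lampact (tile \<phi> m y) a t" "card (defect \<phi> a t (tile \<phi> m y)) \<le> card Q"
    using tile_lampact by blast
  have "real (card (defect \<phi> a t (tile \<phi> m y))) \<le> 1 * real (card Q)" using at(2) by simp
  also have "\<dots> \<le> \<beta> * real m * real (card Q)" using \<beta> by (intro mult_right_mono) auto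
  finally show "\<exists>a t. lampact (tile \<phi> m y) a t \<and> real (card (defect \<phi> a t (tile \<phi> m y))) \<le> \<beta> * real (card (tile \<phi> m y))"
    using at(1) by (auto simp: card_tile mult.assoc)
  have "real (card (boundary \<phi> r (tile \<phi> m y))) \<le> real (card (wbox r) * (4 * r)) * real (card Q)"
    using tile_boundary[OF r] by (metis of_nat_le_iff of_nat_mult)
  also have "\<dots> \<le> \<delta> * real m * real (card Q)" using \<delta> by (intro mult_right_mono) auto
  finally show "real (card (boundary \<phi> r (tile \<phi> m y))) \<le> \<delta> * real (card (tile \<phi> m y))"
    by (simp add: card_tile mult.assoc)
qed

end

text \<open>Weighting each tile by \<open>1 / card\<close>, every point receives total weight at most \<open>1\<close>.\<close>

lemma tile_double_count:
  assumes m: "0 < m" and mM: "8 * m \<le> M" and Y: "Y \<subseteq> nonper X \<phi> M" and U: "finite U"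
    and dense: "\<And>y. y \<in> Y \<Longrightarrow> \<epsilon> * real (card (tile \<phi> m y)) \<le> real (card (tile \<phi> m y \<inter> U))"
  shows "\<epsilon> * real (card Y) \<le> real (card U)"
proof -
  define V where "V = {- int m<..0}"
  have VM: "V \<subseteq> {- int M..int M}" using mM by (auto simp: V_def)
  define c where "c y = real (card (orb \<phi> V y))" for y
  have YX: "Y \<subseteq> X" using Y good_X by (auto simp: nonper_def)
  have fY: "finite Y" using YX finX finite_subset by blast
  have Yg: "y \<in> good X \<phi> M" if "y \<in> Y" for y using that Y by (auto simp: nonper_def)
  have ct: "real (card (tile \<phi> m y)) = real m * c y" if "y \<in> Y" for y
    using card_tile[OF m mM, of y] that Y by (auto simp: c_def V_def)
  have cpos: "c y > 0" if "y \<in> Y" for y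
    using orb_self[OF Yg[OF that], of V] finite_orb[of y V] YX that by (auto simp: c_def card_gt_0_iff)
  define A where "A z j = {y \<in> Y. z \<in> \<phi> (int j, {}) ` orb \<phi> V y}" for z j
  have fA: "finite (A z j)" for z j using fY by (simp add: A_def)
  have A1: "(\<Sum>y\<in>A z j. 1 / c y) \<le> 1" for z j
  proof -
    have "1 / c y \<le> 1 / real (card (A z j))" if y: "y \<in> A z j" for y
    proof -
      \<comment> \<open>Two base points with \<open>z\<close> on the same level differ by lamps of
        the window and so share an orbit. Hence a level contributes \<open>card (A z j)\<close>
        weights, each at most \<open>1 / card (A z j)\<close>.\<close>
      have "A z j \<subseteq> orb \<phi> V y"
      proof
        fix y' assume y': "y' \<in> A z j"
        obtain S where S: "S \<subseteq> V" "z = \<phi> (int j, {}) (\<phi> (0, S) y)" using y by (auto simp: A_def orb_def)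
        obtain S' where S': "S' \<subseteq> V" "z = \<phi> (int j, {}) (\<phi> (0, S') y')" using y' by (auto simp: A_def orb_def)
        have yY: "y \<in> Y" "y' \<in> Y" using y y' by (auto simp: A_def)
        have "\<phi> (0, S) y = \<phi> (0, S') y'" using S(2) S'(2) inj yY YX by (metis closed subsetD)
        then have "y' = \<phi> (0, S') (\<phi> (0, S) y)"
          using orb_sym[OF Yg[OF yY(2)], of V S'] S'(1) VM by simp
        moreover have "\<phi> (0, S') (\<phi> (0, S) y) \<in> orb \<phi> V y"
          using orb_closed[OF Yg[OF yY(1)], of V "\<phi> (0, S) y" S'] S(1) S'(1) VM by (auto simp: orb_def)
        ultimately show "y' \<in> orb \<phi> V y" by simp
      qed
      moreover have "y \<in> X" using y YX by (auto simp: A_def)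
      ultimately have "card (A z j) \<le> card (orb \<phi> V y)" by (intro card_mono finite_orb)
      moreover have "card (A z j) > 0" using y fA by (auto simp: card_gt_0_iff)
      ultimately show ?thesis by (intro divide_left_mono) (auto simp: c_def)
    qed
    then have "(\<Sum>y\<in>A z j. 1 / c y) \<le> (\<Sum>y\<in>A z j. 1 / real (card (A z j)))" by (rule sum_mono)
    also have "\<dots> \<le> 1" by simp
    finally show ?thesis .
  qed
  have "\<epsilon> * real (card Y) = (\<Sum>y\<in>Y. \<epsilon>)" by simp
  also have "\<dots> \<le> (\<Sum>y\<in>Y. real (card (tile \<phi> m y \<inter> U)) / (real m * c y))"
  proof (rule sum_mono)
    fix y assume y: "y \<in> Y"
    show "\<epsilon> \<le> real (card (tile \<phi> m y \<inter> U)) / (real m * c y)"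
      using dense[OF y] ct[OF y] cpos[OF y] m by (simp add: pos_le_divide_eq)
  qed
  also have "\<dots> = (\<Sum>y\<in>Y. \<Sum>z\<in>U. if z \<in> tile \<phi> m y then 1 / (real m * c y) else 0)"
    using U by (intro sum.cong) (simp_all add: sum.If_cases Int_commute)
  also have "\<dots> = (\<Sum>z\<in>U. \<Sum>y\<in>Y. if z \<in> tile \<phi> m y then 1 / (real m * c y) else 0)" by (rule sum.swap)
  also have "\<dots> \<le> (\<Sum>z\<in>U. 1)"
  proof (rule sum_mono)
    fix z
    have "(\<Sum>y\<in>Y. if z \<in> tile \<phi> m y then 1 / (real m * c y) else 0)
        \<le> (\<Sum>y\<in>Y. \<Sum>j<m. if y \<in> A z j then 1 / (real m * c y) else 0)"
    proof (rule sum_mono)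
      fix y assume y: "y \<in> Y"
      have nn: "0 \<le> 1 / (real m * c y)" by (simp add: c_def)
      show "(if z \<in> tile \<phi> m y then 1 / (real m * c y) else 0) \<le> (\<Sum>j<m. if y \<in> A z j then 1 / (real m * c y) else 0)"
      proof (cases "z \<in> tile \<phi> m y")
        case True
        then obtain j where j: "j < m" "y \<in> A z j" using y by (auto simp: tile_def A_def V_def)
        have "(if y \<in> A z j then 1 / (real m * c y) else 0) \<le> (\<Sum>j<m. if y \<in> A z j then 1 / (real m * c y) else 0)"
          using j nn by (intro member_le_sum) auto
        then show ?thesis using True j by simp
      next
        case False then show ?thesis using nn by (auto intro!: sum_nonneg)
      qed
    qed
    also have "\<dots> = (\<Sum>j<m. \<Sum>y\<in>Y. if y \<in> A z j then 1 / (real m * c y) else 0)" by (rule sum.swap)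
    also have "\<dots> = (\<Sum>j<m. (\<Sum>y\<in>A z j. 1 / c y) / real m)"
    proof (rule sum.cong[OF refl])
      fix j
      have "Y \<inter> {y. y \<in> A z j} = A z j" by (auto simp: A_def)
      then show "(\<Sum>y\<in>Y. if y \<in> A z j then 1 / (real m * c y) else 0) = (\<Sum>y\<in>A z j. 1 / c y) / real m"
        using fY by (simp add: sum.If_cases sum_divide_distrib mult.commute)
    qed
    also have "\<dots> \<le> (\<Sum>j<m. 1 / real m)" using A1 by (intro sum_mono divide_right_mono) auto
    also have "\<dots> = 1" using m by simp
    finally show "(\<Sum>y\<in>Y. if z \<in> tile \<phi> m y then 1 / (real m * c y) else 0) \<le> 1" .
  qed
  finally show ?thesis by simp
qed

end

section \<open>Quasi-tilings\<close>

text \<open>The \<epsilon>-disjointness of Ornstein and Weiss, read from the end of the list: a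
  newly chosen tile goes to the front, and every suffix is again such a family.\<close>

primrec chain :: "real \<Rightarrow> 'a set list \<Rightarrow> bool"
  where "chain \<epsilon> [] = True"
  | "chain \<epsilon> (T # ts) = (real (card (T \<inter> \<Union>(set ts))) \<le> \<epsilon> * real (card T) \<and> chain \<epsilon> ts)"

definition total_card :: "'a set list \<Rightarrow> nat"
  where "total_card ts = (\<Sum>T\<leftarrow>ts. card T)"

lemma total_simps [simp]: "total_card [] = 0" "total_card (T # ts) = card T + total_card ts"
  "total_card (ts @ us) = total_card ts + total_card us"
  by (simp_all add: total_card_def)

text \<open>Each tile adds at least the proportion \<open>1 - \<epsilon>\<close> of its points to
  the union of those behind it.\<close>

lemma chain_total:
  assumes "chain \<epsilon> ts" "\<And>T. T \<in> set ts \<Longrightarrow> finite T"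
  shows "(1 - \<epsilon>) * real (total_card ts) \<le> real (card (\<Union>(set ts)))"
  using assms
proof (induction ts)
  case (Cons T ts)
  have fin: "finite T" "finite (\<Union>(set ts))" using Cons.prems(2) by auto
  have "card (T \<union> \<Union>(set ts)) + card (T \<inter> \<Union>(set ts)) = card T + card (\<Union>(set ts))"
    using card_Un_Int[OF fin] by simp
  then have "real (card (T \<union> \<Union>(set ts))) + real (card (T \<inter> \<Union>(set ts))) = real (card T) + real (card (\<Union>(set ts)))"
    by (metis of_nat_add)
  moreover have "(1 - \<epsilon>) * real (total_card ts) \<le> real (card (\<Union>(set ts)))" using Cons by simp
  ultimately show ?case using Cons.prems(1) by (simp add: algebra_simps)
qed simp

lemma card_UN_total:
  assumes "\<And>T. T \<in> set ts \<Longrightarrow> real (card (F T)) \<le> \<delta> * real (card T)"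
  shows "real (card (\<Union>T\<in>set ts. F T)) \<le> \<delta> * real (total_card ts)"
  using assms
proof (induction ts)
  case (Cons T ts)
  have "real (card (F T \<union> (\<Union>T\<in>set ts. F T))) \<le> real (card (F T)) + real (card (\<Union>T\<in>set ts. F T))"
    using card_Un_le by (metis of_nat_add of_nat_le_iff)
  also have "\<dots> \<le> \<delta> * real (card T) + \<delta> * real (total_card ts)"
    using Cons by (intro add_mono) auto
  finally show ?case by (simp add: algebra_simps)
qed simp

text \<open>The parameter \<open>c\<close> is the proportion of the space that can be covered. The set \<open>W\<close> collects the
  points with small orbits, which are tiled by their orbits.\<close>

definition covers :: "real \<Rightarrow> real \<Rightarrow> real \<Rightarrow> nat \<Rightarrow> real \<Rightarrow> nat \<Rightarrow> nat \<Rightarrow> real \<Rightarrow> bool"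
  where "covers \<beta> \<epsilon> c r \<delta> M R \<eta> \<longleftrightarrow>
    (\<forall>(X :: nat set) \<phi> W. qact X \<phi> \<longrightarrow> W \<subseteq> X \<longrightarrow> (\<forall>g\<in>wbox M. \<phi> g ` W \<subseteq> W) \<longrightarrow>
      real (card (X - W - nonper X \<phi> M)) \<le> \<eta> * real (card X) \<longrightarrow>
      (\<exists>ts. chain \<epsilon> ts \<and> (\<forall>T\<in>set ts. T \<inter> W = {} \<and> tile_ok X \<phi> \<beta> r \<delta> R T) \<and>
        c * real (card X) \<le> real (card (W \<union> \<Union>(set ts)))))"

lemma coversD:
  fixes X :: "nat set"
  assumes "covers \<beta> \<epsilon> c r \<delta> M R \<eta>" "qact X \<phi>" "W \<subseteq> X" "\<forall>g\<in>wbox M. \<phi> g ` W \<subseteq> W"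
    "real (card (X - W - nonper X \<phi> M)) \<le> \<eta> * real (card X)"
  shows "\<exists>ts. chain \<epsilon> ts \<and> (\<forall>T\<in>set ts. T \<inter> W = {} \<and> tile_ok X \<phi> \<beta> r \<delta> R T) \<and>
    c * real (card X) \<le> real (card (W \<union> \<Union>(set ts)))"
  by (rule assms(1)[unfolded covers_def, THEN spec, THEN spec, THEN spec, THEN mp, THEN mp, THEN mp, THEN mp,
    OF assms(2-5)])

text \<open>The invariance \<open>(r, \<delta>)\<close> of the tiles is prescribed after
  \<open>c\<close>, and the thresholds depend on it. This order lets the induction demand invariance
  at the scale of the smaller tiles that are added next.\<close>

definition coverable :: "real \<Rightarrow> real \<Rightarrow> real \<Rightarrow> bool"
  where "coverable \<beta> \<epsilon> c \<longleftrightarrow> (\<forall>r \<delta>. 0 < \<delta> \<longrightarrow> (\<exists>M R \<eta>. 0 < \<eta> \<and> covers \<beta> \<epsilon> c r \<delta> M R \<eta>))"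

lemma coverable_0: "coverable \<beta> \<epsilon> 0"
  unfolding coverable_def covers_def
  by (intro allI impI exI[of _ 0] exI[of _ "1 :: real"] conjI exI[of _ "[]"]) auto

lemma tile_ok_mono: "tile_ok X \<phi> \<beta> r \<delta> R T \<Longrightarrow> r' \<le> r \<Longrightarrow> \<delta> \<le> \<delta>' \<Longrightarrow> R \<le> R' \<Longrightarrow> finite X \<Longrightarrow>
    qact X \<phi> \<Longrightarrow> tile_ok X \<phi> \<beta> r' \<delta>' R' T"
proof -
  assume *: "tile_ok X \<phi> \<beta> r \<delta> R T" "r' \<le> r" "\<delta> \<le> \<delta>'" "R \<le> R'" "finite X" "qact X \<phi>"
  have fT: "finite T" using *(1) finite_subset[OF _ *(5)] by (simp add: tile_ok_def)
  have "boundary \<phi> r' T \<subseteq> boundary \<phi> r T"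
    using wbox_mono[OF *(2)] by (auto simp: boundary_def)
  then have "card (boundary \<phi> r' T) \<le> card (boundary \<phi> r T)"
    by (intro card_mono) (auto simp: boundary_def fT)
  also have "real \<dots> \<le> \<delta> * real (card T)" using * by (simp add: tile_ok_def)
  also have "\<dots> \<le> \<delta>' * real (card T)" using * by (intro mult_right_mono) auto
  finally show ?thesis using * by (simp add: tile_ok_def)
qed

text \<open>The large tiles of the induction hypothesis are almost invariant at the scale \<open>m\<close> of the new
  tiles, so that almost every remaining point is the base point of a tile of scale \<open>m\<close> disjoint from
  them; a maximal \<open>\<epsilon>\<close>-disjoint family of such tiles covers an \<open>\<epsilon>\<close>-fraction of these.\<close>

lemma coverable_step:
  assumes cov: "coverable \<beta> \<epsilon> c" and c: "c < 1" and \<beta>: "0 < \<beta>" and \<epsilon>: "0 < \<epsilon>" "\<epsilon> \<le> 1 / 2"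
  shows "coverable \<beta> \<epsilon> (c + \<epsilon> * (1 - c) / 2)"
  unfolding coverable_def
proof (intro allI impI)
  fix r :: nat and \<delta> :: real
  assume \<delta>: "0 < \<delta>"
  obtain m1 :: nat where m1: "1 / \<beta> \<le> real m1" using real_arch_simple by blast
  obtain m2 :: nat where m2: "real (card (wbox r) * (4 * r)) / \<delta> \<le> real m2" using real_arch_simple by blast
  \<comment> \<open>The scale of the new tiles: the defect \<open>1 / m\<close> is at most
    \<open>\<beta>\<close> and the boundary proportion at most \<open>\<delta>\<close>.\<close>
  define m where "m = m1 + m2 + r + 1"
  have m: "0 < m" "r \<le> m" by (simp_all add: m_def)
  have "1 / \<beta> \<le> real m" using m1 by (simp add: m_def)
  then have mb: "1 \<le> \<beta> * real m" using \<beta> by (simp add: field_simps)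
  have "real (card (wbox r) * (4 * r)) / \<delta> \<le> real m" using m2 by (simp add: m_def)
  then have md: "real (card (wbox r) * (4 * r)) \<le> \<delta> * real m" using \<delta> by (simp add: field_simps)
  \<comment> \<open>The tiles have total size at most \<open>2 * card X\<close> as
    \<open>\<epsilon> \<le> 1 / 2\<close>, so their boundaries cover at most the proportion
    \<open>(1 - c) / 4\<close>.\<close>
  define \<delta>2 where "\<delta>2 = min \<delta> ((1 - c) / 8)"
  have \<delta>2_le: "\<delta>2 \<le> (1 - c) / 8" unfolding \<delta>2_def by (rule min.cobounded2)
  have \<delta>2: "0 < \<delta>2" using \<delta> c by (simp add: \<delta>2_def)
  \<comment> \<open>Inverses of words of radius \<open>m\<close> have radius at most
    \<open>2 * m\<close>: this bounds how far a base point is from the points of its tile.\<close>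
  define r2 where "r2 = max r (2 * m)"
  obtain M1 R1 \<eta>1 where \<eta>1: "0 < \<eta>1" and cov1: "covers \<beta> \<epsilon> c r2 \<delta>2 M1 R1 \<eta>1"
    using cov \<delta>2 unfolding coverable_def by blast
  define M where "M = max M1 (8 * m)"
  define R where "R = max R1 (m * 2 ^ m)"
  define \<eta> where "\<eta> = min \<eta>1 ((1 - c) / 4)"
  have \<eta>: "0 < \<eta>" using \<eta>1 c by (simp add: \<eta>_def)
  have "covers \<beta> \<epsilon> (c + \<epsilon> * (1 - c) / 2) r \<delta> M R \<eta>"
    unfolding covers_def
  proof (intro allI impI)
    fix X :: "nat set" and \<phi> W
    assume q: "qact X \<phi>" and WX: "W \<subseteq> X" and Wc: "\<forall>g\<in>wbox M. \<phi> g ` W \<subseteq> W"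
      and np: "real (card (X - W - nonper X \<phi> M)) \<le> \<eta> * real (card X)"
    interpret local_action X \<phi> by unfold_locales (rule q)
    have "card (X - W - nonper X \<phi> M1) \<le> card (X - W - nonper X \<phi> M)"
      using nonper_mono[of M1 M] by (intro card_mono) (auto simp: M_def)
    then have "real (card (X - W - nonper X \<phi> M1)) \<le> \<eta> * real (card X)" using np by linarith
    also have "\<dots> \<le> \<eta>1 * real (card X)" by (intro mult_right_mono) (simp_all add: \<eta>_def)
    finally have np1: "real (card (X - W - nonper X \<phi> M1)) \<le> \<eta>1 * real (card X)" .
    have "\<forall>g\<in>wbox M1. \<phi> g ` W \<subseteq> W" using Wc wbox_mono[of M1 M] by (auto simp: M_def)
    from coversD[OF cov1 q WX this np1] obtain ts where ts: "chain \<epsilon> ts" "\<forall>T\<in>set ts. T \<inter> W = {} \<and> tile_ok X \<phi> \<beta> r2 \<delta>2 R1 T"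
      "c * real (card X) \<le> real (card (W \<union> \<Union>(set ts)))"
      by blast
    define U where "U = \<Union>(set ts)"
    have TX: "T \<subseteq> X" if "T \<in> set ts" for T
      using ts(2) that by (simp add: tile_ok_def)
    have fT: "finite T" if "T \<in> set ts" for T
      using TX[OF that] finX finite_subset by blast
    have UX: "U \<subseteq> X" using TX by (auto simp: U_def)
    have UW: "U \<inter> W = {}" using ts(2) by (auto simp: U_def)
    have fU: "finite U" "finite W" using UX WX finite_subset[OF _ finX] by blast+
    define B where "B = boundary \<phi> (2 * m) U"
    have "B \<subseteq> (\<Union>T\<in>set ts. boundary \<phi> r2 T)"
      unfolding B_def U_def boundary_def using wbox_mono[of "2 * m" r2] by (auto simp: r2_def)
    then have "card B \<le> card (\<Union>T\<in>set ts. boundary \<phi> r2 T)"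
      by (intro card_mono) (auto simp: boundary_def fT)
    also have "real \<dots> \<le> \<delta>2 * real (total_card ts)"
      using ts(2) by (intro card_UN_total) (auto simp: tile_ok_def)
    also have "\<dots> \<le> \<delta>2 * (2 * real (card X))"
    proof -
      have "(1 / 2) * real (total_card ts) \<le> (1 - \<epsilon>) * real (total_card ts)" using \<epsilon> by (intro mult_right_mono) auto
      also have "\<dots> \<le> real (card U)" unfolding U_def by (rule chain_total[OF ts(1) fT])
      also have "\<dots> \<le> real (card X)" using UX by (simp add: card_mono)
      finally show ?thesis using \<delta>2 by simp
    qed
    also have "\<dots> \<le> ((1 - c) / 8) * (2 * real (card X))" by (intro mult_right_mono \<delta>2_le) simp
    finally have cB: "real (card B) \<le> (1 - c) / 4 * real (card X)" by simp
    define Y where "Y = nonper X \<phi> M - W - U - B"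
    have mM: "8 * m \<le> M" by (simp add: M_def)
    have YX: "Y \<subseteq> X" using good_X by (auto simp: Y_def nonper_def)
    have fY: "finite Y" using YX finX finite_subset by blast
    have tX: "tile \<phi> m y \<subseteq> X" if "y \<in> Y" for y
      using tile_X[OF m(1) mM] that by (simp add: Y_def)
    have disj: "tile \<phi> m y \<inter> W = {}" "tile \<phi> m y \<inter> U = {}" if y: "y \<in> Y" for y
    proof -
      have yn: "y \<in> nonper X \<phi> M" using y by (simp add: Y_def)
      have rev: "\<exists>h\<in>wbox (2 * m). \<phi> h z = y" if z: "z \<in> tile \<phi> m y" for z
      proof -
        obtain g where g: "g \<in> wbox m" "z = \<phi> g y" using tile_form[OF m(1) mM yn z] .
        have "linv g \<in> wbox M" "g \<in> wbox M" "linv g \<in> wbox (2 * m)"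
          using wbox_linv[OF g(1)] g(1) wbox_mono[of "2 * m" M] wbox_mono[of m M] mM by auto
        then have "\<phi> (linv g) z = y"
          using good_mult[OF yg[OF m(1) mM yn], of "linv g" g] good_one[OF yg[OF m(1) mM yn]] g(2) by simp
        then show ?thesis using \<open>linv g \<in> wbox (2 * m)\<close> by blast
      qed
      show "tile \<phi> m y \<inter> W = {}"
      proof (rule ccontr)
        assume "tile \<phi> m y \<inter> W \<noteq> {}"
        then obtain z h where "z \<in> W" "h \<in> wbox (2 * m)" "\<phi> h z = y" using rev by blast
        then have "y \<in> W" using Wc wbox_mono[of "2 * m" M] mM by (auto simp: image_subset_iff)
        then show False using y by (simp add: Y_def)
      qed
      show "tile \<phi> m y \<inter> U = {}"
      proof (rule ccontr)
        assume "tile \<phi> m y \<inter> U \<noteq> {}"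
        then obtain z h where "z \<in> U" "h \<in> wbox (2 * m)" "\<phi> h z = y" using rev by blast
        then have "y \<in> U \<or> y \<in> B" by (auto simp: B_def boundary_def)
        then show False using y by (simp add: Y_def)
      qed
    qed
    have tpos: "real (card (tile \<phi> m y)) > 0" if "y \<in> Y" for y
    proof -
      have "y \<in> tile \<phi> m y" using self_tile[OF m(1) mM] that by (simp add: Y_def)
      then show ?thesis using finite_subset[OF tX[OF that] finX] by (auto simp: card_gt_0_iff)
    qed
    define adm where "adm us \<longleftrightarrow> set us \<subseteq> tile \<phi> m ` Y \<and> chain \<epsilon> (us @ ts)" for us
    have adm_X: "\<Union>(set us) \<subseteq> X" if "adm us" for us
      using that tX unfolding adm_def by blast
    have "adm []" using ts(1) by (simp add: adm_def)
    moreover have "\<forall>us. adm us \<longrightarrow> card (\<Union>(set us)) < Suc (card X)"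
      using adm_X card_mono[OF finX] by (simp add: less_Suc_eq_le)
    ultimately obtain us where us: "adm us" "\<And>us'. adm us' \<Longrightarrow> card (\<Union>(set us')) \<le> card (\<Union>(set us))"
      using ex_has_greatest_nat[of adm "[]" "\<lambda>us. card (\<Union>(set us))" "Suc (card X)"] by blast
    define U' where "U' = \<Union>(set us)"
    have U'X: "U' \<subseteq> X" using adm_X us by (simp add: U'_def)
    have fU': "finite U'" using U'X finX finite_subset by blast
    \<comment> \<open>A tile meeting the chosen ones in less could be put in front; maximality of
      the covered set would then place it inside \<open>U'\<close>, against
      \<open>\<epsilon> < 1\<close>.\<close>
    have dense: "\<epsilon> * real (card (tile \<phi> m y)) \<le> real (card (tile \<phi> m y \<inter> U'))" if y: "y \<in> Y" for y
    proof (rule ccontr)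
      assume neg: "\<not> ?thesis"
      have "tile \<phi> m y \<inter> \<Union>(set (us @ ts)) = tile \<phi> m y \<inter> U'"
        using disj(2)[OF y] unfolding U'_def U_def by auto
      then have "adm (tile \<phi> m y # us)" using us(1) neg y by (simp add: adm_def)
      then have "card (tile \<phi> m y \<union> U') \<le> card U'" using us(2)[of "tile \<phi> m y # us"] by (simp add: U'_def)
      then have "tile \<phi> m y \<union> U' = U'"
        using card_subset_eq[of "tile \<phi> m y \<union> U'" U'] fU' finite_subset[OF tX[OF y] finX]
        by (metis Un_upper2 card_seteq finite_UnI)
      then have "tile \<phi> m y \<inter> U' = tile \<phi> m y" by blast
      then have "real (card (tile \<phi> m y)) < \<epsilon> * real (card (tile \<phi> m y))" using neg by simp
      then show False using \<epsilon> tpos[OF y] by (simp add: mult_less_cancel_right1)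
    qed
    have "\<epsilon> * real (card Y) \<le> real (card U')"
      by (rule tile_double_count[OF m(1) mM _ fU' dense]) (auto simp: Y_def)
    moreover have U'd: "U' \<inter> (W \<union> U) = {}"
    proof -
      have "T \<inter> W = {} \<and> T \<inter> U = {}" if T: "T \<in> set us" for T
      proof -
        obtain y where "y \<in> Y" "T = tile \<phi> m y" using T us(1) unfolding adm_def by blast
        then show ?thesis using disj by simp
      qed
      then show ?thesis unfolding U'_def by blast
    qed
    moreover have "real (card X) \<le> real (card (W \<union> U)) + real (card Y) + \<eta> * real (card X) + (1 - c) / 4 * real (card X)"
    proof -
      have "X \<subseteq> (W \<union> U) \<union> Y \<union> (X - W - nonper X \<phi> M) \<union> B" by (auto simp: Y_def)
      then have "card X \<le> card ((W \<union> U) \<union> Y \<union> (X - W - nonper X \<phi> M) \<union> B)"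
        using fU fY finX by (intro card_mono) (auto simp: B_def boundary_def)
      also have "\<dots> \<le> card (W \<union> U) + card Y + card (X - W - nonper X \<phi> M) + card B"
        by (meson card_Un_le add_le_mono order.trans order_refl)
      finally have "real (card X) \<le> real (card (W \<union> U)) + real (card Y) + real (card (X - W - nonper X \<phi> M)) + real (card B)"
        by (metis of_nat_add of_nat_le_iff)
      then show ?thesis using np cB by linarith
    qed
    moreover have "\<eta> * real (card X) \<le> (1 - c) / 4 * real (card X)"
      by (rule mult_right_mono) (simp_all only: \<eta>_def min.cobounded2 of_nat_0_le_iff)
    ultimately have Y1: "real (card X) - real (card (W \<union> U)) - (1 - c) / 2 * real (card X) \<le> real (card Y)"
      and Y2: "\<epsilon> * real (card Y) \<le> real (card U')" and dj: "U' \<inter> (W \<union> U) = {}"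
      by (simp_all add: field_simps)
    \<comment> \<open>If \<open>w\<close> is the proportion covered before, the new one is at least
      \<open>w + \<epsilon> * (1 - w - (1 - c) / 2)\<close>. It increases with \<open>w\<close>, and
      \<open>w = c\<close> gives the claim.\<close>
    have "\<epsilon> * (real (card X) - real (card (W \<union> U)) - (1 - c) / 2 * real (card X)) \<le> real (card U')"
      using order.trans[OF mult_left_mono[OF Y1 less_imp_le[OF \<epsilon>(1)]] Y2] .
    moreover have "(1 - \<epsilon>) * (c * real (card X)) \<le> (1 - \<epsilon>) * real (card (W \<union> U))"
      using ts(3) \<epsilon> by (intro mult_left_mono) (auto simp: U_def)
    moreover have "real (card (W \<union> \<Union>(set (us @ ts)))) = real (card (W \<union> U)) + real (card U')"
    proof -
      have "W \<union> \<Union>(set (us @ ts)) = (W \<union> U) \<union> U'" by (auto simp: U_def U'_def)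
      then show ?thesis using card_Un_disjoint[of "W \<union> U" U'] fU fU' dj by (simp add: Int_commute)
    qed
    ultimately have "(c + \<epsilon> * (1 - c) / 2) * real (card X) \<le> real (card (W \<union> \<Union>(set (us @ ts))))"
      by (simp add: algebra_simps add_divide_distrib diff_divide_distrib)
    moreover have "T \<inter> W = {} \<and> tile_ok X \<phi> \<beta> r \<delta> R T" if T: "T \<in> set (us @ ts)" for T
    proof (cases "T \<in> set ts")
      case True
      then show ?thesis
        using ts(2) tile_ok_mono[of X \<phi> \<beta> r2 \<delta>2 R1 T r \<delta> R] q by (auto simp: r2_def \<delta>2_def R_def)
    next
      case False
      then obtain y where y: "y \<in> Y" "T = tile \<phi> m y" using T us(1) by (auto simp: adm_def)
      have "tile_ok X \<phi> \<beta> r \<delta> (m * 2 ^ m) T"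
        unfolding y(2) by (rule tile_ok_tile[OF m(1) mM _ m(2) mb md]) (use y in \<open>simp add: Y_def\<close>)
      then have "tile_ok X \<phi> \<beta> r \<delta> R T"
        using tile_ok_mono[of X \<phi> \<beta> r \<delta> "m * 2 ^ m" T r \<delta> R] q by (auto simp: R_def)
      then show ?thesis using disj(1) y by simp
    qed
    moreover have "chain \<epsilon> (us @ ts)" using us(1) by (simp add: adm_def)
    ultimately show "\<exists>ts. chain \<epsilon> ts \<and> (\<forall>T\<in>set ts. T \<inter> W = {} \<and> tile_ok X \<phi> \<beta> r \<delta> R T) \<and>
        (c + \<epsilon> * (1 - c) / 2) * real (card X) \<le> real (card (W \<union> \<Union>(set ts)))"
      by blast
  qed
  then show "\<exists>M R \<eta>. 0 < \<eta> \<and> covers \<beta> \<epsilon> (c + \<epsilon> * (1 - c) / 2) r \<delta> M R \<eta>" using \<eta> by blast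
qed

text \<open>A step multiplies the uncovered proportion \<open>1 - c\<close> by
  \<open>1 - \<epsilon> / 2\<close>.\<close>

lemma coverable_near_1:
  assumes "0 < \<beta>" "0 < \<epsilon>" "\<epsilon> \<le> 1 / 2"
  shows "\<exists>c>1 - \<epsilon>. coverable \<beta> \<epsilon> c"
proof -
  have step: "coverable \<beta> \<epsilon> (1 - (1 - \<epsilon> / 2) ^ n)" for n
  proof (induction n)
    case 0 then show ?case using coverable_0 by simp
  next
    case (Suc n)
    have "1 - (1 - \<epsilon> / 2) ^ n < 1" using assms by simp
    from coverable_step[OF Suc this assms] show ?case by (simp add: algebra_simps)
  qed
  have "(\<lambda>n. (1 - \<epsilon> / 2) ^ n) \<longlonglongrightarrow> 0" using assms by (intro LIMSEQ_realpow_zero) auto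
  then have "\<forall>\<^sub>F n in sequentially. (1 - \<epsilon> / 2) ^ n < \<epsilon>" using assms by (intro order_tendstoD) auto
  then obtain n where "(1 - \<epsilon> / 2) ^ n < \<epsilon>" by (auto simp: eventually_sequentially)
  then show ?thesis using step[of n] by (intro exI[of _ "1 - (1 - \<epsilon> / 2) ^ n"]) auto
qed

section \<open>From quasi-tilings to exact actions\<close>

text \<open>The disjoint union \<open>Z\<close> of the pieces is embedded into \<open>X\<close> by a map that agrees with the
  projection \<open>snd\<close> on a set \<open>D\<close> of representatives.\<close>

lemma assemble:
  assumes finX: "finite X" and TX: "\<And>T. T \<in> set ts \<Longrightarrow> T \<subseteq> X" and tot: "total_card ts \<le> card X"
    and L: "\<And>T. T \<in> set ts \<Longrightarrow> \<exists>a t. lampact T a t \<and> real (card (defect \<phi> a t T)) \<le> \<beta> * real (card T)"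
  defines "u \<equiv> card (\<Union>(set ts))"
  shows "\<exists>a t. lampact X a t \<and> real (card (defect \<phi> a t X)) \<le>
    (real (card X) - real u) + 2 * (real (total_card ts) - real u) + \<beta> * real (total_card ts)"
proof -
  define n where "n = length ts"
  define T where "T i = ts ! i" for i
  have Ti: "T i \<in> set ts" if "i < n" for i using that by (simp add: T_def n_def)
  have UT: "\<Union>(set ts) = (\<Union>i<n. T i)" by (auto simp: T_def n_def set_conv_nth)
  have fT: "finite (T i)" if "i < n" for i using TX[OF Ti[OF that]] finX finite_subset by blast
  obtain A \<tau> where A: "\<And>i. i < n \<Longrightarrow> lampact (T i) (A i) (\<tau> i)"
    "\<And>i. i < n \<Longrightarrow> real (card (defect \<phi> (A i) (\<tau> i) (T i))) \<le> \<beta> * real (card (T i))"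
    using L[OF Ti] by metis
  define Z where "Z = Sigma {..<n} T"
  define aZ where "aZ = (\<lambda>(i, z). (i, A i z))"
  define tZ where "tZ = (\<lambda>(i, z). (i, \<tau> i z))"
  have fZ: "finite Z" unfolding Z_def using fT by (intro finite_SigmaI) auto
  have sum_total: "(\<Sum>i<n. card (T i)) = total_card ts"
    by (simp add: total_card_def sum_list_sum_nth atLeast0LessThan n_def T_def)
  have cZ: "card Z = total_card ts" using fT sum_total by (simp add: Z_def)
  have "lampact (\<Union>((\<lambda>i. {i} \<times> T i) ` {..<n})) aZ tZ"
  proof (rule lampact_Union)
    fix P assume "P \<in> (\<lambda>i. {i} \<times> T i) ` {..<n}"
    then obtain i where i: "i < n" "P = {i} \<times> T i" by auto
    show "lampact P aZ tZ"
      by (rule lampact_transport[OF A(1)[OF i(1)], of "\<lambda>z. (i, z)"])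
        (auto simp: i bij_betw_def inj_on_def aZ_def tZ_def)
  next
    have "inj_on (\<tau> i) (T i)" if "i < n" for i
      using A(1)[OF that] by (simp add: lampact_def bij_betw_def)
    then show "inj_on tZ (\<Union>((\<lambda>i. {i} \<times> T i) ` {..<n}))" by (fastforce simp: inj_on_def tZ_def)
  qed
  moreover have "\<Union>((\<lambda>i. {i} \<times> T i) ` {..<n}) = Z" by (auto simp: Z_def)
  ultimately have LZ: "lampact Z aZ tZ" by simp
  \<comment> \<open>One copy of every covered point stays in place.\<close>
  obtain D where D: "D \<subseteq> Z" "inj_on snd D" "snd ` Z = snd ` D"
    using subset_image_inj[of "snd ` Z" snd Z] by auto
  have sZ: "snd ` Z = \<Union>(set ts)" unfolding UT Z_def by force
  have fD: "finite D" using D(1) fZ finite_subset by blast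
  have cD: "card D = u" using D sZ card_image by (metis u_def)
  have sDX: "snd ` D \<subseteq> X" unfolding D(3)[symmetric] sZ using TX by blast
  \<comment> \<open>The surplus copies fit on the uncovered points because
    \<open>card Z \<le> card X\<close>.\<close>
  have "card (Z - D) \<le> card (X - snd ` D)"
    using tot cZ cD D card_image[OF D(2)] sDX fD by (simp add: card_Diff_subset)
  then obtain g where g: "g ` (Z - D) \<subseteq> X - snd ` D" "inj_on g (Z - D)"
    using card_le_inj[of "Z - D" "X - snd ` D"] fZ finX by auto
  define \<iota> where "\<iota> d = (if d \<in> D then snd d else g d)" for d
  have \<iota>: "inj_on \<iota> Z"
  proof (rule inj_onI)
    fix d e assume de: "d \<in> Z" "e \<in> Z" "\<iota> d = \<iota> e"
    show "d = e"
    proof (cases "d \<in> D"; cases "e \<in> D")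
      assume "d \<in> D" "e \<in> D" then show ?thesis using D(2) de by (simp add: \<iota>_def inj_on_def)
    next
      assume "d \<in> D" "e \<notin> D" then show ?thesis using g(1) de by (auto simp: \<iota>_def)
    next
      assume "d \<notin> D" "e \<in> D"
      then have "g d \<in> snd ` D" "g d \<in> X - snd ` D" using g(1) de by (auto simp: \<iota>_def)
      then show ?thesis by blast
    next
      assume "d \<notin> D" "e \<notin> D" then show ?thesis using g(2) de by (simp add: \<iota>_def inj_on_def)
    qed
  qed
  define P where "P = \<iota> ` Z"
  have PX: "P \<subseteq> X"
  proof -
    have "\<iota> d \<in> X" if "d \<in> Z" for d using that sDX g(1) unfolding \<iota>_def by (cases "d \<in> D") auto
    then show ?thesis by (auto simp: P_def)
  qed
  have "bij_betw \<iota> Z P" using \<iota> by (simp add: P_def bij_betw_def)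
  then obtain a0 t0 where L0: "lampact P a0 t0"
    and at0: "\<And>d. d \<in> Z \<Longrightarrow> a0 (\<iota> d) = \<iota> (aZ d)" "\<And>d. d \<in> Z \<Longrightarrow> t0 (\<iota> d) = \<iota> (tZ d)"
    using lampact_transport_ex[OF LZ] by blast
  define a where "a x = (if x \<in> P then a0 x else x)" for x
  define t where "t x = (if x \<in> P then t0 x else x)" for x
  have "lampact (\<Union>{P, X - P}) a t"
  proof (rule lampact_Union)
    fix S assume "S \<in> {P, X - P}"
    then consider "S = P" | "S = X - P" by blast
    then show "lampact S a t"
    proof cases
      case 1 show ?thesis unfolding 1 by (rule lampact_cong[OF L0]) (simp_all add: a_def t_def)
    next
      case 2 show ?thesis unfolding 2 by (rule lampact_cong[OF lampact_id]) (simp_all add: a_def t_def)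
    qed
  next
    have "inj_on t0 P" using L0 by (simp add: lampact_def bij_betw_def)
    then have *: "x = y" if "x \<in> P" "y \<in> P" "t0 x = t0 y" for x y using that by (simp add: inj_on_def)
    show "inj_on t (\<Union>{P, X - P})"
    proof (rule inj_onI)
      fix x y assume "t x = t y"
      then show "x = y" using * lampactD(2)[OF L0, of x] lampactD(2)[OF L0, of y]
        unfolding t_def by (metis (full_types))
    qed
  qed
  moreover have "\<Union>{P, X - P} = X" using PX by auto
  ultimately have LX: "lampact X a t" by simp
  define F where "F = Sigma {..<n} (\<lambda>i. defect \<phi> (A i) (\<tau> i) (T i))"
  have fdef: "finite (defect \<phi> (A i) (\<tau> i) (T i))" if "i < n" for i using fT[OF that] by (simp add: defect_def)
  have fF: "finite F" unfolding F_def using fdef by (intro finite_SigmaI) auto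
  define Da where "Da = {d \<in> D. aZ d \<notin> D}"
  define Dt where "Dt = {d \<in> D. tZ d \<notin> D}"
  \<comment> \<open>Four sources of defects: uncovered points, representatives that the lamp
    generator sends to a surplus copy, those that the shift sends to one, and the defects within the
    pieces.\<close>
  have "defect \<phi> a t X \<subseteq> (X - \<iota> ` D) \<union> \<iota> ` Da \<union> \<iota> ` Dt \<union> \<iota> ` F"
  proof
    fix x assume x: "x \<in> defect \<phi> a t X"
    show "x \<in> (X - \<iota> ` D) \<union> \<iota> ` Da \<union> \<iota> ` Dt \<union> \<iota> ` F"
    proof (rule ccontr)
      assume neg: "\<not> ?thesis"
      then obtain d where d: "d \<in> D" "x = \<iota> d" using x by (auto simp: defect_def)
      then have dd: "aZ d \<in> D" "tZ d \<in> D" "d \<notin> F" using neg by (auto simp: Da_def Dt_def)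
      obtain i z where iz: "d = (i, z)" by (cases d)
      have dZ: "d \<in> Z" "x \<in> P" using d D(1) by (auto simp: P_def)
      have i: "i < n" "z \<in> T i" using dZ iz by (auto simp: Z_def)
      have "A i z = \<phi> (0, {0}) z" "\<tau> i z = \<phi> (1, {}) z"
        using dd(3) i iz by (auto simp: F_def defect_def)
      moreover have "a x = \<iota> (aZ d)" "t x = \<iota> (tZ d)"
        using at0[OF dZ(1)] dZ(2) by (simp_all add: a_def t_def d(2))
      then have "a x = snd (aZ d)" "t x = snd (tZ d)" "x = z"
        using d dd iz by (simp_all add: \<iota>_def)
      ultimately show False using x iz by (simp add: defect_def aZ_def tZ_def)
    qed
  qed
  then have "card (defect \<phi> a t X) \<le> card ((X - \<iota> ` D) \<union> \<iota> ` Da \<union> \<iota> ` Dt \<union> \<iota> ` F)"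
    using finX fD fF by (intro card_mono) (auto simp: Da_def Dt_def)
  also have "\<dots> \<le> card (X - \<iota> ` D) + card (\<iota> ` Da) + card (\<iota> ` Dt) + card (\<iota> ` F)"
    by (meson card_Un_le add_le_mono order.trans order_refl)
  also have "\<dots> \<le> (card X - u) + (total_card ts - u) + (total_card ts - u) + card F"
  proof (intro add_mono)
    have "\<iota> ` D = snd ` D" by (simp add: \<iota>_def)
    then show "card (X - \<iota> ` D) \<le> card X - u"
      using sDX fD cD card_image[OF D(2)] by (simp add: card_Diff_subset)
    have inj: "inj_on aZ Z" "inj_on tZ Z" and cl: "aZ ` Z \<subseteq> Z" "tZ ` Z \<subseteq> Z"
      using LZ by (auto simp: lampact_def bij_betw_def)
    have *: "card (\<iota> ` {d \<in> D. f d \<notin> D}) \<le> total_card ts - u" if "inj_on f Z" "f ` Z \<subseteq> Z" for f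
    proof -
      have "card (\<iota> ` {d \<in> D. f d \<notin> D}) \<le> card {d \<in> D. f d \<notin> D}" using fD by (intro card_image_le) simp
      also have "\<dots> \<le> card (Z - D)"
        using that D(1) fZ by (intro card_inj_on_le[of f]) (auto intro: inj_on_subset)
      finally show ?thesis using D(1) fD cD cZ by (simp add: card_Diff_subset)
    qed
    show "card (\<iota> ` Da) \<le> total_card ts - u" unfolding Da_def by (rule *[OF inj(1) cl(1)])
    show "card (\<iota> ` Dt) \<le> total_card ts - u" unfolding Dt_def by (rule *[OF inj(2) cl(2)])
    show "card (\<iota> ` F) \<le> card F" by (rule card_image_le[OF fF])
  qed
  finally have "real (card (defect \<phi> a t X)) \<le> real ((card X - u) + (total_card ts - u) + (total_card ts - u) + card F)"
    by (simp only: of_nat_le_iff)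
  also have "real (card F) \<le> \<beta> * real (total_card ts)"
  proof -
    have "real (card F) = (\<Sum>i<n. real (card (defect \<phi> (A i) (\<tau> i) (T i))))"
      using fdef by (simp add: F_def)
    also have "\<dots> \<le> (\<Sum>i<n. \<beta> * real (card (T i)))" by (intro sum_mono) (use A(2) in auto)
    also have "\<dots> = \<beta> * real (total_card ts)" by (simp flip: sum_total add: sum_distrib_left)
    finally show ?thesis .
  qed
  moreover have "u \<le> card X" using cD card_mono[OF finX sDX] card_image[OF D(2)] by simp
  moreover have "u \<le> total_card ts" using cD card_mono[OF fZ D(1)] cZ by simp
  ultimately have "real (card (defect \<phi> a t X)) \<le>
      (real (card X) - real u) + 2 * (real (total_card ts) - real u) + \<beta> * real (total_card ts)"
    by (simp add: of_nat_diff)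
  then show ?thesis using LX by blast
qed

lemma chain_append: "chain \<epsilon> (us @ vs) \<Longrightarrow> chain \<epsilon> vs"
  by (induction us) auto

text \<open>Overlaps may make the total size exceed \<open>card X\<close>, which
  \<open>assemble\<close> excludes. Tiles are dropped from the front, which keeps the chain
  property, and the last one dropped costs at most \<open>R\<close> points.\<close>

lemma trim:
  assumes "w \<le> x" "\<And>T. T \<in> set ts \<Longrightarrow> card T \<le> R"
  shows "\<exists>us vs. ts = us @ vs \<and> total_card vs + w \<le> x \<and> (us = [] \<or> x \<le> total_card vs + w + R)"
  using assms(2)
proof (induction ts)
  case Nil then show ?case using assms(1) by simp
next
  case (Cons T ts)
  show ?case
  proof (cases "total_card (T # ts) + w \<le> x")
    case True then show ?thesis by (intro exI[of _ "[]"] exI[of _ "T # ts"]) simp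
  next
    case False
    obtain us vs where *: "ts = us @ vs" "total_card vs + w \<le> x" "us = [] \<or> x \<le> total_card vs + w + R"
      using Cons by auto
    then show ?thesis
      using False Cons.prems[of T] by (intro exI[of _ "T # us"] exI[of _ vs]) auto
  qed
qed

text \<open>The thresholds precede \<open>X\<close> and \<open>\<phi>\<close>, so that one choice
  serves a whole sequence of almost actions.\<close>

theorem lampact_approx:
  assumes \<epsilon>: "0 < \<epsilon>"
  shows "\<exists>N \<eta> n0. 0 < \<eta> \<and> (\<forall>(X :: nat set) \<phi>. qact X \<phi> \<longrightarrow> n0 \<le> card X \<longrightarrow>
    real (card (X - good X \<phi> N)) \<le> \<eta> * real (card X) \<longrightarrow>
    (\<exists>a t. lampact X a t \<and> real (card (defect \<phi> a t X)) \<le> \<epsilon> * real (card X)))"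
proof -
  define e where "e = min \<epsilon> 1 / 16"
  have e: "0 < e" "e \<le> 1 / 2" "16 * e \<le> \<epsilon>" using \<epsilon> by (auto simp: e_def)
  obtain c where c: "1 - e < c" "coverable e e c" using coverable_near_1[of e e] e by auto
  \<comment> \<open>Invariance of a family matters when smaller tiles follow it; the last family
    gets the weak demand \<open>r = 0\<close>, \<open>\<delta> = 1\<close>.\<close>
  then obtain M R \<eta>1 where \<eta>1: "0 < \<eta>1" and cov: "covers e e c 0 1 M R \<eta>1"
    unfolding coverable_def by (meson zero_less_one)
  \<comment> \<open>At most \<open>card (wbox M)\<close> exceptional sets, each of density at most
    \<open>2 ^ M / K\<close>, together stay below \<open>\<eta>1 / 2\<close>.\<close>
  obtain K where K: "2 * real (card (wbox M) * 2 ^ M) / \<eta>1 + 1 \<le> real K" using real_arch_simple by blast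
  have K1: "1 \<le> real K"
  proof -
    have "0 \<le> 2 * real (card (wbox M) * 2 ^ M) / \<eta>1" using \<eta>1 by simp
    then show ?thesis using K by linarith
  qed
  define k where "k = M * (K + 1)"
  \<comment> \<open>\<open>fact (M * K)\<close> makes the small orbits an exact action, and
    \<open>M\<close> makes \<open>W\<close> closed under \<open>wbox M\<close>. The terms of
    \<open>N\<close> cover the demands of \<open>mem_fin_part\<close>,
    \<open>card_exceptional\<close> and \<open>nonper\<close>.\<close>
  define N1 where "N1 = M + 1 + fact (M * K)"
  define N where "N = 2 * N1 + 5 * k + M"
  \<comment> \<open>For \<open>n0 \<le> card X\<close> a single tile, of at most \<open>R\<close>
    points, is a proportion at most \<open>e\<close> of \<open>X\<close>.\<close>
  obtain n0 where n0: "real R / e \<le> real n0" using real_arch_simple by blast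
  have main: "\<exists>a t. lampact X a t \<and> real (card (defect \<phi> a t X)) \<le> \<epsilon> * real (card X)"
    if q: "qact X \<phi>" and nX: "n0 \<le> card X" and gd: "real (card (X - good X \<phi> N)) \<le> \<eta>1 / 2 * real (card X)"
    for X :: "nat set" and \<phi>
  proof -
    interpret local_action X \<phi> by unfold_locales (rule q)
    define W where "W = fin_part N1 (M * K)"
    have WX: "W \<subseteq> X" using fin_part_good good_X unfolding W_def by blast
    have Wc: "\<forall>g\<in>wbox M. \<phi> g ` W \<subseteq> W"
    proof -
      have "1 \<le> N1" "wbox M \<subseteq> wbox N1" by (simp_all add: N1_def wbox_mono)
      then show ?thesis unfolding W_def using fin_part_closed by blast
    qed
    define E where "E = (\<lambda>(p, b). {x \<in> good X \<phi> (5 * k). \<phi> (p, b) x = x \<and> K \<le> card (orb \<phi> {- int k..int k} x)})"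
    define I where "I = {g \<in> wbox M. 0 < fst g}"
    have fI: "finite I" "card I \<le> card (wbox M)" by (auto simp: I_def intro: card_mono)
    have Mk: "M \<le> k" by (simp add: k_def)
    have EX: "E g \<subseteq> X" for g using good_X by (auto simp: E_def split: prod.splits)
    have sub: "X - W - nonper X \<phi> M \<subseteq> (X - good X \<phi> N) \<union> (\<Union>g\<in>I. E g)"
    proof
      fix x assume x: "x \<in> X - W - nonper X \<phi> M"
      show "x \<in> (X - good X \<phi> N) \<union> (\<Union>g\<in>I. E g)"
      proof (cases "x \<in> good X \<phi> N")
        case True
        then have g: "x \<in> good X \<phi> M" "x \<in> good X \<phi> (5 * k)" "x \<in> good X \<phi> (2 * N1 + 4 * k)"
          using good_mono[of M N] good_mono[of "5 * k" N] good_mono[of "2 * N1 + 4 * k" N] by (auto simp: N_def)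
        then obtain p b where pb: "(p, b) \<in> wbox M" "0 < p" "\<phi> (p, b) x = x" using x by (auto simp: nonper_def)
        have "K \<le> card (orb \<phi> {- int k..int k} x)"
        proof (rule ccontr)
          assume "\<not> ?thesis"
          then have "x \<in> W" unfolding W_def using mem_fin_part[OF pb k_def _ g(3)] by simp
          then show False using x by simp
        qed
        then have "x \<in> E (p, b)" using g(2) pb(3) by (simp add: E_def)
        then show ?thesis using pb by (auto simp: I_def)
      qed (use x in blast)
    qed
    have cE: "real (card (E g)) * real K \<le> 2 ^ M * real (card X)" if g: "g \<in> I" for g
    proof -
      obtain p b where pb: "g = (p, b)" by (cases g)
      have p: "0 < p" "p \<le> int M" "(p, b) \<in> wbox M" using g pb by (auto simp: I_def wbox_def)
      have "card (E g) * K \<le> 2 ^ nat p * card X"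
        unfolding E_def pb prod.case using p Mk wbox_mono[OF Mk] by (intro card_exceptional) auto
      also have "\<dots> \<le> 2 ^ M * card X" using p by (intro mult_right_mono power_increasing) auto
      finally have "real (card (E g) * K) \<le> real (2 ^ M * card X)" by (simp only: of_nat_le_iff)
      then show ?thesis by simp
    qed
    have "real (card (\<Union>g\<in>I. E g)) \<le> (\<Sum>g\<in>I. real (card (E g)))"
      using card_UN_le[OF fI(1), of E] by (metis of_nat_le_iff of_nat_sum)
    also have "\<dots> \<le> (\<Sum>g\<in>I. 2 ^ M * real (card X) / real K)"
      using cE K1 by (intro sum_mono) (simp add: field_simps)
    also have "\<dots> \<le> real (card (wbox M)) * (2 ^ M * real (card X) / real K)"
      using fI by (simp only: sum_constant) (intro mult_right_mono, auto)
    also have "\<dots> = real (card (wbox M) * 2 ^ M) / real K * real (card X)" by simp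
    also have "\<dots> \<le> \<eta>1 / 2 * real (card X)"
    proof (intro mult_right_mono)
      have "2 * real (card (wbox M) * 2 ^ M) / \<eta>1 \<le> real K" using K by simp
      then have "2 * real (card (wbox M) * 2 ^ M) \<le> real K * \<eta>1" using \<eta>1 by (simp add: field_simps)
      then show "real (card (wbox M) * 2 ^ M) / real K \<le> \<eta>1 / 2"
        using K1 by (simp add: pos_divide_le_eq mult.commute)
    qed simp
    finally have 1: "real (card (\<Union>g\<in>I. E g)) \<le> \<eta>1 / 2 * real (card X)" .
    have "card (X - W - nonper X \<phi> M) \<le> card ((X - good X \<phi> N) \<union> (\<Union>g\<in>I. E g))"
      using sub EX finX fI(1) by (intro card_mono) (auto intro: finite_subset[OF EX])
    also have "\<dots> \<le> card (X - good X \<phi> N) + card (\<Union>g\<in>I. E g)" by (rule card_Un_le)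
    finally have "real (card (X - W - nonper X \<phi> M)) \<le> real (card (X - good X \<phi> N)) + real (card (\<Union>g\<in>I. E g))"
      by (metis of_nat_add of_nat_le_iff)
    also have "\<dots> \<le> \<eta>1 * real (card X)" using 1 gd by simp
    finally have np: "real (card (X - W - nonper X \<phi> M)) \<le> \<eta>1 * real (card X)" .
    from coversD[OF cov q WX Wc np] obtain ts where ts: "chain e ts" "\<forall>T\<in>set ts. T \<inter> W = {} \<and> tile_ok X \<phi> e 0 1 R T"
      "c * real (card X) \<le> real (card (W \<union> \<Union>(set ts)))"
      by blast
    have fW: "finite W" using WX finX finite_subset by blast
    have "card W \<le> card X" using WX by (simp add: card_mono)
    moreover have "card T \<le> R" if "T \<in> set ts" for T using ts(2) that by (auto simp: tile_ok_def)
    ultimately obtain us vs where uv: "ts = us @ vs" "total_card vs + card W \<le> card X"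
      "us = [] \<or> card X \<le> total_card vs + card W + R" using trim[of "card W" "card X" ts R] by blast
    have vX: "T \<subseteq> X" if "T \<in> set (W # vs)" for T using that ts(2) WX uv(1) by (auto simp: tile_ok_def)
    define u where "u = card (\<Union>(set (W # vs)))"
    have "real u \<ge> (1 - 2 * e) * real (card X)"
    proof (cases "us = []")
      case True
      then have "c * real (card X) \<le> real u" using ts(3) uv(1) by (simp add: u_def)
      moreover have "(1 - e) * real (card X) \<le> c * real (card X)" using c by (intro mult_right_mono) auto
      moreover have "(1 - 2 * e) * real (card X) \<le> (1 - e) * real (card X)" using e by (intro mult_right_mono) auto
      ultimately show ?thesis by linarith
    next
      case False
      have fv: "finite T" if "T \<in> set vs" for T using finite_subset[OF vX finX, of T] that by simp
      have "real R \<le> e * real n0" using n0 e by (simp add: field_simps)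
      also have "\<dots> \<le> e * real (card X)" using nX e by simp
      finally have Rx: "real R \<le> e * real (card X)" .
      have "(1 - e) * real (total_card vs) \<le> real (card (\<Union>(set vs)))"
        using chain_total[OF chain_append fv] ts(1) uv(1) by blast
      moreover have "u = card W + card (\<Union>(set vs))"
      proof -
        have "W \<inter> \<Union>(set vs) = {}" using ts(2) uv(1) by auto
        then show ?thesis using fW fv by (simp add: u_def card_Un_disjoint)
      qed
      moreover have "(1 - e) * real (card W) \<le> real (card W)" using e by (simp add: mult_left_le_one_le)
      ultimately have "(1 - e) * (real (total_card vs) + real (card W)) \<le> real u" by (simp add: distrib_left)
      moreover have "real (card X) \<le> real (total_card vs) + real (card W) + real R" using uv(3) False by linarith
      then have "(1 - e) * (real (card X) - real R) \<le> (1 - e) * (real (total_card vs) + real (card W))"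
        using e by (intro mult_left_mono) auto
      moreover have "(1 - e) * real R \<le> real R" using e by (simp add: mult_left_le_one_le)
      ultimately show ?thesis using Rx by (simp add: algebra_simps)
    qed
    note u_ge = this
    have "\<exists>a t. lampact T a t \<and> real (card (defect \<phi> a t T)) \<le> e * real (card T)" if T: "T \<in> set (W # vs)" for T
    proof (cases "T = W")
      case True
      have "defect \<phi> (\<phi> (0, {0})) (\<phi> (1, {})) W = {}" by (simp add: defect_def)
      moreover have "lampact W (\<phi> (0, {0})) (\<phi> (1, {}))"
        unfolding W_def by (rule lampact_fin_part) (simp add: N1_def)
      ultimately have "lampact T (\<phi> (0, {0})) (\<phi> (1, {})) \<and>
          real (card (defect \<phi> (\<phi> (0, {0})) (\<phi> (1, {})) T)) \<le> e * real (card T)"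
        using True e by simp
      then show ?thesis by blast
    next
      case False then show ?thesis using T ts(2) uv(1) by (auto simp: tile_ok_def)
    qed
    note pieces = this
    have "total_card (W # vs) \<le> card X" using uv(2) by simp
    from assemble[where ts = "W # vs", OF finX vX this pieces]
    obtain a t where at: "lampact X a t" "real (card (defect \<phi> a t X)) \<le>
        (real (card X) - real u) + 2 * (real (total_card (W # vs)) - real u) + e * real (total_card (W # vs))"
      unfolding u_def by blast
    have "real (total_card (W # vs)) \<le> real (card X)" using uv(2) by simp
    moreover from this have "e * real (total_card (W # vs)) \<le> e * real (card X)" using e by simp
    \<comment> \<open>Uncovered points contribute \<open>2 * e\<close>, the overlaps twice
      \<open>2 * e\<close>, the defects of the pieces \<open>e\<close>.\<close>
    ultimately have "real (card (defect \<phi> a t X)) \<le> 7 * e * real (card X)"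
      using at(2) u_ge by (simp add: algebra_simps)
    also have "\<dots> \<le> \<epsilon> * real (card X)" using e by (intro mult_right_mono) auto
    finally show ?thesis using at(1) by blast
  qed
  show ?thesis
    by (rule exI[of _ N], rule exI[of _ "\<eta>1 / 2"], rule exI[of _ n0]) (use main \<eta>1 in auto)
qed

section \<open>The universal property of the lamplighter group\<close>

text \<open>Lands in the carrier only for finite lamp sets; infinite ones belong to the unrestricted
  product.\<close>

definition el :: "int \<times> int set \<Rightarrow> int \<times> (int \<Rightarrow> int)"
  where "el g = (fst g, \<lambda>x. if x \<in> snd g then 1 else 0)"

lemma el_carrier: "finite S \<Longrightarrow> el (k, S) \<in> carrier lamplighter"
  by (simp add: el_def carrier_lamplighter carrier_lamp_group image_subset_iff)

lemma el_mult: "el g \<otimes>\<^bsub>lamplighter\<^esub> el h = el (g \<odot> h)"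
proof -
  obtain k S l T where [simp]: "g = (k, S)" "h = (l, T)" by fastforce
  have "((if x \<in> S then 1 else 0) + (if x - k \<in> T then 1 else 0)) mod 2 = (if x \<in> sd S (tr k T) then 1 else (0 :: int))" for x
    by simp
  then show ?thesis by (simp add: el_def mult_lamplighter mult_lamp_group shift_def)
qed

lemma el_one: "\<one>\<^bsub>lamplighter\<^esub> = el (0, {})"
  by (simp add: el_def one_lamplighter one_lamp_group)

lemma carrier_el: "carrier lamplighter = {el (k, S) |k S. finite S}"
proof (intro equalityI subsetI)
  fix g assume g: "g \<in> carrier lamplighter"
  obtain k f where kf: "g = (k, f)" by (cases g)
  have f: "range f \<subseteq> {0, 1}" "finite {x. f x \<noteq> 0}" using g kf by (auto simp: carrier_lamplighter carrier_lamp_group)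
  have "f x = (if x \<in> {x. f x \<noteq> 0} then 1 else 0)" for x
  proof -
    have "f x \<in> {0, 1}" using f(1) by blast
    then show ?thesis by auto
  qed
  then have "g = el (k, {x. f x \<noteq> 0})" unfolding el_def kf by simp
  then show "g \<in> {el (k, S) |k S. finite S}" using f(2) by blast
qed (auto intro: el_carrier)

text \<open>The standard presentation of the lamplighter group, with infinitely many relations, in
  the form in which \<open>lampact\<close> encodes it.\<close>

locale lamp_generators = group G for G (structure) +
  fixes a t
  assumes a [simp]: "a \<in> carrier G" and t [simp]: "t \<in> carrier G" and aa: "a \<otimes> a = \<one>"
    and comm_nat: "\<And>j :: nat. (inv (t [^] j) \<otimes> a \<otimes> t [^] j) \<otimes> a = a \<otimes> (inv (t [^] j) \<otimes> a \<otimes> t [^] j)"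
begin

section \<open>Conjugates of the lamp generator and their finite products\<close>

definition u :: "int \<Rightarrow> 'a \<Rightarrow> 'a" where "u k x = t [^] k \<otimes> x \<otimes> t [^] (- k)"

abbreviation c where "c i \<equiv> u i a"

lemma tk [simp]: "t [^] (k :: int) \<in> carrier G" by simp

lemma t_cancel: "t [^] (- k) \<otimes> t [^] (k :: int) = \<one>" "t [^] (k :: int) \<otimes> t [^] (- k) = \<one>"
  using int_pow_mult[OF t, of "- k" k] int_pow_mult[OF t, of k "- k"] by simp_all

lemma u_carrier [simp]: "x \<in> carrier G \<Longrightarrow> u k x \<in> carrier G"
  by (simp add: u_def del: int_pow_neg)

lemma u_mult:
  assumes "x \<in> carrier G" "y \<in> carrier G" shows "u k (x \<otimes> y) = u k x \<otimes> u k y"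
proof -
  have "u k x \<otimes> u k y = t [^] k \<otimes> (x \<otimes> ((t [^] (- k) \<otimes> t [^] k) \<otimes> (y \<otimes> t [^] (- k))))"
    using assms by (simp add: u_def m_assoc del: int_pow_neg)
  also have "\<dots> = u k (x \<otimes> y)" unfolding t_cancel using assms by (simp add: u_def m_assoc del: int_pow_neg)
  finally show ?thesis by simp
qed

lemma u_u:
  assumes "x \<in> carrier G" shows "u k (u l x) = u (k + l) x"
proof -
  have "t [^] (- k - l) = t [^] (- l) \<otimes> t [^] (- k)" using int_pow_mult[OF t, of "- l" "- k"] by (simp add: algebra_simps)
  then show ?thesis using assms int_pow_mult[OF t, of k l] by (simp add: u_def m_assoc del: int_pow_neg)
qed

lemma u_one [simp]: "u k \<one> = \<one>"
  by (simp add: u_def t_cancel del: int_pow_neg)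

lemma u_0 [simp]: "x \<in> carrier G \<Longrightarrow> u 0 x = x"
  by (simp add: u_def)

text \<open>Conjugation by a power of \<open>t\<close> moves one position to \<open>0\<close>; it
  also yields the positive distances from the negative ones, which are the given relations.\<close>

lemma c_comm: "c i \<otimes> c j = c j \<otimes> c i"
proof -
  have neg: "c (- int j) \<otimes> a = a \<otimes> c (- int j)" for j
    using comm_nat[of j] by (simp add: u_def int_pow_int int_pow_neg_int)
  have pos: "c (int j) \<otimes> a = a \<otimes> c (int j)" for j
  proof -
    have "u (int j) (c (- int j) \<otimes> a) = u (int j) (a \<otimes> c (- int j))" by (simp add: neg)
    then show ?thesis by (simp add: u_mult u_u)
  qed
  have "c i \<otimes> a = a \<otimes> c i" for i using neg[of "nat (- i)"] pos[of "nat i"] by (cases "0 \<le> i") auto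
  then have "u j (c (i - j) \<otimes> a) = u j (a \<otimes> c (i - j))" by simp
  then show ?thesis by (simp add: u_mult u_u)
qed

lemma c_sq: "c i \<otimes> c i = \<one>"
  using u_mult[OF a a, of i] by (simp add: aa)

text \<open>The default outside the carrier makes the steps commute on the whole type, as the fold
  over \<open>UNIV\<close> requires.\<close>

definition step where "step i r = (if r \<in> carrier G then c i \<otimes> r else r)"

definition lamps :: "int set \<Rightarrow> 'a" where "lamps S = Finite_Set.fold step \<one> S"

lemma step_comm: "comp_fun_commute_on UNIV step"
proof
  fix i j show "step j \<circ> step i = step i \<circ> step j"
  proof
    fix r show "(step j \<circ> step i) r = (step i \<circ> step j) r"
      using c_comm[of i j] by (auto simp: step_def simp flip: m_assoc)
  qed
qed

lemma lamps_empty [simp]: "lamps {} = \<one>"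
  by (simp add: lamps_def)

lemma lamps_insert':
  assumes "finite S" "i \<notin> S" shows "lamps (insert i S) = step i (lamps S)"
  unfolding lamps_def by (rule comp_fun_commute_on.fold_insert[OF step_comm]) (use assms in auto)

lemma lamps_carrier [simp]: "finite S \<Longrightarrow> lamps S \<in> carrier G"
  by (induction S rule: finite_induct) (simp_all add: lamps_insert' step_def)

lemma lamps_insert: "finite S \<Longrightarrow> i \<notin> S \<Longrightarrow> lamps (insert i S) = c i \<otimes> lamps S"
  by (simp add: lamps_insert' step_def)

lemma lamps_toggle: "finite S \<Longrightarrow> lamps (sd {i} S) = c i \<otimes> lamps S"
proof (cases "i \<in> S")
  case True
  assume "finite S"
  have "sd {i} S = S - {i}" using True by (auto simp: set_eq_iff)
  moreover have "lamps S = c i \<otimes> lamps (S - {i})"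
    using lamps_insert[of "S - {i}" i] True \<open>finite S\<close> by (simp add: insert_absorb)
  ultimately show ?thesis using \<open>finite S\<close> by (simp add: c_sq flip: m_assoc)
next
  case False
  assume "finite S"
  have "sd {i} S = insert i S" using False by (auto simp: set_eq_iff)
  then show ?thesis using lamps_insert \<open>finite S\<close> False by simp
qed

lemma lamps_sd: "finite S \<Longrightarrow> finite T \<Longrightarrow> lamps (sd S T) = lamps S \<otimes> lamps T"
proof (induction S rule: finite_induct)
  case (insert i S)
  have "sd (insert i S) T = sd {i} (sd S T)" using insert.hyps by (auto simp: set_eq_iff)
  then show ?case using insert by (simp add: lamps_toggle lamps_insert m_assoc)
qed simp

lemma lamps_tr: "finite S \<Longrightarrow> lamps (tr k S) = u k (lamps S)"
proof (induction S rule: finite_induct)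
  case (insert i S)
  have "tr k (insert i S) = insert (i + k) (tr k S)" by (auto simp: set_eq_iff)
  then show ?case using insert by (simp add: lamps_insert u_mult u_u add.commute)
qed simp

text \<open>Every element has the normal form lamps times a power of \<open>t\<close>, on which the
  homomorphism is prescribed; moving \<open>t ^ k\<close> to the right of \<open>lamps T\<close>
  shifts \<open>T\<close> by \<open>k\<close>.\<close>

lemma lamplighter_hom: "\<exists>\<rho>\<in>hom lamplighter G. \<rho> (el (0, {0})) = a \<and> \<rho> (el (1, {})) = t"
proof -
  define \<rho> where "\<rho> g = lamps {x. snd g x \<noteq> 0} \<otimes> t [^] fst g" for g :: "int \<times> (int \<Rightarrow> int)"
  have el: "\<rho> (el (k, S)) = lamps S \<otimes> t [^] k" for k S by (simp add: \<rho>_def el_def)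
  have "\<rho> \<in> hom lamplighter G"
  proof (rule homI)
    fix g assume "g \<in> carrier lamplighter"
    then show "\<rho> g \<in> carrier G" by (auto simp: carrier_el el)
    fix h assume "h \<in> carrier lamplighter"
    with \<open>g \<in> carrier lamplighter\<close> obtain k S l T where *: "g = el (k, S)" "h = el (l, T)" "finite S" "finite T"
      by (auto simp: carrier_el)
    have "u k (lamps T) \<otimes> t [^] k = t [^] k \<otimes> lamps T"
      using *(4) by (simp add: u_def m_assoc t_cancel del: int_pow_neg)
    then have "lamps S \<otimes> u k (lamps T) \<otimes> (t [^] k \<otimes> t [^] l) = lamps S \<otimes> t [^] k \<otimes> (lamps T \<otimes> t [^] l)"
      using *(3,4) by (metis (no_types, lifting) lamps_carrier m_assoc m_closed tk u_carrier)
    then show "\<rho> (g \<otimes>\<^bsub>lamplighter\<^esub> h) = \<rho> g \<otimes> \<rho> h"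
      using * by (simp add: el_mult el lamps_sd lamps_tr int_pow_mult)
  qed
  moreover have "lamps {0} = a" using lamps_insert[of "{}" 0] by simp
  ultimately show ?thesis by (intro bexI[of _ \<rho>]) (simp_all add: el)
qed

end


section \<open>Permutation stability\<close>

lemma sym_group_pow: "t [^]\<^bsub>sym_group n\<^esub> (j :: nat) = t ^^ j"
proof (induction j)
  case 0 then show ?case by (simp add: sym_group_def)
next
  case (Suc j) then show ?case by (simp add: nat_pow_def sym_group_def fun_eq_iff funpow_swap1)
qed

text \<open>Elements of \<open>sym_group n\<close> are functions on all naturals, so both
  permutations are first extended by the identity. The defining relations of the presentation are
  then those of \<open>lampact\<close>.\<close>

lemma lampact_hom:
  assumes L: "lampact {1..n} a t"
  shows "\<exists>\<rho>\<in>hom lamplighter (sym_group n). \<forall>x\<in>{1..n}. \<rho> (el (0, {0})) x = a x \<and> \<rho> (el (1, {})) x = t x"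
proof -
  define a' where "a' x = (if x \<in> {1..n} then a x else x)" for x
  define t' where "t' x = (if x \<in> {1..n} then t x else x)" for x
  have L': "lampact {1..n} a' t'" by (rule lampact_cong[OF L]) (auto simp: a'_def t'_def)
  have a': "a' permutes {1..n}" and t': "t' permutes {1..n}"
    using L' by (auto simp: lampact_def a'_def t'_def intro!: bij_imp_permutes)
  interpret sym: group "sym_group n" by (rule sym_group_is_group)
  have pw: "t' ^^ j permutes {1..n}" for j using t' by (induction j) (auto intro: permutes_compose permutes_id)
  have "lamp_generators (sym_group n) a' t'"
  proof unfold_locales
    show "a' \<in> carrier (sym_group n)" "t' \<in> carrier (sym_group n)" using a' t' by (simp_all add: sym_group_carrier)
    have "a' (a' x) = x" for x using lampactD(4)[OF L', of x] permutes_not_in[OF a', of x] by (cases "x \<in> {1..n}") simp_all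
    then show "a' \<otimes>\<^bsub>sym_group n\<^esub> a' = \<one>\<^bsub>sym_group n\<^esub>" by (auto simp: sym_group_mult sym_group_one)
    fix j :: nat
    define \<tau> where "\<tau> = t' ^^ j"
    define \<sigma> where "\<sigma> = inv' \<tau>"
    have \<tau>: "\<tau> permutes {1..n}" and \<sigma>: "\<sigma> permutes {1..n}" using pw permutes_inv by (auto simp: \<tau>_def \<sigma>_def)
    have \<sigma>\<tau>: "\<sigma> (\<tau> x) = x" "\<tau> (\<sigma> x) = x" for x using \<tau> by (simp_all add: \<sigma>_def permutes_inverses)
    have "\<sigma> (a' (\<tau> (a' x))) = a' (\<sigma> (a' (\<tau> x)))" for x
    proof (cases "x \<in> {1..n}")
      case True
      have in_X: "p x \<in> {1..n}" if "p permutes {1..n}" "x \<in> {1..n}" for p x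
        using permutes_in_image[OF that(1), of x] that(2) by simp
      \<comment> \<open>The point for which the commutation clause of \<open>lampact\<close> is
        stated.\<close>
      define z where "z = \<sigma> (a' (\<tau> x))"
      have "z \<in> {1..n}" unfolding z_def using in_X \<sigma> a' \<tau> True by blast
      moreover have "(t' ^^ j) z = a' ((t' ^^ j) x)" using \<sigma>\<tau> by (simp add: z_def flip: \<tau>_def)
      ultimately have "\<tau> (a' z) = a' (\<tau> (a' x))" using L' True by (simp add: lampact_def \<tau>_def)
      then show ?thesis using \<sigma>\<tau>(1)[of "a' z"] by (simp add: z_def)
    next
      case False
      then show ?thesis using \<sigma> \<tau> a' by (simp add: permutes_not_in)
    qed
    then have "\<sigma> \<circ> a' \<circ> \<tau> \<circ> a' = a' \<circ> (\<sigma> \<circ> a' \<circ> \<tau>)" by (simp add: fun_eq_iff)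
    then show "inv\<^bsub>sym_group n\<^esub> (t' [^]\<^bsub>sym_group n\<^esub> j) \<otimes>\<^bsub>sym_group n\<^esub> a' \<otimes>\<^bsub>sym_group n\<^esub> t' [^]\<^bsub>sym_group n\<^esub> j
        \<otimes>\<^bsub>sym_group n\<^esub> a' = a' \<otimes>\<^bsub>sym_group n\<^esub>
        (inv\<^bsub>sym_group n\<^esub> (t' [^]\<^bsub>sym_group n\<^esub> j) \<otimes>\<^bsub>sym_group n\<^esub> a' \<otimes>\<^bsub>sym_group n\<^esub> t' [^]\<^bsub>sym_group n\<^esub> j)"
      using sym_group_inv_equality[of \<tau> n] \<tau>
      by (simp add: sym_group_pow sym_group_mult sym_group_carrier flip: \<tau>_def \<sigma>_def)
  qed
  from lamp_generators.lamplighter_hom[OF this] obtain \<rho> where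
    "\<rho> \<in> hom lamplighter (sym_group n)" "\<rho> (el (0, {0})) = a'" "\<rho> (el (1, {})) = t'" by blast
  then show ?thesis by (intro bexI[of _ \<rho>]) (simp_all add: a'_def t'_def)
qed

text \<open>Agrees with \<open>perm_dist\<close> for \<open>n > 0\<close> when the first argument is
  a permutation; free of group inverses, it makes the triangle inequality and both invariances plain
  counting.\<close>

definition disagree :: "nat \<Rightarrow> (nat \<Rightarrow> nat) \<Rightarrow> (nat \<Rightarrow> nat) \<Rightarrow> real"
  where "disagree n \<sigma> \<tau> = real (card {x \<in> {1..n}. \<sigma> x \<noteq> \<tau> x}) / real n"

lemma perm_dist_eq_disagree:
  assumes "\<sigma> \<in> carrier (sym_group n)" "0 < n"
  shows "perm_dist n \<sigma> \<tau> = disagree n \<sigma> \<tau>"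
proof -
  have \<sigma>: "\<sigma> permutes {1..n}" using assms by (simp add: sym_group_carrier)
  have "(inv\<^bsub>sym_group n\<^esub> \<sigma> \<otimes>\<^bsub>sym_group n\<^esub> \<tau>) x = x \<longleftrightarrow> \<sigma> x = \<tau> x" for x
    using permutes_inv_eq[OF \<sigma>, of "\<tau> x" x] assms by (auto simp: sym_group_mult sym_group_inv_equality)
  then have "perm_dist n \<sigma> \<tau> = 1 - real (card {x \<in> {1..n}. \<sigma> x = \<tau> x}) / real n"
    by (simp add: perm_dist_def)
  moreover have "card {x \<in> {1..n}. \<sigma> x = \<tau> x} + card {x \<in> {1..n}. \<sigma> x \<noteq> \<tau> x} = card {1..n}"
  proof -
    have "{1..n} = {x \<in> {1..n}. \<sigma> x = \<tau> x} \<union> {x \<in> {1..n}. \<sigma> x \<noteq> \<tau> x}" by blast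
    then have "card {1..n} = card ({x \<in> {1..n}. \<sigma> x = \<tau> x} \<union> {x \<in> {1..n}. \<sigma> x \<noteq> \<tau> x})" by (rule arg_cong)
    also have "\<dots> = card {x \<in> {1..n}. \<sigma> x = \<tau> x} + card {x \<in> {1..n}. \<sigma> x \<noteq> \<tau> x}"
      by (rule card_Un_disjoint) auto
    finally show ?thesis by simp
  qed
  then have "real (card {x \<in> {1..n}. \<sigma> x = \<tau> x}) + real (card {x \<in> {1..n}. \<sigma> x \<noteq> \<tau> x}) = real n"
    by (metis card_atLeastAtMost diff_Suc_1 of_nat_add)
  ultimately show ?thesis using assms(2) by (simp add: disagree_def field_simps)
qed

lemma perm_dist_tendsto_iff:
  assumes "\<And>n. \<sigma> n \<in> carrier (sym_group n)"
  shows "(\<lambda>n. perm_dist n (\<sigma> n) (\<tau> n)) \<longlonglongrightarrow> 0 \<longleftrightarrow> (\<lambda>n. disagree n (\<sigma> n) (\<tau> n)) \<longlonglongrightarrow> 0"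
proof (rule tendsto_cong)
  show "\<forall>\<^sub>F n in sequentially. perm_dist n (\<sigma> n) (\<tau> n) = disagree n (\<sigma> n) (\<tau> n)"
    using eventually_gt_at_top[of 0] by eventually_elim (simp add: perm_dist_eq_disagree assms)
qed

lemma disagree_commute: "disagree n \<sigma> \<tau> = disagree n \<tau> \<sigma>"
proof -
  have "{x \<in> {1..n}. \<sigma> x \<noteq> \<tau> x} = {x \<in> {1..n}. \<tau> x \<noteq> \<sigma> x}" by auto
  then show ?thesis by (simp only: disagree_def)
qed

lemma disagree_nonneg: "0 \<le> disagree n \<sigma> \<tau>"
  by (simp add: disagree_def)

lemma disagree_triangle: "disagree n \<sigma> \<pi> \<le> disagree n \<sigma> \<tau> + disagree n \<tau> \<pi>"
proof -
  have "card {x \<in> {1..n}. \<sigma> x \<noteq> \<pi> x} \<le> card ({x \<in> {1..n}. \<sigma> x \<noteq> \<tau> x} \<union> {x \<in> {1..n}. \<tau> x \<noteq> \<pi> x})"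
    by (intro card_mono) auto
  also have "\<dots> \<le> card {x \<in> {1..n}. \<sigma> x \<noteq> \<tau> x} + card {x \<in> {1..n}. \<tau> x \<noteq> \<pi> x}" by (rule card_Un_le)
  finally show ?thesis by (simp add: disagree_def flip: add_divide_distrib of_nat_add) (rule divide_right_mono, simp_all)
qed

lemma disagree_comp_left:
  assumes "inj p" shows "disagree n (p \<circ> \<sigma>) (p \<circ> \<tau>) = disagree n \<sigma> \<tau>"
  using assms by (simp add: disagree_def inj_eq)

lemma disagree_comp_right:
  assumes "p permutes {1..n}" shows "disagree n (\<sigma> \<circ> p) (\<tau> \<circ> p) = disagree n \<sigma> \<tau>"
proof -
  have "bij_betw p {x \<in> {1..n}. \<sigma> (p x) \<noteq> \<tau> (p x)} {x \<in> {1..n}. \<sigma> x \<noteq> \<tau> x}"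
    unfolding bij_betw_def
  proof
    show "inj_on p {x \<in> {1..n}. \<sigma> (p x) \<noteq> \<tau> (p x)}" using permutes_inj_on[OF assms] by (rule inj_on_subset) auto
    show "p ` {x \<in> {1..n}. \<sigma> (p x) \<noteq> \<tau> (p x)} = {x \<in> {1..n}. \<sigma> x \<noteq> \<tau> x}"
    proof (intro equalityI subsetI)
      fix y assume y: "y \<in> {x \<in> {1..n}. \<sigma> x \<noteq> \<tau> x}"
      then obtain x where "y = p x" using permutes_surj[OF assms] by (metis surj_def)
      then show "y \<in> p ` {x \<in> {1..n}. \<sigma> (p x) \<noteq> \<tau> (p x)}" using y permutes_in_image[OF assms] by auto
    qed (use permutes_in_image[OF assms] in auto)
  qed
  from bij_betw_same_card[OF this] show ?thesis by (simp add: disagree_def)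
qed

text \<open>Closeness to a homomorphism passes to products, but inverses need an argument of their
  own; as the lamp generator is an involution, the inverse of \<open>t\<close> is the only one to
  supply.\<close>

lemma lamplighter_generated:
  assumes S: "finite S" and a: "P (el (0, {0}))" and t: "P (el (1, {}))"
    and mult: "\<And>g h. g \<in> carrier lamplighter \<Longrightarrow> h \<in> carrier lamplighter \<Longrightarrow> P g \<Longrightarrow> P h \<Longrightarrow> P (g \<otimes>\<^bsub>lamplighter\<^esub> h)"
    and inv_t: "P (el (-1, {}))"
  shows "P (el (k, S))"
proof -
  have mult': "P (el ((k, S) \<odot> (l, T)))" if "finite S" "finite T" "P (el (k, S))" "P (el (l, T))" for k S l T
    using mult[OF el_carrier[OF that(1)] el_carrier[OF that(2)] that(3,4)] by (simp add: el_mult)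
  have one: "P (el (0, {}))" using mult'[of "{}" "{}" 1 "-1"] t inv_t by simp
  have tn: "P (el (int n, {})) \<and> P (el (- int n, {}))" for n
  proof (induction n)
    case (Suc n)
    then show ?case using mult'[of "{}" "{}" 1 "int n"] mult'[of "{}" "{}" "-1" "- int n"] t inv_t by simp
  qed (simp add: one)
  have tk: "P (el (k, {}))" for k using tn[of "nat \<bar>k\<bar>"] by (cases "0 \<le> k") auto
  have ai: "P (el (0, {i}))" for i
    using mult'[of "{}" "{0}" i "- i"] mult'[of "{0}" "{}" 0 "- i"] a tk by simp
  have "P (el (0, S))" using S
  proof (induction S rule: finite_induct)
    case (insert i S)
    then have "sd {i} S = insert i S" by (auto simp: set_eq_iff)
    then show ?case using mult'[of "{i}" S 0 0] ai insert by simp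
  qed (rule one)
  then show ?thesis using mult'[of S "{}" 0 k] tk S by simp
qed

theorem lamplighter_stable: "permutation_stable lamplighter"
  unfolding permutation_stable_def
proof (intro allI impI)
  fix f assume ah: "almost_hom lamplighter f"
  interpret L: group lamplighter by (rule group_lamplighter)
  have fc: "f n g \<in> carrier (sym_group n)" if "g \<in> carrier lamplighter" for n g
    using ah that by (auto simp: almost_hom_def)
  have fp: "f n g permutes {1..n}" if "g \<in> carrier lamplighter" for n g
    using fc[OF that] by (simp add: sym_group_carrier)
  have fmult: "(\<lambda>n. disagree n (f n g \<circ> f n h) (f n (g \<otimes>\<^bsub>lamplighter\<^esub> h))) \<longlonglongrightarrow> 0"
    if "g \<in> carrier lamplighter" "h \<in> carrier lamplighter" for g h
  proof -
    have "f n g \<circ> f n h \<in> carrier (sym_group n)" for n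
      using fp that by (simp add: sym_group_carrier permutes_compose)
    moreover have "(\<lambda>n. perm_dist n (f n g \<circ> f n h) (f n (g \<otimes>\<^bsub>lamplighter\<^esub> h))) \<longlonglongrightarrow> 0"
      using ah that unfolding almost_hom_def sym_group_mult by blast
    ultimately show ?thesis using perm_dist_tendsto_iff[of "\<lambda>n. f n g \<circ> f n h"] by simp
  qed
  define A where "A = el (0, {0})"
  define T where "T = el (1, {})"
  have AT: "A \<in> carrier lamplighter" "T \<in> carrier lamplighter" by (simp_all add: A_def T_def el_carrier)
  define err where "err n \<rho> = card {x \<in> {1..n}. \<rho> A x \<noteq> f n A x \<or> \<rho> T x \<noteq> f n T x}" for n \<rho>
  \<comment> \<open>A homomorphism with the fewest errors on the generators does not depend on
    \<open>\<epsilon>\<close>; this replaces a diagonal argument over the approximations.\<close>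
  have "\<exists>\<rho>. \<rho> \<in> hom lamplighter (sym_group n) \<and> (\<forall>\<rho>'. \<rho>' \<in> hom lamplighter (sym_group n) \<longrightarrow> err n \<rho> \<le> err n \<rho>')" for n
  proof -
    have "(\<lambda>_. id) \<in> hom lamplighter (sym_group n)"
      by (auto simp: hom_def sym_group_def permutes_id)
    then show ?thesis
      using ex_has_least_nat[of "\<lambda>\<rho>. \<rho> \<in> hom lamplighter (sym_group n)" "\<lambda>_. id" "err n"] by blast
  qed
  then obtain \<rho> where \<rho>: "\<And>n. \<rho> n \<in> hom lamplighter (sym_group n)"
    and least: "\<And>n \<rho>'. \<rho>' \<in> hom lamplighter (sym_group n) \<Longrightarrow> err n (\<rho> n) \<le> err n \<rho>'" by metis
  have \<rho>c: "\<rho> n g \<in> carrier (sym_group n)" if "g \<in> carrier lamplighter" for n g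
    using \<rho>[of n] that by (auto simp: hom_def)
  have \<rho>p: "\<rho> n g permutes {1..n}" if "g \<in> carrier lamplighter" for n g
    using \<rho>c[OF that] by (simp add: sym_group_carrier)
  have \<rho>m: "\<rho> n (g \<otimes>\<^bsub>lamplighter\<^esub> h) = \<rho> n g \<circ> \<rho> n h"
    if "g \<in> carrier lamplighter" "h \<in> carrier lamplighter" for n g h
    using \<rho>[of n] that by (auto simp: hom_def sym_group_mult)
  \<comment> \<open>Infinite lamp sets name no group element and get the identity, since
    \<open>qact\<close> asks for a bijection for every word.\<close>
  define \<phi> where "\<phi> n g = (if finite (snd g) then f n (el g) else id)" for n g
  have q: "qact {1..n} (\<phi> n)" for n
  proof -
    have "bij_betw (\<phi> n g) {1..n} {1..n}" for g
    proof (cases "finite (snd g)")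
      case True
      then have "el g \<in> carrier lamplighter" using el_carrier[of "snd g" "fst g"] by simp
      then show ?thesis using permutes_imp_bij[OF fp] True by (simp add: \<phi>_def)
    qed (simp add: \<phi>_def)
    then show ?thesis by (simp add: qact_def)
  qed
  have good_lim: "(\<lambda>n. real (card ({1..n} - good {1..n} (\<phi> n) N)) / real n) \<longlonglongrightarrow> 0" for N
  proof (rule tendsto_sandwich[OF _ _ tendsto_const])
    show "(\<lambda>n. \<Sum>g\<in>wbox N. \<Sum>h\<in>wbox N. disagree n (\<phi> n g \<circ> \<phi> n h) (\<phi> n (g \<odot> h))) \<longlonglongrightarrow> 0"
    proof (intro tendsto_null_sum)
      fix g h assume "g \<in> wbox N" "h \<in> wbox N"
      then have fin: "finite (snd g)" "finite (snd h)"
        by (auto simp: wbox_def intro: finite_subset[of _ "{- int N..int N}"])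
      then have "finite (snd (g \<odot> h))" by (simp add: lmul_def)
      then show "(\<lambda>n. disagree n (\<phi> n g \<circ> \<phi> n h) (\<phi> n (g \<odot> h))) \<longlonglongrightarrow> 0"
        using fmult[of "el g" "el h"] fin el_carrier[of "snd g" "fst g"] el_carrier[of "snd h" "fst h"]
        by (simp add: \<phi>_def el_mult)
    qed
    show "\<forall>\<^sub>F n in sequentially. real (card ({1..n} - good {1..n} (\<phi> n) N)) / real n
        \<le> (\<Sum>g\<in>wbox N. \<Sum>h\<in>wbox N. disagree n (\<phi> n g \<circ> \<phi> n h) (\<phi> n (g \<odot> h)))"
    proof (intro always_eventually allI)
      fix n
      let ?B = "\<lambda>g h. {x \<in> {1..n}. (\<phi> n g \<circ> \<phi> n h) x \<noteq> \<phi> n (g \<odot> h) x}"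
      have "card ({1..n} - good {1..n} (\<phi> n) N) \<le> card (\<Union>g\<in>wbox N. \<Union>h\<in>wbox N. ?B g h)"
        by (intro card_mono) (auto simp: good_def)
      also have "\<dots> \<le> (\<Sum>g\<in>wbox N. card (\<Union>h\<in>wbox N. ?B g h))" by (intro card_UN_le) simp
      also have "\<dots> \<le> (\<Sum>g\<in>wbox N. \<Sum>h\<in>wbox N. card (?B g h))" by (intro sum_mono card_UN_le) simp
      finally have "real (card ({1..n} - good {1..n} (\<phi> n) N)) \<le> real (\<Sum>g\<in>wbox N. \<Sum>h\<in>wbox N. card (?B g h))"
        by (simp only: of_nat_le_iff)
      then have "real (card ({1..n} - good {1..n} (\<phi> n) N)) \<le> (\<Sum>g\<in>wbox N. \<Sum>h\<in>wbox N. real (card (?B g h)))"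
        by simp
      then have "real (card ({1..n} - good {1..n} (\<phi> n) N)) / real n \<le> (\<Sum>g\<in>wbox N. \<Sum>h\<in>wbox N. real (card (?B g h))) / real n"
        by (intro divide_right_mono) auto
      then show "real (card ({1..n} - good {1..n} (\<phi> n) N)) / real n
        \<le> (\<Sum>g\<in>wbox N. \<Sum>h\<in>wbox N. disagree n (\<phi> n g \<circ> \<phi> n h) (\<phi> n (g \<odot> h)))"
        by (simp add: disagree_def sum_divide_distrib)
    qed
  qed (simp add: always_eventually)
  have err_lim: "(\<lambda>n. real (err n (\<rho> n)) / real n) \<longlonglongrightarrow> 0"
  proof (rule tendstoI)
    fix \<epsilon> :: real assume \<epsilon>: "0 < \<epsilon>"
    obtain N \<eta> n0 where \<eta>: "0 < \<eta>" and approx: "\<forall>(X :: nat set) \<phi>. qact X \<phi> \<longrightarrow> n0 \<le> card X \<longrightarrow>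
        real (card (X - good X \<phi> N)) \<le> \<eta> * real (card X) \<longrightarrow>
        (\<exists>a t. lampact X a t \<and> real (card (defect \<phi> a t X)) \<le> \<epsilon> / 2 * real (card X))"
      using lampact_approx[OF half_gt_zero[OF \<epsilon>]] by (elim exE conjE) rule
    have "\<forall>\<^sub>F n in sequentially. real (card ({1..n} - good {1..n} (\<phi> n) N)) / real n < \<eta>"
      using order_tendstoD(2)[OF good_lim \<eta>] .
    then show "\<forall>\<^sub>F n in sequentially. dist (real (err n (\<rho> n)) / real n) 0 < \<epsilon>"
      using eventually_ge_at_top[of "max 1 n0"]
    proof eventually_elim
      fix n assume n: "real (card ({1..n} - good {1..n} (\<phi> n) N)) / real n < \<eta>" "max 1 n0 \<le> n"
      then have "real (card ({1..n} - good {1..n} (\<phi> n) N)) \<le> \<eta> * real (card {1..n})"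
        by (simp add: field_simps)
      then obtain a t where at: "lampact {1..n} a t" "real (card (defect (\<phi> n) a t {1..n})) \<le> \<epsilon> / 2 * real n"
        using approx[THEN spec, THEN spec, THEN mp, OF q[of n]] n(2) by auto
      obtain \<rho>' where \<rho>': "\<rho>' \<in> hom lamplighter (sym_group n)" "\<forall>x\<in>{1..n}. \<rho>' A x = a x \<and> \<rho>' T x = t x"
        using lampact_hom[OF at(1)] by (auto simp: A_def T_def)
      have "{x \<in> {1..n}. \<rho>' A x \<noteq> f n A x \<or> \<rho>' T x \<noteq> f n T x} = defect (\<phi> n) a t {1..n}"
        using \<rho>'(2) by (auto simp: defect_def \<phi>_def A_def T_def)
      then have "real (err n (\<rho> n)) \<le> \<epsilon> / 2 * real n" using least[OF \<rho>'(1)] at(2) by (simp add: err_def)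
      then have "real (err n (\<rho> n)) / real n \<le> \<epsilon> / 2" using n(2) by (simp add: field_simps)
      moreover have "\<epsilon> / 2 < \<epsilon>" using \<epsilon> by simp
      ultimately show "dist (real (err n (\<rho> n)) / real n) 0 < \<epsilon>"
        by (simp only: dist_real_def diff_0_right abs_of_nonneg divide_nonneg_nonneg of_nat_0_le_iff)
    qed
  qed
  define close where "close g \<longleftrightarrow> (\<lambda>n. disagree n (\<rho> n g) (f n g)) \<longlonglongrightarrow> 0" for g
  have squeeze: "(\<lambda>n. d n) \<longlonglongrightarrow> 0" if "\<And>n. 0 \<le> d n" "\<And>n. d n \<le> e n" "e \<longlonglongrightarrow> 0" for d e :: "nat \<Rightarrow> real"
    by (rule tendsto_sandwich[OF _ _ tendsto_const that(3)]) (simp_all add: always_eventually that)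
  have "close A" "close T"
  proof -
    have "card {x \<in> {1..n}. \<rho> n g x \<noteq> f n g x} \<le> err n (\<rho> n)" if "g = A \<or> g = T" for n g
      unfolding err_def using that by (intro card_mono) auto
    then have le: "disagree n (\<rho> n g) (f n g) \<le> real (err n (\<rho> n)) / real n" if "g = A \<or> g = T" for n g
      unfolding disagree_def using that by (intro divide_right_mono) auto
    show "close A" "close T"
      unfolding close_def by (rule squeeze[OF disagree_nonneg _ err_lim], rule le, simp)+
  qed
  have mult: "close (g \<otimes>\<^bsub>lamplighter\<^esub> h)" if g: "g \<in> carrier lamplighter" "close g"
    and h: "h \<in> carrier lamplighter" "close h" for g h
    unfolding close_def
  proof (rule squeeze[OF disagree_nonneg])
    show "disagree n (\<rho> n (g \<otimes>\<^bsub>lamplighter\<^esub> h)) (f n (g \<otimes>\<^bsub>lamplighter\<^esub> h)) \<le>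
        disagree n (\<rho> n h) (f n h) + disagree n (\<rho> n g) (f n g) + disagree n (f n g \<circ> f n h) (f n (g \<otimes>\<^bsub>lamplighter\<^esub> h))" for n
    proof -
      have "disagree n (\<rho> n g \<circ> \<rho> n h) (\<rho> n g \<circ> f n h) = disagree n (\<rho> n h) (f n h)"
        by (rule disagree_comp_left[OF permutes_inj[OF \<rho>p[OF g(1)]]])
      moreover have "disagree n (\<rho> n g \<circ> f n h) (f n g \<circ> f n h) = disagree n (\<rho> n g) (f n g)"
        by (rule disagree_comp_right[OF fp[OF h(1)]])
      ultimately show ?thesis
        using disagree_triangle[of n "\<rho> n g \<circ> \<rho> n h" "f n (g \<otimes>\<^bsub>lamplighter\<^esub> h)" "f n g \<circ> f n h"]
          disagree_triangle[of n "\<rho> n g \<circ> \<rho> n h" "f n g \<circ> f n h" "\<rho> n g \<circ> f n h"] \<rho>m[OF g(1) h(1)] by simp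
    qed
    show "(\<lambda>n. disagree n (\<rho> n h) (f n h) + disagree n (\<rho> n g) (f n g) +
        disagree n (f n g \<circ> f n h) (f n (g \<otimes>\<^bsub>lamplighter\<^esub> h))) \<longlonglongrightarrow> 0"
      using tendsto_add[OF tendsto_add[OF h(2)[unfolded close_def] g(2)[unfolded close_def]] fmult[OF g(1) h(1)]] by simp
  qed
  have f1: "(\<lambda>n. disagree n (f n \<one>\<^bsub>lamplighter\<^esub>) id) \<longlonglongrightarrow> 0"
  proof -
    let ?e = "\<one>\<^bsub>lamplighter\<^esub>"
    \<comment> \<open>The identity equals its square, so the almost-homomorphism property compares
      \<open>f n ?e \<circ> f n ?e\<close> with \<open>f n ?e\<close>; one factor cancels on the
      left.\<close>
    have "disagree n (f n ?e) id = disagree n (f n ?e \<circ> f n ?e) (f n ?e)" for n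
      using disagree_comp_left[OF permutes_inj[OF fp[OF L.one_closed]], of n n "f n ?e" id] by simp
    then show ?thesis using fmult[OF L.one_closed L.one_closed] by simp
  qed
  have inv_close: "close (el (-1, {}))"
    unfolding close_def
  proof (rule squeeze[OF disagree_nonneg])
    let ?T' = "el (-1, {})"
    have T': "?T' \<in> carrier lamplighter" by (simp add: el_carrier)
    have TT: "T \<otimes>\<^bsub>lamplighter\<^esub> ?T' = \<one>\<^bsub>lamplighter\<^esub>" by (simp add: T_def el_mult el_one)
    show "disagree n (\<rho> n ?T') (f n ?T') \<le> disagree n (\<rho> n T) (f n T) +
        disagree n (f n T \<circ> f n ?T') (f n (T \<otimes>\<^bsub>lamplighter\<^esub> ?T')) + disagree n (f n \<one>\<^bsub>lamplighter\<^esub>) id" for n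
    proof -
      interpret sym: group "sym_group n" by (rule sym_group_is_group)
      interpret gh: group_hom lamplighter "sym_group n" "\<rho> n"
        by (unfold_locales) (rule \<rho>)
      \<comment> \<open>Composing with \<open>\<rho> n T\<close> on the left moves the comparison at
        the inverse to one at \<open>T\<close>, where closeness is known.\<close>
      have "\<rho> n T \<circ> \<rho> n ?T' = id" using \<rho>m[OF AT(2) T', of n] gh.hom_one by (simp add: TT sym_group_one)
      then have "disagree n (\<rho> n ?T') (f n ?T') = disagree n id (\<rho> n T \<circ> f n ?T')"
        using disagree_comp_left[OF permutes_inj[OF \<rho>p[OF AT(2)]], of n n "\<rho> n ?T'" "f n ?T'"] by simp
      moreover have "disagree n (f n T \<circ> f n ?T') (\<rho> n T \<circ> f n ?T') = disagree n (\<rho> n T) (f n T)"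
        using disagree_comp_right[OF fp[OF T'], of n "f n T" "\<rho> n T"] disagree_commute by metis
      ultimately show ?thesis
        using disagree_triangle[of n id "\<rho> n T \<circ> f n ?T'" "f n T \<circ> f n ?T'"]
          disagree_triangle[of n id "f n T \<circ> f n ?T'" "f n \<one>\<^bsub>lamplighter\<^esub>"]
          disagree_commute[of n "f n T \<circ> f n ?T'" "f n \<one>\<^bsub>lamplighter\<^esub>"]
          disagree_commute[of n id "f n \<one>\<^bsub>lamplighter\<^esub>"] by (simp add: TT)
    qed
    show "(\<lambda>n. disagree n (\<rho> n T) (f n T) + disagree n (f n T \<circ> f n ?T') (f n (T \<otimes>\<^bsub>lamplighter\<^esub> ?T')) +
        disagree n (f n \<one>\<^bsub>lamplighter\<^esub>) id) \<longlonglongrightarrow> 0"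
      using tendsto_add[OF tendsto_add[OF \<open>close T\<close>[unfolded close_def] fmult[OF AT(2) T']] f1] by simp
  qed
  have "close g" if "g \<in> carrier lamplighter" for g
  proof -
    obtain k S where "g = el (k, S)" "finite S" using \<open>g \<in> carrier lamplighter\<close> by (auto simp: carrier_el)
    then show ?thesis
      using lamplighter_generated[of S close k] \<open>close A\<close> \<open>close T\<close> mult inv_close by (auto simp: A_def T_def)
  qed
  note all_close = this
  show "close_to_hom lamplighter f"
    unfolding close_to_hom_def
  proof (intro exI[of _ \<rho>] conjI allI ballI \<rho>)
    fix g assume g: "g \<in> carrier lamplighter"
    show "(\<lambda>n. perm_dist n (\<rho> n g) (f n g)) \<longlonglongrightarrow> 0"
      using perm_dist_tendsto_iff[of "\<lambda>n. \<rho> n g" "\<lambda>n. f n g", OF \<rho>c[OF g]] all_close[OF g]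
      by (simp add: close_def)
  qed
qed

section \<open>The Chabauty topology\<close>

definition cylinder :: "('a, 'c) monoid_scheme \<Rightarrow> 'a set \<Rightarrow> 'a set \<Rightarrow> 'a set set"
  where "cylinder G F A = {H \<in> Sub G. H \<inter> F = A}"

lemma openin_chabauty_coord:
  assumes g: "g \<in> carrier G" shows "openin (chabauty G) {H \<in> Sub G. (g \<in> H) = b}"
proof -
  let ?P = "product_topology (\<lambda>_. discrete_topology (UNIV :: bool set)) (carrier G)"
  have "openin ?P {r \<in> topspace ?P. r g \<in> {b}}"
    by (rule openin_continuous_map_preimage[OF continuous_map_product_projection[OF g]]) simp
  moreover have "{H \<in> Sub G. (g \<in> H) = b} =
      (\<lambda>H. \<lambda>x\<in>carrier G. x \<in> H) -` {r \<in> topspace ?P. r g \<in> {b}} \<inter> Sub G"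
    using g by auto
  ultimately show ?thesis unfolding chabauty_def openin_pullback_topology by blast
qed

lemma chabauty_nbhd:
  assumes U: "openin (chabauty G) U" and H: "H \<in> U"
  obtains F where "finite F" "F \<subseteq> carrier G" "cylinder G F (H \<inter> F) \<subseteq> U"
proof -
  let ?\<chi> = "\<lambda>H. \<lambda>x\<in>carrier G. x \<in> H"
  obtain V where V: "openin (product_topology (\<lambda>_. discrete_topology (UNIV :: bool set)) (carrier G)) V"
    "U = ?\<chi> -` V \<inter> Sub G"
    using U unfolding chabauty_def openin_pullback_topology by blast
  have "?\<chi> H \<in> V" using H V(2) by auto
  then obtain W where W: "finite {i \<in> carrier G. W i \<noteq> UNIV}" "?\<chi> H \<in> Pi\<^sub>E (carrier G) W" "Pi\<^sub>E (carrier G) W \<subseteq> V"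
    using V(1) unfolding openin_product_topology_alt by auto
  define F where "F = {i \<in> carrier G. W i \<noteq> UNIV}"
  have "H' \<in> U" if H': "H' \<in> cylinder G F (H \<inter> F)" for H'
  proof -
    have "?\<chi> H' \<in> Pi\<^sub>E (carrier G) W"
    proof (rule PiE_I)
      fix i assume i: "i \<in> carrier G"
      show "?\<chi> H' i \<in> W i"
      proof (cases "i \<in> F")
        case True
        then have "(i \<in> H') = (i \<in> H)" using H' by (auto simp: cylinder_def)
        then show ?thesis using PiE_mem[OF W(2) i] i by simp
      next
        case False then show ?thesis using i by (auto simp: F_def)
      qed
    qed simp
    then have "?\<chi> H' \<in> V" using W(3) by blast
    then show ?thesis using H' V(2) by (simp add: cylinder_def)
  qed
  then show thesis using that[of F] W(1) by (auto simp: F_def)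
qed

text \<open>Indicator functions of subgroups form a closed subset of the product: each axiom is a
  condition on at most three coordinates, and conditions on coordinates are clopen. Tychonoff's
  theorem applies, and \<open>su\<close>, inverse to \<open>ch\<close>, carries compactness
  back.\<close>

lemma (in group) compact_space_chabauty: "compact_space (chabauty G)"
proof -
  define P where "P = product_topology (\<lambda>_. discrete_topology (UNIV :: bool set)) (carrier G)"
  define ch where "ch H = (\<lambda>x\<in>carrier G. x \<in> H)" for H :: "'a set"
  define su where "su r = {g \<in> carrier G. r g}" for r :: "'a \<Rightarrow> bool"
  define K where "K = ch ` Sub G"
  have tP: "topspace P = extensional (carrier G)" by (simp add: P_def PiE_def)
  have cl: "closedin P {r \<in> topspace P. r g = b}" if "g \<in> carrier G" for g b
  proof -
    have "closedin P {r \<in> topspace P. r g \<in> {b}}"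
      unfolding P_def by (rule closedin_continuous_map_preimage[OF continuous_map_product_projection[OF that]]) simp
    then show ?thesis by simp
  qed
  define A where "A g h = {r \<in> topspace P. r g = False} \<union> {r \<in> topspace P. r h = False} \<union>
    {r \<in> topspace P. r (g \<otimes> h) = True}" for g h
  define D where "D g = {r \<in> topspace P. r g = False} \<union> {r \<in> topspace P. r (inv g) = True}" for g
  have clA: "closedin P (A g h)" and clD: "closedin P (D g)" if "g \<in> carrier G" "h \<in> carrier G" for g h
    unfolding A_def D_def using that by (intro closedin_Un cl; simp)+
  \<comment> \<open>Inserting \<open>topspace P\<close> makes both families nonempty at sight, as
    closedness of an intersection requires.\<close>
  have K: "K = {r \<in> topspace P. r \<one> = True} \<inter>
      (\<Inter>(insert (topspace P) {A g h |g h. g \<in> carrier G \<and> h \<in> carrier G})) \<inter>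
      (\<Inter>(insert (topspace P) {D g |g. g \<in> carrier G}))"
    (is "_ = ?R")
  proof (intro equalityI subsetI)
    fix r assume "r \<in> K"
    then obtain H where H: "subgroup H G" "r = ch H" by (auto simp: K_def Sub_def)
    interpret H: subgroup H G by fact
    show "r \<in> ?R" by (auto simp: H(2) ch_def tP A_def D_def)
  next
    fix r assume r: "r \<in> ?R"
    then have rt: "r \<in> extensional (carrier G)" "r \<one>" by (auto simp: tP)
    have rm: "r (g \<otimes> h)" if "g \<in> carrier G" "h \<in> carrier G" "r g" "r h" for g h
    proof -
      have "r \<in> A g h" using r that by blast
      then show ?thesis using that by (simp add: A_def)
    qed
    have ri: "r (inv g)" if "g \<in> carrier G" "r g" for g
    proof -
      have "r \<in> D g" using r that by blast
      then show ?thesis using that by (simp add: D_def)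
    qed
    have "subgroup (su r) G"
      by (rule subgroupI) (use rt rm ri in \<open>auto simp: su_def\<close>)
    moreover have "r = ch (su r)" using rt(1) by (auto simp: ch_def su_def extensional_def fun_eq_iff)
    ultimately show "r \<in> K" by (auto simp: K_def Sub_def)
  qed
  have "closedin P K"
    unfolding K
  proof (intro closedin_Int closedin_Inter)
    show "closedin P {r \<in> topspace P. r \<one> = True}" by (rule cl) simp
    show "closedin P S" if "S \<in> insert (topspace P) {A g h |g h. g \<in> carrier G \<and> h \<in> carrier G}" for S
      using that clA by blast
    show "closedin P S" if "S \<in> insert (topspace P) {D g |g. g \<in> carrier G}" for S
      using that clD by blast
  qed auto
  moreover have "compact_space P"
    unfolding P_def compact_space_product_topology by (simp add: compact_space_discrete_topology)
  ultimately have "compactin P K" by (simp add: closedin_compact_space)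
  then have cK: "compactin (subtopology P K) K" by (simp add: compactin_subtopology)
  have KP: "K \<subseteq> topspace P" unfolding K by blast
  have chsu: "ch (su r) = r" "su r \<in> Sub G" if rK: "r \<in> K" for r
  proof -
    obtain H where H: "H \<in> Sub G" "r = ch H" using rK by (auto simp: K_def)
    have "H \<subseteq> carrier G" using H(1) subgroup.subset by (auto simp: Sub_def)
    then have "su r = H" by (auto simp: H(2) su_def ch_def)
    then show "ch (su r) = r" "su r \<in> Sub G" using H by simp_all
  qed
  have "continuous_map (subtopology P K) P (ch \<circ> su)"
  proof (rule continuous_map_eq)
    show "continuous_map (subtopology P K) P id" by (simp add: continuous_map_from_subtopology)
    show "\<And>x. x \<in> topspace (subtopology P K) \<Longrightarrow> id x = (ch \<circ> su) x" using chsu by simp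
  qed
  then have "continuous_map (subtopology P K) (chabauty G) su"
    unfolding chabauty_def P_def[symmetric] ch_def[symmetric]
    by (rule continuous_map_pullback') (use chsu in auto)
  then have "compactin (chabauty G) (su ` K)" using image_compactin[OF cK] by blast
  moreover have "su ` K = Sub G"
  proof (intro equalityI subsetI)
    fix H assume H: "H \<in> Sub G"
    then have "H \<subseteq> carrier G" using subgroup.subset by (auto simp: Sub_def)
    then have "su (ch H) = H" by (auto simp: su_def ch_def)
    then show "H \<in> su ` K" using H unfolding K_def by (metis imageI)
  qed (use chsu in auto)
  ultimately show ?thesis by (simp add: compact_space_def topspace_chabauty)
qed

lemma (in group) continuous_chabauty_bounded:
  assumes "continuous_map (chabauty G) euclideanreal f"
  obtains C where "0 \<le> C" "\<And>H. H \<in> Sub G \<Longrightarrow> \<bar>f H\<bar> \<le> C"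
proof -
  have "compactin euclideanreal (f ` Sub G)"
    using image_compactin[OF _ assms, of "Sub G"] compact_space_chabauty
    by (simp add: compact_space_def topspace_chabauty)
  then have "bounded (f ` Sub G)" using compact_imp_bounded by simp
  then obtain C where "\<forall>x\<in>f ` Sub G. norm x \<le> C" unfolding bounded_iff by blast
  then have "\<bar>f H\<bar> \<le> max 0 C" if "H \<in> Sub G" for H using that by fastforce
  then show thesis by (intro that[of "max 0 C"]) auto
qed

section \<open>Measurability on the space of subgroups\<close>

lemma sets_chabauty_coord:
  assumes "g \<in> carrier G" shows "{H \<in> Sub G. g \<in> H} \<in> sets (chabauty_borel G)"
  using openin_chabauty_coord[OF assms, of True] unfolding sets_chabauty_borel by auto

text \<open>For a countable group there are countably many cylinders, so an open set is a countable
  union of them, and each is a condition on finitely many coordinates.\<close>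

lemma measurable_into_chabauty:
  assumes cG: "countable (carrier G)" and h: "\<And>x. x \<in> space M \<Longrightarrow> h x \<in> Sub G"
    and coord: "\<And>g. g \<in> carrier G \<Longrightarrow> {x \<in> space M. g \<in> h x} \<in> sets M"
  shows "h \<in> measurable M (chabauty_borel G)"
  unfolding chabauty_borel_def
proof (rule measurable_measure_of)
  show "{U. openin (chabauty G) U} \<subseteq> Pow (Sub G)" by (auto dest: openin_chabauty_subset)
  show "h \<in> space M \<rightarrow> Sub G" using h by auto
  fix U assume "U \<in> {U. openin (chabauty G) U}"
  then have U: "openin (chabauty G) U" by simp
  define \<F> where "\<F> = {(F, A). finite F \<and> F \<subseteq> carrier G \<and> finite A \<and> A \<subseteq> carrier G \<and> cylinder G F A \<subseteq> U}"
  have "countable ({F. finite F \<and> F \<subseteq> carrier G} \<times> {F. finite F \<and> F \<subseteq> carrier G})"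
    using countable_Collect_finite_subset[OF cG] by (intro countable_SIGMA) auto
  then have cF: "countable \<F>" by (rule countable_subset[rotated]) (auto simp: \<F>_def)
  have UF: "U = (\<Union>(F, A)\<in>\<F>. cylinder G F A)"
  proof (intro equalityI subsetI)
    fix H assume H: "H \<in> U"
    obtain F where F: "finite F" "F \<subseteq> carrier G" "cylinder G F (H \<inter> F) \<subseteq> U"
      using chabauty_nbhd[OF U H] .
    have "H \<in> cylinder G F (H \<inter> F)" using H openin_chabauty_subset[OF U] by (auto simp: cylinder_def)
    moreover have "(F, H \<inter> F) \<in> \<F>" using F by (auto simp: \<F>_def)
    ultimately show "H \<in> (\<Union>(F, A)\<in>\<F>. cylinder G F A)" by blast
  qed (auto simp: \<F>_def)
  have "h -` cylinder G F A \<inter> space M \<in> sets M" if F: "finite F" "F \<subseteq> carrier G" for F A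
  proof (cases "A \<subseteq> F")
    case True
    have "h -` cylinder G F A \<inter> space M = {x \<in> space M. \<forall>g\<in>F. (g \<in> A) = (g \<in> h x)}"
      using h True by (auto simp: cylinder_def)
    also have "\<dots> \<in> sets M"
    proof (intro sets.sets_Collect_finite_All F)
      fix g assume "g \<in> F"
      then have "{x \<in> space M. g \<in> h x} \<in> sets M" using F coord by blast
      then show "{x \<in> space M. (g \<in> A) = (g \<in> h x)} \<in> sets M"
        by (cases "g \<in> A") (simp_all add: sets.sets_Collect_neg)
    qed
    finally show ?thesis .
  next
    case False
    then have "cylinder G F A = {}" by (auto simp: cylinder_def)
    then show ?thesis by simp
  qed
  moreover have "h -` U \<inter> space M = (\<Union>(F, A)\<in>\<F>. h -` cylinder G F A \<inter> space M)"
    unfolding UF by auto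
  ultimately show "h -` U \<inter> space M \<in> sets M"
    using cF by (auto simp: \<F>_def intro!: sets.countable_UN')
qed

lemma continuous_chabauty_measurable:
  assumes "continuous_map (chabauty G) euclideanreal f" shows "f \<in> borel_measurable (chabauty_borel G)"
proof (rule borel_measurableI)
  fix S :: "real set" assume "open S"
  then have "openin (chabauty G) {H \<in> topspace (chabauty G). f H \<in> S}"
    using assms by (intro openin_continuous_map_preimage) auto
  moreover have "f -` S \<inter> space (chabauty_borel G) = {H \<in> topspace (chabauty G). f H \<in> S}"
    by (auto simp: space_chabauty_borel topspace_chabauty)
  ultimately show "f -` S \<inter> space (chabauty_borel G) \<in> sets (chabauty_borel G)"
    unfolding sets_chabauty_borel by auto
qed

text \<open>Convergence in a product is convergence of each coordinate, here of the integral of each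
  continuous function.\<close>

lemma weak_star_closureI:
  assumes \<mu>: "\<mu> \<in> prob_measures G" and \<nu>: "\<And>n :: nat. \<nu> n \<in> S" "S \<subseteq> prob_measures G"
    and lim: "\<And>f. continuous_map (chabauty G) euclideanreal f \<Longrightarrow> (\<lambda>n. \<integral>H. f H \<partial>\<nu> n) \<longlonglongrightarrow> (\<integral>H. f H \<partial>\<mu>)"
  shows "\<mu> \<in> weak_star G closure_of S"
proof -
  define C where "C = {f :: 'a set \<Rightarrow> real. continuous_map (chabauty G) euclideanreal f}"
  define I where "I = (\<lambda>\<mu> :: 'a set measure. \<lambda>f\<in>C. \<integral>H. f H \<partial>\<mu>)"
  define P where "P = product_topology (\<lambda>_. euclideanreal) C"
  have W: "weak_star G = pullback_topology (prob_measures G) I P"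
    by (simp add: weak_star_def C_def I_def P_def Let_def)
  have "limitin P (\<lambda>n. I (\<nu> n)) (I \<mu>) sequentially"
    unfolding P_def limitin_componentwise using lim by (auto simp: I_def C_def)
  have "\<exists>\<nu>'. \<nu>' \<in> S \<and> \<nu>' \<in> T" if T: "\<mu> \<in> T" "openin (weak_star G) T" for T
  proof -
    obtain U where U: "openin P U" "T = I -` U \<inter> prob_measures G"
      using T(2) unfolding W openin_pullback_topology by blast
    have "\<forall>\<^sub>F n in sequentially. I (\<nu> n) \<in> U"
      using \<open>limitin P (\<lambda>n. I (\<nu> n)) (I \<mu>) sequentially\<close> U T(1) by (auto simp: limitin_def)
    then obtain n where "I (\<nu> n) \<in> U" by (auto simp: eventually_sequentially)
    then show ?thesis using U \<nu> by (intro exI[of _ "\<nu> n"]) auto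
  qed
  then show ?thesis using \<mu> unfolding in_closure_of topspace_weak_star by blast
qed


section \<open>Conjugation\<close>

lemma (in group) mem_conj_subgroup:
  assumes "subgroup H G" "k \<in> carrier G"
  shows "x \<in> conj_subgroup G k H \<longleftrightarrow> x \<in> carrier G \<and> inv k \<otimes> x \<otimes> k \<in> H"
proof -
  have HG: "h \<in> carrier G" if "h \<in> H" for h using subgroup.mem_carrier[OF assms(1) that] .
  have "x \<in> conj_subgroup G k H \<longleftrightarrow> (\<exists>h\<in>H. x = k \<otimes> h \<otimes> inv k)"
    by (auto simp: conj_subgroup_def l_coset_def r_coset_def)
  also have "\<dots> \<longleftrightarrow> x \<in> carrier G \<and> inv k \<otimes> x \<otimes> k \<in> H"
  proof
    assume "\<exists>h\<in>H. x = k \<otimes> h \<otimes> inv k"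
    then obtain h where h: "h \<in> H" "x = k \<otimes> h \<otimes> inv k" by blast
    have "inv k \<otimes> (k \<otimes> h \<otimes> inv k) \<otimes> k = h"
      using assms(2) HG[OF h(1)] by (simp add: m_assoc) (simp add: m_assoc[symmetric])
    then show "x \<in> carrier G \<and> inv k \<otimes> x \<otimes> k \<in> H" using h HG assms(2) by simp
  next
    assume x: "x \<in> carrier G \<and> inv k \<otimes> x \<otimes> k \<in> H"
    have "x = k \<otimes> (inv k \<otimes> x \<otimes> k) \<otimes> inv k"
      using assms(2) x by (simp add: m_assoc) (simp add: m_assoc[symmetric])
    then show "\<exists>h\<in>H. x = k \<otimes> h \<otimes> inv k" using x by blast
  qed
  finally show ?thesis .
qed

lemma (in group) conj_subgroup_Sub:
  assumes H: "H \<in> Sub G" and k: "k \<in> carrier G" shows "conj_subgroup G k H \<in> Sub G"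
proof -
  interpret H: subgroup H G using H by (simp add: Sub_def)
  note m = mem_conj_subgroup[OF H.subgroup_axioms k]
  have "subgroup (conj_subgroup G k H) G"
  proof (rule subgroupI)
    show "conj_subgroup G k H \<subseteq> carrier G" using m by blast
    have "\<one> \<in> conj_subgroup G k H" using k by (simp add: m)
    then show "conj_subgroup G k H \<noteq> {}" by blast
  next
    fix a assume a: "a \<in> conj_subgroup G k H"
    have "inv (inv k \<otimes> a \<otimes> k) = inv k \<otimes> inv a \<otimes> k" using a k m by (simp add: inv_mult_group m_assoc)
    then show "inv a \<in> conj_subgroup G k H" using a m by (metis H.m_inv_closed inv_closed)
    fix b assume b: "b \<in> conj_subgroup G k H"
    have "k \<otimes> (inv k \<otimes> y) = y" if "y \<in> carrier G" for y
      using k that by (simp flip: m_assoc)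
    then have "(inv k \<otimes> a \<otimes> k) \<otimes> (inv k \<otimes> b \<otimes> k) = inv k \<otimes> (a \<otimes> b) \<otimes> k"
      using a b k m by (simp add: m_assoc)
    then show "a \<otimes> b \<in> conj_subgroup G k H" using a b m by (metis H.m_closed m_closed)
  qed
  then show ?thesis by (simp add: Sub_def)
qed

lemma (in group) measurable_conj_subgroup:
  assumes "countable (carrier G)" "k \<in> carrier G"
  shows "conj_subgroup G k \<in> measurable (chabauty_borel G) (chabauty_borel G)"
proof (rule measurable_into_chabauty[OF assms(1)])
  show "conj_subgroup G k H \<in> Sub G" if "H \<in> space (chabauty_borel G)" for H
    using conj_subgroup_Sub assms(2) that by (simp add: space_chabauty_borel)
  fix g assume g: "g \<in> carrier G"
  have "{H \<in> space (chabauty_borel G). g \<in> conj_subgroup G k H} = {H \<in> Sub G. inv k \<otimes> g \<otimes> k \<in> H}"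
    using mem_conj_subgroup assms(2) g by (auto simp: space_chabauty_borel Sub_def)
  then show "{H \<in> space (chabauty_borel G). g \<in> conj_subgroup G k H} \<in> sets (chabauty_borel G)"
    using sets_chabauty_coord[of "inv k \<otimes> g \<otimes> k" G] g assms(2) by simp
qed

lemma (in group) IRS_integral_conj:
  fixes f :: "'a set \<Rightarrow> real"
  assumes G: "countable (carrier G)" "k \<in> carrier G" and \<mu>: "\<mu> \<in> IRS G"
    and f: "f \<in> borel_measurable (chabauty_borel G)"
  shows "(\<integral>H. f (conj_subgroup G k H) \<partial>\<mu>) = (\<integral>H. f H \<partial>\<mu>)"
proof -
  have s: "sets \<mu> = sets (chabauty_borel G)" and d: "distr \<mu> \<mu> (conj_subgroup G k) = \<mu>"
    using \<mu> G(2) by (auto simp: IRS_def prob_measures_def)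
  have "conj_subgroup G k \<in> measurable \<mu> \<mu>" "f \<in> borel_measurable \<mu>"
    using measurable_conj_subgroup[OF G] f measurable_cong_sets[OF s s] measurable_cong_sets[OF s refl] by blast+
  then have "integral\<^sup>L (distr \<mu> \<mu> (conj_subgroup G k)) f = (\<integral>H. f (conj_subgroup G k H) \<partial>\<mu>)"
    by (rule integral_distr)
  then show ?thesis by (simp add: d)
qed

text \<open>Finite index is rephrased through finite sets of representatives, of which a countable
  group has countably many; this makes it a Borel condition.\<close>

lemma (in group) finite_index_iff:
  assumes H: "H \<in> Sub G"
  shows "H \<in> finite_index G \<longleftrightarrow> (\<exists>A. finite A \<and> A \<subseteq> carrier G \<and> (\<forall>g\<in>carrier G. \<exists>a\<in>A. g \<otimes> inv a \<in> H))"
proof -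
  have sH: "subgroup H G" using H by (simp add: Sub_def)
  interpret H: subgroup H G by (rule sH)
  have eq: "g \<otimes> inv a \<in> H \<longleftrightarrow> H #> g = H #> a" if "g \<in> carrier G" "a \<in> carrier G" for g a
  proof
    assume h: "g \<otimes> inv a \<in> H"
    have "g = (g \<otimes> inv a) \<otimes> a" using that by (simp add: m_assoc)
    then have "g \<in> H #> a" using h by (auto simp: r_coset_def)
    then show "H #> g = H #> a" using repr_independence[OF _ _ sH] that by metis
  next
    assume "H #> g = H #> a"
    then have "g \<in> H #> a" using rcos_self[OF that(1) sH] by simp
    then obtain h where "h \<in> H" "g = h \<otimes> a" by (auto simp: r_coset_def)
    then show "g \<otimes> inv a \<in> H" using that H.mem_carrier by (simp add: m_assoc)
  qed
  have R: "rcosets H = (\<lambda>g. H #> g) ` carrier G" by (auto simp: RCOSETS_def)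
  have "finite (rcosets H) \<longleftrightarrow> (\<exists>A. finite A \<and> A \<subseteq> carrier G \<and> (\<forall>g\<in>carrier G. \<exists>a\<in>A. H #> g = H #> a))"
  proof
    assume "finite (rcosets H)"
    then obtain A where A: "A \<subseteq> carrier G" "finite A" "rcosets H = (\<lambda>g. H #> g) ` A"
      using finite_subset_image[of "rcosets H" "\<lambda>g. H #> g" "carrier G"] R by auto
    then have "\<exists>a\<in>A. H #> g = H #> a" if "g \<in> carrier G" for g using that R by blast
    then show "\<exists>A. finite A \<and> A \<subseteq> carrier G \<and> (\<forall>g\<in>carrier G. \<exists>a\<in>A. H #> g = H #> a)" using A by blast
  next
    assume "\<exists>A. finite A \<and> A \<subseteq> carrier G \<and> (\<forall>g\<in>carrier G. \<exists>a\<in>A. H #> g = H #> a)"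
    then obtain A where A: "finite A" "\<forall>g\<in>carrier G. \<exists>a\<in>A. H #> g = H #> a" by blast
    have "rcosets H \<subseteq> (\<lambda>g. H #> g) ` A" unfolding R using A(2) by blast
    then show "finite (rcosets H)" using A(1) finite_surj by blast
  qed
  also have "\<dots> \<longleftrightarrow> (\<exists>A. finite A \<and> A \<subseteq> carrier G \<and> (\<forall>g\<in>carrier G. \<exists>a\<in>A. g \<otimes> inv a \<in> H))"
    using eq by (intro ex_cong1 conj_cong ball_cong bex_cong refl) blast+
  finally show ?thesis using H by (simp add: finite_index_def)
qed

lemma (in group) sets_finite_index:
  assumes "countable (carrier G)" shows "finite_index G \<in> sets (chabauty_borel G)"
proof -
  define \<A> where "\<A> = {A. finite A \<and> A \<subseteq> carrier G}"
  have "countable \<A>" unfolding \<A>_def by (rule countable_Collect_finite_subset[OF assms])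
  moreover have "finite_index G = {H \<in> Sub G. \<exists>A\<in>\<A>. \<forall>g\<in>carrier G. \<exists>a\<in>A. g \<otimes> inv a \<in> H}"
    using finite_index_iff by (auto simp: \<A>_def finite_index_def[of G])
  moreover have "{H \<in> Sub G. \<forall>g\<in>carrier G. \<exists>a\<in>A. g \<otimes> inv a \<in> H} \<in> sets (chabauty_borel G)" if A: "A \<in> \<A>" for A
  proof -
    have "{H \<in> Sub G. \<exists>a\<in>A. g \<otimes> inv a \<in> H} \<in> sets (chabauty_borel G)" if g: "g \<in> carrier G" for g
    proof -
      have "{H \<in> Sub G. \<exists>a\<in>A. g \<otimes> inv a \<in> H} = (\<Union>a\<in>A. {H \<in> Sub G. g \<otimes> inv a \<in> H})" by auto
      also have "\<dots> \<in> sets (chabauty_borel G)"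
        using A g by (intro sets.finite_UN sets_chabauty_coord) (auto simp: \<A>_def)
      finally show ?thesis .
    qed
    moreover have "{H \<in> Sub G. \<forall>g\<in>carrier G. \<exists>a\<in>A. g \<otimes> inv a \<in> H} =
        (\<Inter>g\<in>carrier G. {H \<in> Sub G. \<exists>a\<in>A. g \<otimes> inv a \<in> H})" by auto
    ultimately show ?thesis using assms by (auto intro!: sets.countable_INT')
  qed
  moreover have "{H \<in> Sub G. \<exists>A\<in>\<A>. \<forall>g\<in>carrier G. \<exists>a\<in>A. g \<otimes> inv a \<in> H} =
      (\<Union>A\<in>\<A>. {H \<in> Sub G. \<forall>g\<in>carrier G. \<exists>a\<in>A. g \<otimes> inv a \<in> H})" by auto
  ultimately show ?thesis by (auto intro!: sets.countable_UN')
qed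


section \<open>Uniform mixtures\<close>

text \<open>An index drawn uniformly and a point drawn by \<open>\<mu>\<close> are mapped by
  \<open>\<Psi>\<close>: the mixture is the image of a product measure, and Fubini gives the formula
  for integrals.\<close>

lemma uniform_mixture:
  fixes \<Psi> :: "nat \<Rightarrow> 'b \<Rightarrow> 'c"
  assumes \<mu>: "prob_space \<mu>" and m: "0 < m" and \<Psi>: "\<And>i. i < m \<Longrightarrow> \<Psi> i \<in> measurable \<mu> N"
  obtains \<nu> where "sets \<nu> = sets N" "prob_space \<nu>"
    "\<And>f :: 'c \<Rightarrow> real. f \<in> borel_measurable N \<Longrightarrow> bounded (f ` space N) \<Longrightarrow>
      (\<integral>x. f x \<partial>\<nu>) = (\<Sum>i<m. \<integral>x. f (\<Psi> i x) \<partial>\<mu>) / real m"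
proof -
  define U where "U = uniform_count_measure {..<m}"
  have pU: "prob_space U" unfolding U_def using m by (intro prob_space_uniform_count_measure) auto
  interpret \<mu>: prob_space \<mu> by fact
  interpret U: prob_space U by fact
  interpret P: pair_prob_space U \<mu> ..
  define g where "g = (\<lambda>(i, x). \<Psi> i x)"
  have sU: "sets (U \<Otimes>\<^sub>M \<mu>) = sets (count_space {..<m} \<Otimes>\<^sub>M \<mu>)"
    by (rule sets_pair_measure_cong) (simp_all add: U_def sets_uniform_count_measure)
  have "g \<in> measurable (count_space {..<m} \<Otimes>\<^sub>M \<mu>) N"
    by (rule measurable_pair_measure_countable1) (use \<Psi> in \<open>auto simp: g_def\<close>)
  then have g: "g \<in> measurable (U \<Otimes>\<^sub>M \<mu>) N" by (simp add: measurable_cong_sets[OF sU refl])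
  define \<nu> where "\<nu> = distr (U \<Otimes>\<^sub>M \<mu>) N g"
  have "(\<integral>x. f x \<partial>\<nu>) = (\<Sum>i<m. \<integral>x. f (\<Psi> i x) \<partial>\<mu>) / real m"
    if f: "f \<in> borel_measurable N" "bounded (f ` space N)" for f :: "'c \<Rightarrow> real"
  proof -
    obtain B where B: "\<And>x. x \<in> space N \<Longrightarrow> norm (f x) \<le> B" using f(2) by (auto simp: bounded_iff)
    have fg: "(\<lambda>z. f (g z)) \<in> borel_measurable (U \<Otimes>\<^sub>M \<mu>)" using measurable_compose[OF g f(1)] .
    have int: "integrable (U \<Otimes>\<^sub>M \<mu>) (\<lambda>z. f (g z))"
      by (rule P.integrable_const_bound[of _ B]) (use fg B measurable_space[OF g] in auto)
    have "(\<integral>x. f x \<partial>\<nu>) = (\<integral>z. f (g z) \<partial>(U \<Otimes>\<^sub>M \<mu>))" unfolding \<nu>_def by (rule integral_distr[OF g f(1)])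
    also have "\<dots> = (\<integral>i. (\<integral>x. f (g (i, x)) \<partial>\<mu>) \<partial>U)" by (rule P.integral_fst'[OF int, symmetric])
    also have "\<dots> = (\<Sum>i<m. \<integral>x. f (\<Psi> i x) \<partial>\<mu>) / real m"
      unfolding U_def by (subst integral_uniform_count_measure) (simp_all add: g_def)
    finally show ?thesis .
  qed
  moreover have "prob_space \<nu>" unfolding \<nu>_def by (rule P.prob_space_distr[OF g])
  ultimately show thesis using that[of \<nu>] by (simp add: \<nu>_def)
qed

section \<open>Subgroups of the lamplighter group\<close>

interpretation lamp: group lamplighter
  by (rule group_lamplighter)

lemma el_inject [simp]: "el g = el h \<longleftrightarrow> g = h"
proof
  assume eq: "el g = el h"
  have "x \<in> snd g \<longleftrightarrow> x \<in> snd h" for x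
    using arg_cong[OF eq, of "\<lambda>u. snd u x"] by (simp add: el_def split: if_splits)
  moreover have "fst g = fst h" using arg_cong[OF eq, of fst] by (simp add: el_def)
  ultimately show "g = h" by (simp add: prod_eq_iff set_eq_iff)
qed simp

lemma el_inv: "finite S \<Longrightarrow> inv\<^bsub>lamplighter\<^esub> (el (k, S)) = el (linv (k, S))"
  by (rule lamp.inv_equality) (simp_all add: el_mult el_one el_carrier)

lemma Sub_el:
  assumes "H \<in> Sub lamplighter"
  shows Sub_el_mult: "el g \<in> H \<Longrightarrow> el h \<in> H \<Longrightarrow> el (g \<odot> h) \<in> H"
    and Sub_el_one: "el (0, {}) \<in> H"
    and Sub_el_linv: "finite S \<Longrightarrow> el (k, S) \<in> H \<Longrightarrow> el (- k, tr (- k) S) \<in> H"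
proof -
  interpret H: subgroup H lamplighter using assms by (simp add: Sub_def)
  show "el g \<in> H \<Longrightarrow> el h \<in> H \<Longrightarrow> el (g \<odot> h) \<in> H" using H.m_closed by (metis el_mult)
  show "el (0, {}) \<in> H" using H.one_closed by (simp add: el_one)
  show "finite S \<Longrightarrow> el (k, S) \<in> H \<Longrightarrow> el (- k, tr (- k) S) \<in> H" using H.m_inv_closed by (metis el_inv linv_simp)
qed

lemma Sub_elim:
  assumes "H \<in> Sub lamplighter" "x \<in> H"
  obtains k S where "finite S" "x = el (k, S)"
proof -
  have "x \<in> carrier lamplighter" using assms subgroup.mem_carrier by (auto simp: Sub_def)
  then show thesis using that by (auto simp: carrier_el)
qed

lemma Sub_eqI:
  assumes "H \<subseteq> carrier lamplighter" "K \<subseteq> carrier lamplighter"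
    and "\<And>k S. finite S \<Longrightarrow> el (k, S) \<in> H \<longleftrightarrow> el (k, S) \<in> K"
  shows "H = K"
  using assms unfolding carrier_el by blast

text \<open>The word on the right is the conjugate of \<open>(k, S)\<close> by the inverse of
  \<open>(j, T)\<close>.\<close>

lemma el_mem_conj:
  assumes "H \<in> Sub lamplighter" "finite S" "finite T"
  shows "el (k, S) \<in> conj_subgroup lamplighter (el (j, T)) H \<longleftrightarrow>
    el (k, sd (sd (tr (- j) T) (tr (- j) S)) (tr (k - j) T)) \<in> H"
  using lamp.mem_conj_subgroup[of H "el (j, T)" "el (k, S)"] assms
  by (simp add: Sub_def el_carrier el_inv el_mult)

text \<open>Lamps commute, hence \<open>T\<close> cancels and only the shift by \<open>j\<close>
  remains.\<close>

lemma el_mem_conj_lamp: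
  assumes "H \<in> Sub lamplighter" "finite S" "finite T"
  shows "el (0, S) \<in> conj_subgroup lamplighter (el (j, T)) H \<longleftrightarrow> el (0, tr (- j) S) \<in> H"
proof -
  have "sd (sd (tr (- j) T) (tr (- j) S)) (tr (- j) T) = tr (- j) S" by (auto simp: set_eq_iff)
  then show ?thesis using el_mem_conj[OF assms, of 0 j] by simp
qed

lemma conj_carrier: "H \<in> Sub lamplighter \<Longrightarrow> g \<in> carrier lamplighter \<Longrightarrow>
    conj_subgroup lamplighter g H \<subseteq> carrier lamplighter"
  using lamp.conj_subgroup_Sub subgroup.subset unfolding Sub_def by blast

definition Lamps :: "(int \<times> (int \<Rightarrow> int)) set"
  where "Lamps = {el (0, S) |S. finite S}"

lemma el_mem_Lamps: "finite S \<Longrightarrow> el (k, S) \<in> Lamps \<longleftrightarrow> k = 0"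
  by (auto simp: Lamps_def)

lemma subset_Lamps_iff:
  assumes "H \<in> Sub lamplighter"
  shows "H \<subseteq> Lamps \<longleftrightarrow> (\<forall>k S. finite S \<longrightarrow> k \<noteq> 0 \<longrightarrow> el (k, S) \<notin> H)"
proof
  assume "H \<subseteq> Lamps"
  then show "\<forall>k S. finite S \<longrightarrow> k \<noteq> 0 \<longrightarrow> el (k, S) \<notin> H" using el_mem_Lamps by blast
next
  assume R: "\<forall>k S. finite S \<longrightarrow> k \<noteq> 0 \<longrightarrow> el (k, S) \<notin> H"
  show "H \<subseteq> Lamps"
  proof
    fix x assume x: "x \<in> H"
    obtain k S where "finite S" "x = el (k, S)" using Sub_elim[OF assms x] .
    then show "x \<in> Lamps" using R x el_mem_Lamps by blast
  qed
qed

text \<open>Conjugation does not change the cursor.\<close>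

lemma conj_subset_Lamps_iff:
  assumes H: "H \<in> Sub lamplighter" and T: "finite T"
  shows "conj_subgroup lamplighter (el (j, T)) H \<subseteq> Lamps \<longleftrightarrow> H \<subseteq> Lamps"
proof -
  have C: "conj_subgroup lamplighter (el (j, T)) H \<in> Sub lamplighter"
    using lamp.conj_subgroup_Sub[OF H el_carrier[OF T]] .
  have "(\<exists>S. finite S \<and> el (k, S) \<in> conj_subgroup lamplighter (el (j, T)) H) \<longleftrightarrow> (\<exists>S. finite S \<and> el (k, S) \<in> H)" for k
  proof
    assume "\<exists>S. finite S \<and> el (k, S) \<in> conj_subgroup lamplighter (el (j, T)) H"
    then obtain S where "finite S" "el (k, sd (sd (tr (- j) T) (tr (- j) S)) (tr (k - j) T)) \<in> H"
      using el_mem_conj[OF H _ T] by blast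
    then show "\<exists>S. finite S \<and> el (k, S) \<in> H" using T by (intro exI[of _ "sd (sd (tr (- j) T) (tr (- j) S)) (tr (k - j) T)"]) simp
  next
    assume "\<exists>S. finite S \<and> el (k, S) \<in> H"
    then obtain S where S: "finite S" "el (k, S) \<in> H" by blast
    define S' where "S' = sd (sd T (tr j S)) (tr k T)"
    have "sd (sd (tr (- j) T) (tr (- j) S')) (tr (k - j) T) = S"
      by (auto simp: S'_def set_eq_iff algebra_simps)
    then have "el (k, S') \<in> conj_subgroup lamplighter (el (j, T)) H"
      using el_mem_conj[OF H _ T, of S' k j] S T by (simp add: S'_def)
    moreover have "finite S'" using S T by (simp add: S'_def)
    ultimately show "\<exists>S. finite S \<and> el (k, S) \<in> conj_subgroup lamplighter (el (j, T)) H" by blast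
  qed
  then show ?thesis unfolding subset_Lamps_iff[OF H] subset_Lamps_iff[OF C] by blast
qed


section \<open>Periodising the lamps\<close>

text \<open>Push-forward of a configuration to the residues modulo \<open>m\<close>, lamps added
  modulo 2, with residues represented in \<open>0..<m\<close>.\<close>

definition fold_mod :: "nat \<Rightarrow> int set \<Rightarrow> int set"
  where "fold_mod m S = {r. 0 \<le> r \<and> r < int m \<and> odd (card {x \<in> S. x mod int m = r})}"

lemma odd_card_sd:
  assumes "finite A" "finite B" shows "odd (card (sd A B)) \<longleftrightarrow> odd (card A) \<noteq> odd (card B)"
proof -
  have "sd A B = (A - B) \<union> (B - A)" by auto
  then have "card (sd A B) = card (A - B) + card (B - A)"
    using card_Un_disjoint[of "A - B" "B - A"] assms by auto
  moreover have "card A = card (A \<inter> B) + card (A - B)" "card B = card (A \<inter> B) + card (B - A)"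
    using card_Int_Diff[OF assms(1), of B] card_Int_Diff[OF assms(2), of A] by (simp_all add: Int_commute)
  ultimately show ?thesis by presburger
qed

lemma fold_mod_sd:
  assumes "finite S" "finite T" shows "fold_mod m (sd S T) = sd (fold_mod m S) (fold_mod m T)"
proof -
  have "{x \<in> sd S T. x mod int m = r} = sd {x \<in> S. x mod int m = r} {x \<in> T. x mod int m = r}" for r by auto
  then show ?thesis using assms by (auto simp: fold_mod_def odd_card_sd)
qed

lemma fold_mod_empty [simp]: "fold_mod m {} = {}"
  by (simp add: fold_mod_def)

lemma fold_mod_id:
  assumes "S \<subseteq> {0..<int m}" shows "fold_mod m S = S"
proof -
  have "odd (card {x \<in> S. x mod int m = r}) \<longleftrightarrow> r \<in> S" if "0 \<le> r" "r < int m" for r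
  proof -
    have "x \<in> S \<Longrightarrow> x mod int m = x" for x using assms by (simp add: subset_iff)
    then have "{x \<in> S. x mod int m = r} = (if r \<in> S then {r} else {})" by auto
    then show ?thesis by simp
  qed
  then have "r \<in> fold_mod m S \<longleftrightarrow> r \<in> S" for r using assms by (auto simp: fold_mod_def subset_iff)
  then show ?thesis by blast
qed

lemma fold_mod_range: "fold_mod m S \<subseteq> {0..<int m}"
  by (auto simp: fold_mod_def)

lemma finite_fold_mod [simp]: "finite (fold_mod m S)"
  using fold_mod_range finite_subset by blast

lemma fold_mod_tr:
  assumes "int m dvd k" shows "fold_mod m (tr k S) = fold_mod m S"
proof -
  have "card {x \<in> tr k S. x mod int m = r} = card {x \<in> S. x mod int m = r}" for r
  proof -
    have md: "(x + k) mod int m = x mod int m" for x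
      using assms by (metis add.right_neutral mod_add_right_eq mod_eq_0_iff_dvd)
    have "{x \<in> tr k S. x mod int m = r} = (\<lambda>x. x + k) ` {x \<in> S. x mod int m = r}"
    proof (intro equalityI subsetI)
      fix y assume y: "y \<in> {x \<in> tr k S. x mod int m = r}"
      then have "y - k \<in> {x \<in> S. x mod int m = r}" using md[of "y - k"] by simp
      then show "y \<in> (\<lambda>x. x + k) ` {x \<in> S. x mod int m = r}" by (rule rev_image_eqI) simp
    qed (auto simp: md)
    then show ?thesis by (simp add: card_image)
  qed
  then show ?thesis by (simp add: fold_mod_def)
qed

text \<open>The preimage, under the reduction to \<open>\<int>/2 \<wr> \<int>/m\<close>, of the configurations of \<open>H\<close> supported in
  the window \<open>{- s..<m - s}\<close>.\<close>

definition window_sub :: "nat \<Rightarrow> int \<Rightarrow> (int \<times> (int \<Rightarrow> int)) set \<Rightarrow> (int \<times> (int \<Rightarrow> int)) set"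
  where "window_sub m s H =
    {el (k, S) |k S. finite S \<and> int m dvd k \<and> el (0, tr (- s) (fold_mod m (tr s S))) \<in> H}"

lemma el_mem_window: "finite S \<Longrightarrow> el (k, S) \<in> window_sub m s H \<longleftrightarrow>
    int m dvd k \<and> el (0, tr (- s) (fold_mod m (tr s S))) \<in> H"
  by (auto simp: window_sub_def)

lemma fold_tr_shift: "int m dvd k \<Longrightarrow> fold_mod m (tr (s + k) S) = fold_mod m (tr s S)"
  using fold_mod_tr[of m k "tr s S"] by (simp add: add.commute)

text \<open>A cursor divisible by \<open>m\<close> shifts by full periods, which folding does not
  see; on such words folding turns the product into the sum of the configurations.\<close>

lemma window_Sub:
  assumes H: "H \<in> Sub lamplighter" shows "window_sub m s H \<in> Sub lamplighter"
proof -
  let ?W = "window_sub m s H"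
  have "subgroup ?W lamplighter"
  proof (rule lamp.subgroupI)
    show "?W \<subseteq> carrier lamplighter" by (auto simp: window_sub_def el_carrier)
    have "el (0, {}) \<in> ?W" using Sub_el_one[OF H] by (simp add: el_mem_window)
    then show "?W \<noteq> {}" by blast
  next
    fix x assume "x \<in> ?W"
    then obtain k S where x: "x = el (k, S)" "finite S" "int m dvd k" "el (0, tr (- s) (fold_mod m (tr s S))) \<in> H"
      by (auto simp: window_sub_def)
    have "fold_mod m (tr (s - k) S) = fold_mod m (tr s S)" using fold_tr_shift[of m "- k" s S] x(3) by simp
    then have "el (- k, tr (- k) S) \<in> ?W" using x by (simp add: el_mem_window)
    then show "inv\<^bsub>lamplighter\<^esub> x \<in> ?W" using x by (simp add: el_inv)
    fix y assume "y \<in> ?W"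
    then obtain l T where y: "y = el (l, T)" "finite T" "int m dvd l" "el (0, tr (- s) (fold_mod m (tr s T))) \<in> H"
      by (auto simp: window_sub_def)
    have "fold_mod m (tr s (sd S (tr k T))) = sd (fold_mod m (tr s S)) (fold_mod m (tr s T))"
      using fold_tr_shift[OF x(3), of s T] x(2) y(2) by (simp add: tr_sd fold_mod_sd)
    then have "el (0, tr (- s) (fold_mod m (tr s (sd S (tr k T))))) \<in> H"
      using Sub_el_mult[OF H x(4) y(4)] by (simp add: tr_sd)
    then show "x \<otimes>\<^bsub>lamplighter\<^esub> y \<in> ?W" using x y by (simp add: el_mult el_mem_window)
  qed
  then show ?thesis by (simp add: Sub_def)
qed

text \<open>The subgroup contains the kernel of the reduction to the finite group of lamps and
  cursors modulo \<open>m\<close>; \<open>?A\<close> lifts the elements of that group.\<close>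

lemma window_finite_index:
  assumes H: "H \<in> Sub lamplighter" and m: "0 < m"
  shows "window_sub m s H \<in> finite_index lamplighter"
  unfolding lamp.finite_index_iff[OF window_Sub[OF H]]
proof (intro exI conjI ballI)
  let ?A = "el ` ({0..<int m} \<times> (tr (- s) ` Pow {0..<int m}))"
  show "finite ?A" by simp
  have "finite R" if "R \<subseteq> {0..<int m}" for R using finite_subset[OF that] by simp
  then show "?A \<subseteq> carrier lamplighter" by (auto simp: carrier_el)
  fix g assume "g \<in> carrier lamplighter"
  then obtain k S where g: "g = el (k, S)" "finite S" by (auto simp: carrier_el)
  define F where "F = fold_mod m (tr s S)"
  define j where "j = k mod int m"
  have F: "fold_mod m F = F" "finite F" unfolding F_def by (simp_all add: fold_mod_id fold_mod_range)
  have dvd: "int m dvd k - j" by (simp add: j_def minus_mod_eq_mult_div)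
  have "j \<in> {0..<int m}" using m by (simp add: j_def)
  moreover have "F \<in> Pow {0..<int m}" using fold_mod_range by (simp add: F_def)
  ultimately have a: "el (j, tr (- s) F) \<in> ?A" by blast
  have "fold_mod m (tr s (sd S (tr (k - j) (tr (- s) F)))) = sd F (fold_mod m (tr (k - j) F))"
    using g(2) F(2) by (simp add: tr_sd fold_mod_sd F_def)
  also have "\<dots> = {}" using fold_mod_tr[OF dvd] F(1) by simp
  finally have "el (k - j, sd S (tr (k - j) (tr (- s) F))) \<in> window_sub m s H"
    using dvd g(2) F(2) Sub_el_one[OF H] by (simp add: el_mem_window)
  then have "g \<otimes>\<^bsub>lamplighter\<^esub> inv\<^bsub>lamplighter\<^esub> (el (j, tr (- s) F)) \<in> window_sub m s H"
    using g F(2) by (simp add: el_inv el_mult algebra_simps)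
  then show "\<exists>a\<in>?A. g \<otimes>\<^bsub>lamplighter\<^esub> inv\<^bsub>lamplighter\<^esub> a \<in> window_sub m s H" using a by blast
qed

text \<open>Conjugation moves the window by \<open>j\<close>. For cursors divisible by
  \<open>m\<close> the two copies of \<open>T\<close> coincide after folding and cancel; other
  cursors occur on neither side.\<close>

lemma conj_window:
  assumes H: "H \<in> Sub lamplighter" and T: "finite T"
  shows "conj_subgroup lamplighter (el (j, T)) (window_sub m s H) =
    window_sub m (s - j) (conj_subgroup lamplighter (el (j, T)) H)"
proof (rule Sub_eqI)
  note C = lamp.conj_subgroup_Sub[OF H el_carrier[OF T]]
  show "conj_subgroup lamplighter (el (j, T)) (window_sub m s H) \<subseteq> carrier lamplighter"
    using conj_carrier[OF window_Sub[OF H] el_carrier[OF T]] .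
  show "window_sub m (s - j) (conj_subgroup lamplighter (el (j, T)) H) \<subseteq> carrier lamplighter"
    using window_Sub[OF C] subgroup.subset unfolding Sub_def by blast
  fix k S assume S: "finite (S :: int set)"
  show "el (k, S) \<in> conj_subgroup lamplighter (el (j, T)) (window_sub m s H) \<longleftrightarrow>
      el (k, S) \<in> window_sub m (s - j) (conj_subgroup lamplighter (el (j, T)) H)"
  proof (cases "int m dvd k")
    case True
    have "fold_mod m (tr (s + (k - j)) T) = fold_mod m (tr (s - j) T)"
      using fold_tr_shift[OF True, of "s - j" T] by (simp add: algebra_simps)
    then have "fold_mod m (tr s (sd (sd (tr (- j) T) (tr (- j) S)) (tr (k - j) T))) = fold_mod m (tr (s - j) S)"
      using S T by (simp add: tr_sd fold_mod_sd) (auto simp: set_eq_iff)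
    then have "el (k, S) \<in> conj_subgroup lamplighter (el (j, T)) (window_sub m s H) \<longleftrightarrow>
        el (0, tr (- s) (fold_mod m (tr (s - j) S))) \<in> H"
      using el_mem_conj[OF window_Sub[OF H] S T] S T True by (simp add: el_mem_window)
    also have "\<dots> \<longleftrightarrow> el (k, S) \<in> window_sub m (s - j) (conj_subgroup lamplighter (el (j, T)) H)"
      using S T True el_mem_conj_lamp[OF H _ T, of "tr (- (s - j)) (fold_mod m (tr (s - j) S))" j]
      by (simp add: el_mem_window)
    finally show ?thesis .
  next
    case False
    then show ?thesis using el_mem_conj[OF window_Sub[OF H] S T] S T by (simp add: el_mem_window)
  qed
qed

text \<open>A full period of the window is absorbed by conjugation with \<open>t ^ m\<close>, so
  that for an invariant measure the position of the window matters only modulo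
  \<open>m\<close>.\<close>

lemma window_periodic:
  assumes H: "H \<in> Sub lamplighter"
  shows "window_sub m (s + int m) H = window_sub m s (conj_subgroup lamplighter (el (int m, {})) H)"
proof -
  have "el (0, tr (- (s + int m)) (fold_mod m (tr (s + int m) S))) \<in> H \<longleftrightarrow>
      el (0, tr (- s) (fold_mod m (tr s S))) \<in> conj_subgroup lamplighter (el (int m, {})) H" for S
    using el_mem_conj_lamp[OF H, of "tr (- s) (fold_mod m (tr s S))" "{}" "int m"]
    by (simp add: fold_tr_shift algebra_simps)
  then show ?thesis by (simp add: window_sub_def)
qed

text \<open>Subgroups outside \<open>Lamps\<close> are kept: almost surely they have finite index
  already.\<close>

definition approx_sub :: "nat \<Rightarrow> int \<Rightarrow> (int \<times> (int \<Rightarrow> int)) set \<Rightarrow> (int \<times> (int \<Rightarrow> int)) set"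
  where "approx_sub m s H = (if H \<subseteq> Lamps then window_sub m s H else H)"

lemma approx_Sub: "H \<in> Sub lamplighter \<Longrightarrow> approx_sub m s H \<in> Sub lamplighter"
  by (simp add: approx_sub_def window_Sub)

lemma conj_approx:
  assumes "H \<in> Sub lamplighter" "finite T"
  shows "conj_subgroup lamplighter (el (j, T)) (approx_sub m s H) =
    approx_sub m (s - j) (conj_subgroup lamplighter (el (j, T)) H)"
  using assms by (simp add: approx_sub_def conj_window conj_subset_Lamps_iff)

text \<open>The hypotheses on \<open>s\<close> place the box of radius \<open>r\<close> inside the
  window, where folding is the identity, and force \<open>r < m\<close>, so that no nonzero cursor
  of the box is divisible by \<open>m\<close>.\<close>

lemma approx_agree:
  assumes H: "H \<in> Sub lamplighter" and F: "F \<subseteq> el ` wbox r" and s: "int r \<le> s" "s + int r < int m"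
  shows "approx_sub m s H \<inter> F = H \<inter> F"
proof (cases "H \<subseteq> Lamps")
  case True
  have "x \<in> window_sub m s H \<longleftrightarrow> x \<in> H" if x: "x \<in> F" for x
  proof -
    obtain k S where kS: "x = el (k, S)" "(k, S) \<in> wbox r" using F x by auto
    then have k: "\<bar>k\<bar> \<le> int r" and S: "\<And>u. u \<in> S \<Longrightarrow> \<bar>u\<bar> \<le> int r" by (auto simp: pair_in_wbox)
    have fS: "finite S" using kS(2) by (auto simp: wbox_def intro: finite_subset[of _ "{- int r..int r}"])
    show ?thesis
    proof (cases "k = 0")
      case True
      have "tr s S \<subseteq> {0..<int m}"
      proof
        fix u assume "u \<in> tr s S"
        then have "\<bar>u - s\<bar> \<le> int r" using S by simp
        then show "u \<in> {0..<int m}" using s by (simp add: abs_le_iff)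
      qed
      then show ?thesis using True fS by (simp add: kS el_mem_window fold_mod_id)
    next
      case False
      have "\<not> int m dvd k" using False k s zdvd_imp_le[of "int m" "\<bar>k\<bar>"] by auto
      moreover have "el (k, S) \<notin> H" using \<open>H \<subseteq> Lamps\<close> False fS el_mem_Lamps by blast
      ultimately show ?thesis using fS by (simp add: kS el_mem_window)
    qed
  qed
  then show ?thesis using True by (auto simp: approx_sub_def)
qed (simp add: approx_sub_def)

lemma sets_subset_Lamps: "{H \<in> Sub lamplighter. H \<subseteq> Lamps} \<in> sets (chabauty_borel lamplighter)"
proof -
  have "{H \<in> Sub lamplighter. H \<subseteq> Lamps} =
      Sub lamplighter - (\<Union>g\<in>carrier lamplighter - Lamps. {H \<in> Sub lamplighter. g \<in> H})"
    using subgroup.mem_carrier by (fastforce simp: Sub_def)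
  moreover have "Sub lamplighter \<in> sets (chabauty_borel lamplighter)"
    using sets.top[of "chabauty_borel lamplighter"] by (simp add: space_chabauty_borel)
  moreover have "(\<Union>g\<in>carrier lamplighter - Lamps. {H \<in> Sub lamplighter. g \<in> H}) \<in> sets (chabauty_borel lamplighter)"
    using countable_lamplighter sets_chabauty_coord by (intro sets.countable_UN') auto
  ultimately show ?thesis by simp
qed

lemma measurable_approx_sub:
  "approx_sub m s \<in> measurable (chabauty_borel lamplighter) (chabauty_borel lamplighter)"
proof (rule measurable_into_chabauty[OF countable_lamplighter])
  show "approx_sub m s H \<in> Sub lamplighter" if "H \<in> space (chabauty_borel lamplighter)" for H
    using that approx_Sub by (simp add: space_chabauty_borel)
  fix g assume "g \<in> carrier lamplighter"
  then obtain k S where g: "g = el (k, S)" "finite S" by (auto simp: carrier_el)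
  let ?L = "{H \<in> Sub lamplighter. H \<subseteq> Lamps}"
  let ?W = "{H \<in> Sub lamplighter. g \<in> window_sub m s H}"
  let ?E = "{H \<in> Sub lamplighter. g \<in> H}"
  have "?W = (if int m dvd k then {H \<in> Sub lamplighter. el (0, tr (- s) (fold_mod m (tr s S))) \<in> H} else {})"
    using g by (auto simp: el_mem_window)
  then have "?W \<in> sets (chabauty_borel lamplighter)" by (simp add: sets_chabauty_coord el_carrier)
  moreover have "?E \<in> sets (chabauty_borel lamplighter)" using g by (simp add: sets_chabauty_coord el_carrier)
  moreover have "{H \<in> space (chabauty_borel lamplighter). g \<in> approx_sub m s H} = (?L \<inter> ?W) \<union> (?E - ?L)"
    by (auto simp: space_chabauty_borel approx_sub_def)
  ultimately show "{H \<in> space (chabauty_borel lamplighter). g \<in> approx_sub m s H} \<in> sets (chabauty_borel lamplighter)"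
    using sets_subset_Lamps by simp
qed

section \<open>Invariant random subgroups not contained in the lamp group\<close>

text \<open>The configurations in \<open>R\<close> lie in different cosets of the lamps of
  \<open>H\<close>; such a family takes the place of a large orbit in the finite count.\<close>

definition separated :: "(int \<times> (int \<Rightarrow> int)) set \<Rightarrow> int set set \<Rightarrow> bool"
  where "separated H R \<longleftrightarrow> (\<forall>T\<in>R. \<forall>T'\<in>R. T \<noteq> T' \<longrightarrow> el (0, sd T T') \<notin> H)"

lemma separated_subset: "separated H R \<Longrightarrow> R' \<subseteq> R \<Longrightarrow> separated H R'"
  unfolding separated_def by blast

text \<open>A maximal separated set is a finite transversal of the lamp group modulo \<open>H\<close>; together with
  \<open>(p, b) \<in> H\<close> this bounds the index of \<open>H\<close>.\<close>

lemma infinite_index_separated: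
  assumes H: "H \<in> Sub lamplighter" and pb: "el (p, b) \<in> H" "finite b" "0 < p"
    and inf: "H \<notin> finite_index lamplighter"
  shows "\<exists>R. finite R \<and> card R = n \<and> (\<forall>T\<in>R. finite T) \<and> separated H R"
proof (rule ccontr)
  assume neg: "\<not> ?thesis"
  define Q where "Q R \<longleftrightarrow> finite R \<and> (\<forall>T\<in>R. finite T) \<and> separated H R" for R
  have small: "card R < n" if "Q R" for R
  proof (rule ccontr)
    assume "\<not> card R < n"
    then obtain R' where R': "R' \<subseteq> R" "card R' = n" "finite R'"
      using obtain_subset_with_card_n[of n R] by (metis linorder_not_less)
    then have "\<exists>R. finite R \<and> card R = n \<and> (\<forall>T\<in>R. finite T) \<and> separated H R"
      using \<open>Q R\<close> separated_subset unfolding Q_def by blast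
    then show False using neg by simp
  qed
  have "Q {}" by (simp add: Q_def separated_def)
  then obtain R where R: "Q R" "\<And>R'. Q R' \<Longrightarrow> card R' \<le> card R"
    using ex_has_greatest_nat[of Q "{}" card n] small by blast
  have repr: "\<exists>r\<in>R. el (0, sd T r) \<in> H" if T: "finite T" for T
  proof (rule ccontr)
    assume no: "\<not> ?thesis"
    have "T \<notin> R"
    proof
      assume "T \<in> R"
      then have "el (0, sd T T) \<notin> H" using no by blast
      then show False using Sub_el_one[OF H] by simp
    qed
    moreover have "separated H (insert T R)"
      unfolding separated_def
    proof (intro ballI impI)
      fix A B assume AB: "A \<in> insert T R" "B \<in> insert T R" "A \<noteq> B"
      consider "A = T" "B \<in> R" | "B = T" "A \<in> R" | "A \<in> R" "B \<in> R" using AB by blast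
      then show "el (0, sd A B) \<notin> H"
      proof cases
        case 1 then show ?thesis using no by blast
      next
        case 2 then show ?thesis using no sd_commute by metis
      next
        case 3 then show ?thesis using R(1) AB(3) unfolding Q_def separated_def by blast
      qed
    qed
    ultimately have "Q (insert T R)" "card (insert T R) = Suc (card R)"
      using R(1) T by (auto simp: Q_def)
    then show False using R(2) by fastforce
  qed
  define A where "A = el ` ({0..<p} \<times> R)"
  define good where "good k \<longleftrightarrow> (\<forall>S. finite S \<longrightarrow> (\<exists>a\<in>{0..<p} \<times> R. el ((k, S) \<odot> linv a) \<in> H))" for k
  have base: "good k" if "0 \<le> k" "k < p" for k
    unfolding good_def
  proof (intro allI impI)
    fix S :: "int set" assume "finite S"
    then obtain r where r: "r \<in> R" "el (0, sd S r) \<in> H" using repr by blast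
    then show "\<exists>a\<in>{0..<p} \<times> R. el ((k, S) \<odot> linv a) \<in> H"
      using that by (intro bexI[of _ "(k, r)"]) auto
  qed
  \<comment> \<open>Left multiplication by \<open>(p, b)\<close> or its inverse stays in
    \<open>H\<close> and changes the cursor by \<open>p\<close>, so the cursors in
    \<open>0..<p\<close> decide.\<close>
  have shift: "good k \<longleftrightarrow> good (k + p)" for k
  proof
    assume g: "good k"
    show "good (k + p)"
      unfolding good_def
    proof (intro allI impI)
      fix S :: "int set" assume S: "finite S"
      define S' where "S' = tr (- p) (sd b S)"
      have "finite S'" using S pb(2) by (simp add: S'_def)
      then obtain a where a: "a \<in> {0..<p} \<times> R" "el ((k, S') \<odot> linv a) \<in> H" using g unfolding good_def by blast
      have "(p, b) \<odot> (k, S') = (k + p, S)" by (simp add: S'_def add.commute)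
      then have "el ((k + p, S) \<odot> linv a) \<in> H"
        using Sub_el_mult[OF H pb(1) a(2)] by (simp only: lmul_assoc[symmetric])
      then show "\<exists>a\<in>{0..<p} \<times> R. el ((k + p, S) \<odot> linv a) \<in> H" using a(1) by blast
    qed
  next
    assume g: "good (k + p)"
    show "good k"
      unfolding good_def
    proof (intro allI impI)
      fix S :: "int set" assume S: "finite S"
      define S' where "S' = sd b (tr p S)"
      have "finite S'" using S pb(2) by (simp add: S'_def)
      then obtain a where a: "a \<in> {0..<p} \<times> R" "el ((k + p, S') \<odot> linv a) \<in> H" using g unfolding good_def by blast
      have "linv (p, b) \<odot> (k + p, S') = (k, S)" by (simp add: S'_def tr_sd)
      moreover have "el (linv (p, b)) \<in> H" using Sub_el_linv[OF H pb(2,1)] by simp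
      ultimately have "el ((k, S) \<odot> linv a) \<in> H"
        using Sub_el_mult[OF H _ a(2), of "linv (p, b)"] by (simp only: lmul_assoc[symmetric])
      then show "\<exists>a\<in>{0..<p} \<times> R. el ((k, S) \<odot> linv a) \<in> H" using a(1) by blast
    qed
  qed
  have shifts: "good k \<longleftrightarrow> good (k + int i * p)" for k i
  proof (induction i)
    case (Suc i)
    have "k + int (Suc i) * p = k + int i * p + p" by (simp add: algebra_simps)
    then show ?case using Suc shift[of "k + int i * p"] by (simp only:)
  qed simp
  have all: "good k" for k
  proof -
    have *: "good (k mod p)" using base pb(3) by simp
    show ?thesis
    proof (cases "0 \<le> k div p")
      case True
      then have "k mod p + int (nat (k div p)) * p = k" by simp
      then show ?thesis using shifts[of "k mod p" "nat (k div p)"] * by (simp only:)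
    next
      case False
      then have "k + int (nat (- (k div p))) * p = k mod p" by (simp add: minus_div_mult_eq_mod)
      then show ?thesis using shifts[of k "nat (- (k div p))"] * by (simp only:)
    qed
  qed
  have "H \<in> finite_index lamplighter"
    unfolding lamp.finite_index_iff[OF H]
  proof (intro exI[of _ A] conjI ballI)
    show "finite A" using R(1) by (simp add: A_def Q_def)
    show "A \<subseteq> carrier lamplighter" using R(1) by (auto simp: A_def Q_def el_carrier)
    fix g assume "g \<in> carrier lamplighter"
    then obtain k S where g: "g = el (k, S)" "finite S" by (auto simp: carrier_el)
    then obtain i r where a: "i \<in> {0..<p}" "r \<in> R" "el ((k, S) \<odot> linv (i, r)) \<in> H" using all unfolding good_def by blast
    have "g \<otimes>\<^bsub>lamplighter\<^esub> inv\<^bsub>lamplighter\<^esub> (el (i, r)) = el ((k, S) \<odot> linv (i, r))"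
      using R(1) a(2) by (simp only: g el_inv el_mult Q_def)
    then show "\<exists>a\<in>A. g \<otimes>\<^bsub>lamplighter\<^esub> inv\<^bsub>lamplighter\<^esub> a \<in> H"
      unfolding A_def using a by (intro bexI[of _ "el (i, r)"]) auto
  qed
  then show False using inf by simp
qed

locale lamp_IRS =
  fixes \<mu> :: "(int \<times> (int \<Rightarrow> int)) set measure"
  assumes \<mu>: "\<mu> \<in> IRS lamplighter"
begin

abbreviation "N \<equiv> chabauty_borel lamplighter"

lemma sets_\<mu>: "sets \<mu> = sets N"
  using \<mu> by (simp add: IRS_def prob_measures_def)

lemma space_\<mu>: "space \<mu> = Sub lamplighter"
  using sets_eq_imp_space_eq[OF sets_\<mu>] by (simp add: space_chabauty_borel)

sublocale prob_space \<mu>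
  using \<mu> by (simp add: IRS_def prob_measures_def)

lemma borel_\<mu>: "f \<in> borel_measurable N \<Longrightarrow> f \<in> borel_measurable \<mu>"
  using measurable_cong_sets[OF sets_\<mu> refl] by blast

lemma integral_conj:
  fixes f :: "_ \<Rightarrow> real"
  assumes "f \<in> borel_measurable N" "finite T"
  shows "(\<integral>H. f (conj_subgroup lamplighter (el (j, T)) H) \<partial>\<mu>) = (\<integral>H. f H \<partial>\<mu>)"
  by (rule lamp.IRS_integral_conj[OF countable_lamplighter el_carrier[OF assms(2)] \<mu> assms(1)])

lemma measurable_conj:
  "finite T \<Longrightarrow> conj_subgroup lamplighter (el (j, T)) \<in> measurable N N"
  by (rule lamp.measurable_conj_subgroup[OF countable_lamplighter el_carrier])

text \<open>The count of \<open>card_exceptional\<close> with \<open>\<mu>\<close> in place of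
  counting points: by invariance the expected number of \<open>T\<close> inside \<open>J\<close>
  whose conjugate of \<open>H\<close> lies in \<open>S\<close> is
  \<open>2 ^ card J * prob S\<close>. It is at most \<open>2 ^ card I / n\<close> for every
  \<open>H\<close>, since \<open>n\<close> separated cosets leave at most that many lamp elements of
  the window in \<open>H\<close>.\<close>

lemma prob_separated_le:
  fixes n :: nat
  assumes p: "0 < p" "p \<le> int k" and b: "finite b"
  defines "S \<equiv> {H \<in> Sub lamplighter. el (p, b) \<in> H \<and> (\<exists>R \<subseteq> Pow {- int k..int k}. card R = n \<and> separated H R)}"
  shows "S \<in> sets N" "real n * prob S \<le> 2 ^ nat p"
proof -
  define I where "I = {- int k..int k}"
  define J where "J = {- int k..int k - p}"
  define c where "c T = sd T (tr p T)" for T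
  have fI: "finite I" "finite J" "J \<subseteq> I" using p by (auto simp: I_def J_def)
  have fin: "finite T" if "T \<subseteq> I" for T using that fI finite_subset by blast
  define \<R> where "\<R> = {R. R \<subseteq> Pow I \<and> card R = n}"
  have f\<R>: "finite \<R>"
  proof (rule finite_subset)
    show "\<R> \<subseteq> Pow (Pow I)" by (auto simp: \<R>_def)
    show "finite (Pow (Pow I))" using fI(1) by (simp only: finite_Pow_iff)
  qed
  have spN: "space N = Sub lamplighter" by (rule space_chabauty_borel)
  have el1: "{H \<in> space N. el (k, T) \<in> H} \<in> sets N" if "finite T" for k T
    using sets_chabauty_coord[OF el_carrier[OF that]] by (simp add: spN)
  have S_eq: "S = {H \<in> space N. el (p, b) \<in> H \<and> (\<exists>R\<in>\<R>. \<forall>T\<in>R. \<forall>T'\<in>R. T = T' \<or> \<not> el (0, sd T T') \<in> H)}"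
  proof -
    have sep: "separated H R \<longleftrightarrow> (\<forall>T\<in>R. \<forall>T'\<in>R. T = T' \<or> \<not> el (0, sd T T') \<in> H)" for H R
      unfolding separated_def by blast
    show ?thesis unfolding S_def spN \<R>_def I_def by (simp only: sep Bex_def mem_Collect_eq conj_assoc)
  qed
  show S: "S \<in> sets N"
    unfolding S_eq
  proof (intro sets.sets_Collect_conj sets.sets_Collect_finite_Ex sets.sets_Collect_finite_All f\<R> el1 b)
    fix R T T' assume R: "R \<in> \<R>"
    show "finite R" "finite R" using R fI(1) finite_subset[of R "Pow I"] by (simp_all add: \<R>_def)
    assume "T \<in> R" "T' \<in> R"
    then have "T \<subseteq> I" "T' \<subseteq> I" using R unfolding \<R>_def by blast+
    then have "finite T" "finite T'" using fin by simp_all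
    then show "{H \<in> space N. T = T' \<or> \<not> el (0, sd T T') \<in> H} \<in> sets N"
      using sets.sets_Collect_neg[OF el1[of "sd T T'" 0]] by (cases "T = T'") auto
  qed
  define P where "P H = {T \<in> Pow J. conj_subgroup lamplighter (el (0, T)) H \<in> S}" for H
  have cardP: "n * card (P H) \<le> 2 ^ card I" if H: "H \<in> Sub lamplighter" for H
  proof (cases "P H = {}")
    case False
    then obtain T0 where T0: "T0 \<in> P H" by blast
    have fT: "finite T" "T \<subseteq> I" if "T \<in> P H" for T using that fin fI(3) by (auto simp: P_def)
    have lamp_conj: "el (0, A) \<in> conj_subgroup lamplighter (el (0, T)) H \<longleftrightarrow> el (0, A) \<in> H"
      if "finite A" "finite T" for A T
      using el_mem_conj_lamp[OF H that, of 0] by simp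
    have pbc: "el (p, sd b (c T)) \<in> H" if T: "T \<in> P H" for T
    proof -
      have "el (p, b) \<in> conj_subgroup lamplighter (el (0, T)) H" using T by (simp add: P_def S_def)
      then have "el (p, sd (sd T b) (tr p T)) \<in> H" using el_mem_conj[OF H b fT(1)[OF T], of p 0] by simp
      moreover have "sd (sd T b) (tr p T) = sd b (c T)" by (auto simp: c_def set_eq_iff)
      ultimately show ?thesis by simp
    qed
    obtain R where R: "R \<subseteq> Pow I" "card R = n" "separated (conj_subgroup lamplighter (el (0, T0)) H) R"
      using T0 by (auto simp: P_def S_def I_def)
    have R_sep: "el (0, sd A B) \<notin> H" if "A \<in> R" "B \<in> R" "A \<noteq> B" for A B
      using R(1,3) that lamp_conj[of "sd A B" T0] fin fT(1)[OF T0] unfolding separated_def by (metis PowD finite_sd subsetD)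
    define K where "K = {A. A \<subseteq> I \<and> el (0, A) \<in> H}"
    have "card (P H) \<le> card K"
    proof (rule card_inj_on_le)
      show "inj_on (\<lambda>T. c (sd T T0)) (P H)"
      proof (rule inj_onI)
        fix T T' assume T: "T \<in> P H" "T' \<in> P H" "c (sd T T0) = c (sd T' T0)"
        then have "sd T T0 = sd T' T0"
          using sd_tr_inject[of "sd T T0" "sd T' T0" p] p(1) fT(1) T0 by (auto simp: c_def)
        then show "T = T'" by (auto simp: set_eq_iff)
      qed
      show "finite K" using fI(1) by (auto simp: K_def)
      show "(\<lambda>T. c (sd T T0)) ` P H \<subseteq> K"
      proof (rule image_subsetI)
        fix T assume T: "T \<in> P H"
        \<comment> \<open>\<open>H\<close> contains the conjugates of \<open>(p, b)\<close> by all
          \<open>T\<close> in \<open>P H\<close>; dividing by the one for \<open>T0\<close> leaves a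
          lamp element that determines \<open>T\<close>.\<close>
        have "el (linv (p, sd b (c T0))) \<in> H"
          using Sub_el_linv[OF H _ pbc[OF T0]] b fT(1)[OF T0] by (simp add: c_def)
        then have "el ((p, sd b (c T)) \<odot> linv (p, sd b (c T0))) \<in> H" by (rule Sub_el_mult[OF H pbc[OF T]])
        moreover have "(p, sd b (c T)) \<odot> linv (p, sd b (c T0)) = (0, c (sd T T0))"
          by (auto simp: c_def set_eq_iff)
        moreover have "c (sd T T0) \<subseteq> I"
        proof
          fix x assume "x \<in> c (sd T T0)"
          then have "x \<in> J \<or> x - p \<in> J" using T T0 by (auto simp: c_def P_def)
          then show "x \<in> I" using p by (auto simp: I_def J_def)
        qed
        ultimately show "c (sd T T0) \<in> K" by (simp add: K_def)
      qed
    qed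
    then have "n * card (P H) \<le> card R * card K" using R(2) by simp
    also have "\<dots> \<le> 2 ^ card I"
    proof (rule card_mult_le_power[OF fI(1) R(1)])
      show "K \<subseteq> Pow I" by (auto simp: K_def)
      fix r r' s s' assume *: "r \<in> R" "r' \<in> R" "s \<in> K" "s' \<in> K" "sd r r' = sd s s'"
      have "el (0, sd s s') \<in> H" using Sub_el_mult[OF H, of "(0, s)" "(0, s')"] * by (simp add: K_def)
      then show "r = r'" using R_sep[of r r'] * by auto
    qed
    finally show ?thesis .
  qed simp
  have ind: "indicat_real S \<in> borel_measurable N" using S by simp
  have meas: "(\<lambda>H. indicat_real S (conj_subgroup lamplighter (el (0, T)) H)) \<in> borel_measurable \<mu>" if "T \<in> Pow J" for T
    using that fI finite_subset by (intro borel_\<mu> measurable_compose[OF measurable_conj ind]) auto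
  have int: "integrable \<mu> (\<lambda>H. real n * indicat_real S (conj_subgroup lamplighter (el (0, T)) H))" if "T \<in> Pow J" for T
    using meas[OF that] by (intro integrable_mult_right integrable_const_bound[of _ 1]) auto
  have "(\<integral>H. (\<Sum>T\<in>Pow J. real n * indicat_real S (conj_subgroup lamplighter (el (0, T)) H)) \<partial>\<mu>) \<le> 2 ^ card I"
  proof (rule integral_le_const)
    show "integrable \<mu> (\<lambda>H. \<Sum>T\<in>Pow J. real n * indicat_real S (conj_subgroup lamplighter (el (0, T)) H))"
      using int by (rule Bochner_Integration.integrable_sum)
    show "AE H in \<mu>. (\<Sum>T\<in>Pow J. real n * indicat_real S (conj_subgroup lamplighter (el (0, T)) H)) \<le> 2 ^ card I"
    proof (rule AE_I2)
      fix H assume "H \<in> space \<mu>"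
      then have H: "H \<in> Sub lamplighter" by (simp add: space_\<mu>)
      have "(\<Sum>T\<in>Pow J. real n * indicat_real S (conj_subgroup lamplighter (el (0, T)) H)) = real (n * card (P H))"
        using fI(2) by (simp add: P_def indicator_def sum.If_cases Int_def flip: sum_distrib_left)
      also have "\<dots> \<le> real (2 ^ card I)" using cardP[OF H] by (simp only: of_nat_le_iff)
      finally show "(\<Sum>T\<in>Pow J. real n * indicat_real S (conj_subgroup lamplighter (el (0, T)) H)) \<le> 2 ^ card I" by simp
    qed
  qed
  also have "(\<integral>H. (\<Sum>T\<in>Pow J. real n * indicat_real S (conj_subgroup lamplighter (el (0, T)) H)) \<partial>\<mu>) =
      (\<Sum>T\<in>Pow J. real n * prob S)"
  proof (subst Bochner_Integration.integral_sum[OF int], assumption, rule sum.cong[OF refl])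
    fix T assume "T \<in> Pow J"
    then have "finite T" using fI finite_subset by auto
    then have "(\<integral>H. indicat_real S (conj_subgroup lamplighter (el (0, T)) H) \<partial>\<mu>) = (\<integral>H. indicat_real S H \<partial>\<mu>)"
      by (rule integral_conj[OF ind])
    also have "\<dots> = prob S" using S sets_\<mu> sets.Int_space_eq2[of S \<mu>] by simp
    finally show "(\<integral>H. real n * indicat_real S (conj_subgroup lamplighter (el (0, T)) H) \<partial>\<mu>) = real n * prob S" by simp
  qed
  also have "\<dots> = 2 ^ card J * (real n * prob S)" using fI(2) by (simp add: card_Pow)
  also have "(2 :: real) ^ card I = 2 ^ card J * 2 ^ nat p"
  proof -
    have "card I = card J + nat p" using p by (simp add: I_def J_def)
    then show ?thesis by (simp add: power_add)
  qed
  finally show "real n * prob S \<le> 2 ^ nat p" by simp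
qed

text \<open>A subgroup of infinite index that contains \<open>(p, b)\<close> has separated families
  of every size \<open>n\<close>, each inside some window. Continuity along increasing windows keeps
  the bound \<open>2 ^ p / n\<close>, and \<open>n\<close> is arbitrary.\<close>

lemma prob_exceptional:
  assumes p: "0 < p" and b: "finite b"
  shows "AE H in \<mu>. el (p, b) \<in> H \<longrightarrow> H \<in> finite_index lamplighter"
proof -
  define E where "E = {H \<in> Sub lamplighter. el (p, b) \<in> H \<and> H \<notin> finite_index lamplighter}"
  have "E = {H \<in> Sub lamplighter. el (p, b) \<in> H} - finite_index lamplighter" by (auto simp: E_def)
  then have E: "E \<in> sets N"
    using sets_chabauty_coord[OF el_carrier[OF b]] lamp.sets_finite_index[OF countable_lamplighter] by auto
  define S where "S n k = {H \<in> Sub lamplighter. el (p, b) \<in> H \<and>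
    (\<exists>R \<subseteq> Pow {- int (k + nat p)..int (k + nat p)}. card R = n \<and> separated H R)}" for n k
  have pk: "p \<le> int (k + nat p)" for k using p by simp
  have S: "S n k \<in> sets \<mu>" and S_le: "real n * prob (S n k) \<le> 2 ^ nat p" for n k
    unfolding S_def sets_\<mu> by (rule prob_separated_le[OF p pk b])+
  have "real n * prob E \<le> 2 ^ nat p" for n
  proof -
    have inc: "incseq (S n)"
    proof (rule incseq_SucI)
      fix k show "S n k \<le> S n (Suc k)"
      proof
        fix H assume "H \<in> S n k"
        then obtain R where R: "H \<in> Sub lamplighter" "el (p, b) \<in> H" "R \<subseteq> Pow {- int (k + nat p)..int (k + nat p)}"
          "card R = n" "separated H R" by (auto simp: S_def)
        have "Pow {- int (k + nat p)..int (k + nat p)} \<subseteq> Pow {- int (Suc k + nat p)..int (Suc k + nat p)}"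
          by (intro Pow_mono) auto
        then show "H \<in> S n (Suc k)" using R unfolding S_def by blast
      qed
    qed
    have "E \<subseteq> (\<Union>k. S n k)"
    proof
      fix H assume "H \<in> E"
      then have H: "H \<in> Sub lamplighter" "el (p, b) \<in> H" "H \<notin> finite_index lamplighter" by (auto simp: E_def)
      obtain R where R: "finite R" "card R = n" "\<forall>T\<in>R. finite T" "separated H R"
        using infinite_index_separated[OF H(1,2) b p H(3)] by blast
      have fU: "finite (\<Union>R)" using R by auto
      define k where "k = nat (\<Sum>x\<in>\<Union>R. \<bar>x\<bar>)"
      have "\<bar>x\<bar> \<le> int (k + nat p)" if "x \<in> \<Union>R" for x
      proof -
        have "\<bar>x\<bar> \<le> (\<Sum>x\<in>\<Union>R. \<bar>x\<bar>)" using that fU by (intro member_le_sum) auto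
        then show ?thesis by (simp add: k_def)
      qed
      then have "R \<subseteq> Pow {- int (k + nat p)..int (k + nat p)}" by (fastforce simp: abs_le_iff)
      then show "H \<in> (\<Union>k. S n k)" using H(1,2) R(2,4) unfolding S_def by blast
    qed
    then have "prob E \<le> prob (\<Union>k. S n k)" using S by (intro finite_measure_mono) auto
    moreover have "(\<lambda>k. real n * prob (S n k)) \<longlonglongrightarrow> real n * prob (\<Union>k. S n k)"
      using S inc by (intro tendsto_mult_left finite_Lim_measure_incseq) auto
    then have "real n * prob (\<Union>k. S n k) \<le> 2 ^ nat p"
      by (rule LIMSEQ_le_const2) (use S_le in auto)
    ultimately show ?thesis by (meson mult_left_mono of_nat_0_le_iff order.trans)
  qed
  then have "prob E = 0"
    using reals_Archimedean3[of "prob E"] measure_nonneg[of \<mu> E] by (metis less_le_not_le order_le_less)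
  then have "AE H in \<mu>. H \<notin> E" using E by (simp add: prob_eq_0 sets_\<mu>)
  then show ?thesis
  proof (rule AE_mp, intro AE_I2 impI)
    fix H assume "H \<in> space \<mu>" "H \<notin> E" "el (p, b) \<in> H"
    then show "H \<in> finite_index lamplighter" by (simp add: E_def space_\<mu>)
  qed
qed

text \<open>There are countably many elements with positive cursor, and an element with negative
  cursor is replaced by its inverse.\<close>

lemma AE_finite_index: "AE H in \<mu>. H \<subseteq> Lamps \<or> H \<in> finite_index lamplighter"
proof -
  have "AE H in \<mu>. \<forall>g\<in>{g \<in> carrier lamplighter. 0 < fst g}. g \<in> H \<longrightarrow> H \<in> finite_index lamplighter"
  proof (subst AE_ball_countable)
    show "countable {g \<in> carrier lamplighter. 0 < fst g}" using countable_lamplighter by auto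
    show "\<forall>g\<in>{g \<in> carrier lamplighter. 0 < fst g}. AE H in \<mu>. g \<in> H \<longrightarrow> H \<in> finite_index lamplighter"
    proof
      fix g assume "g \<in> {g \<in> carrier lamplighter. 0 < fst g}"
      then obtain k S where "g = el (k, S)" "finite S" "0 < fst g" by (auto simp: carrier_el)
      then show "AE H in \<mu>. g \<in> H \<longrightarrow> H \<in> finite_index lamplighter"
        using prob_exceptional[of k S] by (simp add: el_def)
    qed
  qed
  then show ?thesis
  proof (rule AE_mp, intro AE_I2 impI)
    fix H assume "H \<in> space \<mu>" and fi: "\<forall>g\<in>{g \<in> carrier lamplighter. 0 < fst g}. g \<in> H \<longrightarrow> H \<in> finite_index lamplighter"
    then have H: "H \<in> Sub lamplighter" by (simp add: space_\<mu>)
    show "H \<subseteq> Lamps \<or> H \<in> finite_index lamplighter"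
    proof (cases "H \<subseteq> Lamps")
      case False
      then obtain k S where kS: "finite S" "k \<noteq> 0" "el (k, S) \<in> H" using subset_Lamps_iff[OF H] by blast
      have "\<exists>g\<in>{g \<in> carrier lamplighter. 0 < fst g}. g \<in> H"
      proof (cases "0 < k")
        case True
        then show ?thesis using kS by (intro bexI[of _ "el (k, S)"]) (simp_all add: el_carrier, simp add: el_def)
      next
        case False
        then show ?thesis using kS Sub_el_linv[OF H kS(1,3)]
          by (intro bexI[of _ "el (- k, tr (- k) S)"]) (simp_all add: el_carrier, simp add: el_def)
      qed
      then show ?thesis using fi by blast
    qed simp
  qed
qed

end


section \<open>Every invariant random subgroup is co-sofic\<close>

text \<open>Shifting by \<open>j\<close> permutes the residues modulo \<open>m\<close>.\<close>

lemma sum_periodic_shift: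
  fixes h :: "int \<Rightarrow> real"
  assumes m: "0 < m" and per: "\<And>s. h (s + int m) = h s"
  shows "(\<Sum>i<m. h (int i - j)) = (\<Sum>i<m. h (int i))"
proof -
  have per': "h (s + int q * int m) = h s" for s q
  proof (induction q)
    case (Suc q)
    have "h (s + int (Suc q) * int m) = h ((s + int q * int m) + int m)" by (simp add: algebra_simps)
    then show ?case using Suc per by simp
  qed simp
  have md: "h (s mod int m) = h s" for s
  proof -
    show ?thesis
    proof (cases "0 \<le> s div int m")
      case True
      then have "s mod int m + int (nat (s div int m)) * int m = s" by simp
      then show ?thesis using per'[of "s mod int m" "nat (s div int m)"] by (simp only:)
    next
      case False
      then have "s + int (nat (- (s div int m))) * int m = s mod int m" by (simp add: minus_div_mult_eq_mod)
      then show ?thesis using per'[of s "nat (- (s div int m))"] by (simp only:)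
    qed
  qed
  have inv: "nat ((int (nat ((int i - j) mod int m)) + j) mod int m) = i"
    "nat ((int (nat ((int i + j) mod int m)) - j) mod int m) = i" if "i < m" for i
    using that m by (simp_all add: mod_simps)
  show ?thesis
    by (rule sum.reindex_bij_witness[of _ "\<lambda>i. nat ((int i + j) mod int m)" "\<lambda>i. nat ((int i - j) mod int m)"])
      (use m md inv in \<open>auto simp: nat_less_iff\<close>)
qed

lemma finite_subset_wbox:
  assumes "finite F" "F \<subseteq> carrier lamplighter" obtains r where "F \<subseteq> el ` wbox r"
proof -
  have "\<exists>r. F \<subseteq> el ` wbox r" using assms
  proof (induction F rule: finite_induct)
    case (insert x F)
    then obtain r where r: "F \<subseteq> el ` wbox r" by auto
    obtain k S where x: "x = el (k, S)" "finite S" using insert.prems by (auto simp: carrier_el)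
    define r' where "r' = nat (\<bar>k\<bar> + (\<Sum>u\<in>S. \<bar>u\<bar>))"
    have nn: "0 \<le> (\<Sum>u\<in>S. \<bar>u\<bar>)" by (simp add: sum_nonneg)
    have "\<bar>u\<bar> \<le> (\<Sum>u\<in>S. \<bar>u\<bar>)" if "u \<in> S" for u using that x(2) by (intro member_le_sum) auto
    then have "(k, S) \<in> wbox r'" using nn by (fastforce simp: pair_in_wbox r'_def)
    moreover have "el ` wbox r \<subseteq> el ` wbox (max r r')" "el ` wbox r' \<subseteq> el ` wbox (max r r')"
      by (intro image_mono wbox_mono; simp)+
    ultimately have "insert x F \<subseteq> el ` wbox (max r r')" using r x by blast
    then show ?case by blast
  qed simp
  then show thesis using that by blast
qed

text \<open>All but at most \<open>2 * r\<close> of the \<open>m\<close> windows contain the box of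
  radius \<open>r\<close>. For these the approximation stays in a cylinder around \<open>H\<close>
  on which \<open>f\<close> differs from \<open>f H\<close> by less than
  \<open>\<epsilon> / 2\<close>; each remaining one costs at most \<open>2 * C\<close>, on average
  \<open>4 * C * r / m\<close>.\<close>

lemma approx_average:
  fixes f :: "_ \<Rightarrow> real"
  assumes f: "continuous_map (chabauty lamplighter) euclideanreal f"
    and C: "\<And>H. H \<in> Sub lamplighter \<Longrightarrow> \<bar>f H\<bar> \<le> C" and H: "H \<in> Sub lamplighter"
  shows "(\<lambda>n. (\<Sum>i<Suc n. f (approx_sub (Suc n) (int i) H)) / real (Suc n)) \<longlonglongrightarrow> f H"
proof (rule tendstoI)
  fix \<epsilon> :: real assume \<epsilon>: "0 < \<epsilon>"
  have C0: "0 \<le> C" using C[OF H] by linarith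
  have "openin (chabauty lamplighter) {H' \<in> topspace (chabauty lamplighter). f H' \<in> ball (f H) (\<epsilon> / 2)}"
    using f by (intro openin_continuous_map_preimage) auto
  then have "openin (chabauty lamplighter) {H' \<in> Sub lamplighter. f H' \<in> ball (f H) (\<epsilon> / 2)}"
    by (simp add: topspace_chabauty)
  moreover have "H \<in> {H' \<in> Sub lamplighter. f H' \<in> ball (f H) (\<epsilon> / 2)}" using H \<epsilon> by simp
  ultimately obtain F where F: "finite F" "F \<subseteq> carrier lamplighter"
    "cylinder lamplighter F (H \<inter> F) \<subseteq> {H' \<in> Sub lamplighter. f H' \<in> ball (f H) (\<epsilon> / 2)}"
    by (rule chabauty_nbhd)
  obtain r where r: "F \<subseteq> el ` wbox r" using finite_subset_wbox[OF F(1,2)] .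
  have bound: "\<bar>(\<Sum>i<m. f (approx_sub m (int i) H)) / real m - f H\<bar> \<le> \<epsilon> / 2 + 4 * C * real r / real m" if m: "0 < m" for m
  proof -
    define B where "B = {i. i < m \<and> (i < r \<or> m \<le> i + r)}"
    have fB: "finite B" by (simp add: B_def)
    have "B \<subseteq> {..<r} \<union> {m - r..<m}" by (auto simp: B_def)
    then have "card B \<le> card ({..<r} \<union> {m - r..<m})" by (intro card_mono) auto
    also have "\<dots> \<le> 2 * r" by (rule order.trans[OF card_Un_le]) simp
    finally have cB: "card B \<le> 2 * r" .
    have "\<bar>f (approx_sub m (int i) H) - f H\<bar> \<le> \<epsilon> / 2 + (if i \<in> B then 2 * C else 0)" if i: "i < m" for i
    proof (cases "i \<in> B")
      case True
      then show ?thesis using C[OF H] C[OF approx_Sub[OF H, of m "int i"]] \<epsilon> by simp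
    next
      case False
      then have "approx_sub m (int i) H \<inter> F = H \<inter> F" using i by (intro approx_agree[OF H r]) (auto simp: B_def)
      then have "approx_sub m (int i) H \<in> cylinder lamplighter F (H \<inter> F)"
        using approx_Sub[OF H] by (simp add: cylinder_def)
      then have "f (approx_sub m (int i) H) \<in> ball (f H) (\<epsilon> / 2)" using F(3) by blast
      then show ?thesis using False by (simp add: dist_real_def abs_minus_commute)
    qed
    then have "(\<Sum>i<m. \<bar>f (approx_sub m (int i) H) - f H\<bar>) \<le> (\<Sum>i<m. \<epsilon> / 2 + (if i \<in> B then 2 * C else 0))"
      by (intro sum_mono) simp
    also have "\<dots> = real m * (\<epsilon> / 2) + real (card B) * (2 * C)"
    proof -
      have "{..<m} \<inter> {i. i \<in> B} = B" by (auto simp: B_def)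
      then show ?thesis by (simp add: sum.distrib sum.If_cases)
    qed
    also have "\<dots> \<le> real m * (\<epsilon> / 2) + real (2 * r) * (2 * C)"
      using cB C0 by (intro add_left_mono mult_right_mono) simp_all
    finally have s: "(\<Sum>i<m. \<bar>f (approx_sub m (int i) H) - f H\<bar>) \<le> real m * (\<epsilon> / 2) + 4 * C * real r"
      by (simp add: mult_ac)
    have "(\<Sum>i<m. f (approx_sub m (int i) H)) / real m - f H = (\<Sum>i<m. f (approx_sub m (int i) H) - f H) / real m"
      using m by (simp add: sum_subtractf field_simps)
    then have "\<bar>(\<Sum>i<m. f (approx_sub m (int i) H)) / real m - f H\<bar> = \<bar>\<Sum>i<m. f (approx_sub m (int i) H) - f H\<bar> / real m"
      by simp
    also have "\<dots> \<le> (real m * (\<epsilon> / 2) + 4 * C * real r) / real m"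
      by (intro divide_right_mono order.trans[OF sum_abs s]) simp
    also have "\<dots> = \<epsilon> / 2 + 4 * C * real r / real m" using m by (simp add: add_divide_distrib)
    finally show ?thesis .
  qed
  have "(\<lambda>n. 4 * C * real r / real (Suc n)) \<longlonglongrightarrow> 0"
    by (rule LIMSEQ_Suc) (rule lim_const_over_n)
  then have "\<forall>\<^sub>F n in sequentially. 4 * C * real r / real (Suc n) < \<epsilon> / 2"
    using \<epsilon> by (intro order_tendstoD(2)[of _ 0]) auto
  then show "\<forall>\<^sub>F n in sequentially. dist ((\<Sum>i<Suc n. f (approx_sub (Suc n) (int i) H)) / real (Suc n)) (f H) < \<epsilon>"
  proof eventually_elim
    fix n assume "4 * C * real r / real (Suc n) < \<epsilon> / 2"
    then show "dist ((\<Sum>i<Suc n. f (approx_sub (Suc n) (int i) H)) / real (Suc n)) (f H) < \<epsilon>"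
      using bound[of "Suc n"] unfolding dist_real_def by linarith
  qed
qed

context lamp_IRS
begin

section \<open>Conjugation invariance of the averaged approximations\<close>

lemma integrable_approx:
  fixes f :: "_ \<Rightarrow> real"
  assumes "f \<in> borel_measurable N" "bounded (f ` space N)"
  shows "integrable \<mu> (\<lambda>H. f (approx_sub m s H))"
proof -
  obtain B where "\<And>H. H \<in> space N \<Longrightarrow> norm (f H) \<le> B" using assms(2) by (auto simp: bounded_iff)
  then show ?thesis
    using measurable_space[OF measurable_approx_sub] borel_\<mu>[OF measurable_compose[OF measurable_approx_sub assms(1)]]
    by (intro integrable_const_bound[of _ B]) (auto simp: space_\<mu> space_chabauty_borel)
qed

text \<open>Periodicity comes from invariance: on subgroups of \<open>Lamps\<close> a full period is
  a conjugation, which preserves \<open>\<mu>\<close>; elsewhere the position \<open>s\<close> does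
  not enter.\<close>

lemma integral_approx_periodic:
  fixes f :: "_ \<Rightarrow> real"
  assumes f: "f \<in> borel_measurable N" "bounded (f ` space N)"
  shows "(\<integral>H. f (approx_sub m (s + int m) H) \<partial>\<mu>) = (\<integral>H. f (approx_sub m s H) \<partial>\<mu>)"
proof -
  define L where "L = {H \<in> Sub lamplighter. H \<subseteq> Lamps}"
  have L: "L \<in> sets N" unfolding L_def by (rule sets_subset_Lamps)
  define c where "c = conj_subgroup lamplighter (el (int m, {}))"
  have in_L: "c H \<in> L \<longleftrightarrow> H \<in> L" if "H \<in> Sub lamplighter" for H
    using conj_subset_Lamps_iff[OF that, of "{}" "int m"] lamp.conj_subgroup_Sub[OF that el_carrier, of "{}" "int m"] that
    by (simp add: L_def c_def)
  have intL: "integrable \<mu> (\<lambda>H. f (approx_sub m s H) * indicat_real L H)" for s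
    using L sets_\<mu> by (intro integrable_real_mult_indicator integrable_approx f) simp
  have int0: "integrable \<mu> (\<lambda>H. f (approx_sub m s H) * indicat_real (- L) H)" for s
  proof -
    have "(\<lambda>H. f (approx_sub m s H) * indicat_real (- L) H) = (\<lambda>H. f (approx_sub m s H) - f (approx_sub m s H) * indicat_real L H)"
      by (auto simp: indicator_def)
    then show ?thesis using intL integrable_approx[OF f] by simp
  qed
  have split: "(\<integral>H. f (approx_sub m s H) \<partial>\<mu>) =
      (\<integral>H. f (approx_sub m s H) * indicat_real L H \<partial>\<mu>) + (\<integral>H. f H * indicat_real (- L) H \<partial>\<mu>)" for s
  proof -
    have "(\<integral>H. f (approx_sub m s H) \<partial>\<mu>) =
        (\<integral>H. f (approx_sub m s H) * indicat_real L H + f (approx_sub m s H) * indicat_real (- L) H \<partial>\<mu>)"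
      by (rule Bochner_Integration.integral_cong) (auto simp: indicator_def)
    also have "\<dots> = (\<integral>H. f (approx_sub m s H) * indicat_real L H \<partial>\<mu>) + (\<integral>H. f (approx_sub m s H) * indicat_real (- L) H \<partial>\<mu>)"
      by (rule Bochner_Integration.integral_add[OF intL int0])
    also have "(\<integral>H. f (approx_sub m s H) * indicat_real (- L) H \<partial>\<mu>) = (\<integral>H. f H * indicat_real (- L) H \<partial>\<mu>)"
      by (rule Bochner_Integration.integral_cong) (auto simp: indicator_def L_def approx_sub_def space_\<mu>)
    finally show ?thesis .
  qed
  have "(\<integral>H. f (approx_sub m (s + int m) H) * indicat_real L H \<partial>\<mu>) =
      (\<integral>H. f (approx_sub m s (c H)) * indicat_real L (c H) \<partial>\<mu>)"
  proof (rule Bochner_Integration.integral_cong[OF refl])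
    fix H assume "H \<in> space \<mu>"
    then have H: "H \<in> Sub lamplighter" by (simp add: space_\<mu>)
    show "f (approx_sub m (s + int m) H) * indicat_real L H = f (approx_sub m s (c H)) * indicat_real L (c H)"
    proof (cases "H \<in> L")
      case True
      then have "approx_sub m (s + int m) H = approx_sub m s (c H)"
        using in_L[OF H] window_periodic[OF H] by (simp add: approx_sub_def L_def c_def)
      then show ?thesis using True in_L[OF H] by simp
    qed (simp add: in_L[OF H])
  qed
  also have "\<dots> = (\<integral>H. f (approx_sub m s H) * indicat_real L H \<partial>\<mu>)"
    unfolding c_def
    by (rule integral_conj)
      (use L measurable_compose[OF measurable_approx_sub f(1)] in \<open>auto intro!: borel_measurable_times\<close>)
  finally show ?thesis using split[of "s + int m"] split[of s] by simp
qed

lemma integral_conj_approx: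
  fixes f :: "_ \<Rightarrow> real"
  assumes "f \<in> borel_measurable N" "finite T"
  shows "(\<integral>H. f (conj_subgroup lamplighter (el (j, T)) (approx_sub m s H)) \<partial>\<mu>) = (\<integral>H. f (approx_sub m (s - j) H) \<partial>\<mu>)"
proof -
  have "(\<integral>H. f (conj_subgroup lamplighter (el (j, T)) (approx_sub m s H)) \<partial>\<mu>) =
      (\<integral>H. f (approx_sub m (s - j) (conj_subgroup lamplighter (el (j, T)) H)) \<partial>\<mu>)"
    by (rule Bochner_Integration.integral_cong) (simp_all add: space_\<mu> conj_approx assms(2))
  also have "\<dots> = (\<integral>H. f (approx_sub m (s - j) H) \<partial>\<mu>)"
    by (rule integral_conj[OF measurable_compose[OF measurable_approx_sub assms(1)] assms(2)])
  finally show ?thesis .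
qed

text \<open>Conjugation by \<open>(j, T)\<close> moves each of the \<open>m\<close> window positions
  by \<open>- j\<close>. The integrals are periodic in the position, so the average over a full
  period is unchanged, whereas a single window would not give an invariant measure in
  general.\<close>

lemma exists_approximation:
  assumes m: "0 < m"
  shows "\<exists>\<nu>\<in>IRS_fi lamplighter. \<forall>f :: _ \<Rightarrow> real. f \<in> borel_measurable N \<longrightarrow> bounded (f ` space N) \<longrightarrow>
    (\<integral>H. f H \<partial>\<nu>) = (\<Sum>i<m. \<integral>H. f (approx_sub m (int i) H) \<partial>\<mu>) / real m"
proof -
  have "approx_sub m (int i) \<in> measurable \<mu> N" for i
    using measurable_approx_sub measurable_cong_sets[OF sets_\<mu> refl] by blast
  then obtain \<nu> where sets_\<nu>: "sets \<nu> = sets N" and p\<nu>: "prob_space \<nu>" and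
    int_\<nu>: "\<And>f :: _ \<Rightarrow> real. f \<in> borel_measurable N \<Longrightarrow> bounded (f ` space N) \<Longrightarrow>
      (\<integral>H. f H \<partial>\<nu>) = (\<Sum>i<m. \<integral>H. f (approx_sub m (int i) H) \<partial>\<mu>) / real m"
    using uniform_mixture[OF prob_space_axioms m, of "\<lambda>i. approx_sub m (int i)" N] by blast
  interpret \<nu>: prob_space \<nu> by (rule p\<nu>)
  have bi: "bounded (indicat_real A ` B)" for A B :: "(int \<times> (int \<Rightarrow> int)) set set"
    by (rule boundedI[of _ 1]) (auto simp: indicator_def)
  have prob_\<nu>: "\<nu>.prob A = (\<integral>H. indicat_real A H \<partial>\<nu>)" if "A \<in> sets N" for A
    using that sets_\<nu> sets.Int_space_eq2[of A \<nu>] by simp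
  have conj: "distr \<nu> \<nu> (conj_subgroup lamplighter g) = \<nu>" if g: "g \<in> carrier lamplighter" for g
  proof (rule measure_eqI)
    obtain j T where jT: "g = el (j, T)" "finite T" using g by (auto simp: carrier_el)
    let ?c = "conj_subgroup lamplighter g"
    have mN: "?c \<in> measurable N N" using measurable_conj jT by simp
    then have mc: "?c \<in> measurable \<nu> \<nu>" using measurable_cong_sets[OF sets_\<nu> sets_\<nu>] by blast
    show "sets (distr \<nu> \<nu> ?c) = sets \<nu>" by simp
    fix A assume "A \<in> sets (distr \<nu> \<nu> ?c)"
    then have A: "A \<in> sets \<nu>" "A \<in> sets N" using sets_\<nu> by simp_all
    have ind: "indicat_real A \<in> borel_measurable N" using A(2) by simp
    define h where "h s = (\<integral>H. indicat_real A (approx_sub m s H) \<partial>\<mu>)" for s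
    have vA: "?c -` A \<inter> space \<nu> \<in> sets \<nu>" using measurable_sets[OF mc A(1)] .
    have "\<nu>.prob (?c -` A \<inter> space \<nu>) = (\<integral>H. indicat_real (?c -` A \<inter> space \<nu>) H \<partial>\<nu>)"
      using prob_\<nu> vA sets_\<nu> by simp
    also have "\<dots> = (\<integral>H. indicat_real A (?c H) \<partial>\<nu>)"
      by (rule Bochner_Integration.integral_cong) (auto simp: indicator_def)
    also have "\<dots> = (\<Sum>i<m. \<integral>H. indicat_real A (?c (approx_sub m (int i) H)) \<partial>\<mu>) / real m"
    proof (rule int_\<nu>[OF measurable_compose[OF mN ind]])
      show "bounded ((\<lambda>H. indicat_real A (?c H)) ` space N)"
        by (rule boundedI[of _ 1]) (auto simp: indicator_def)
    qed
    also have "\<dots> = (\<Sum>i<m. h (int i - j)) / real m"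
      by (simp add: jT(1) h_def integral_conj_approx[OF ind jT(2)])
    also have "\<dots> = (\<Sum>i<m. h (int i)) / real m"
      using sum_periodic_shift[OF m, of h j] integral_approx_periodic[OF ind bi, of m] by (simp add: h_def)
    also have "\<dots> = \<nu>.prob A" using prob_\<nu>[OF A(2)] int_\<nu>[OF ind bi] by (simp add: h_def)
    finally show "emeasure (distr \<nu> \<nu> ?c) A = emeasure \<nu> A"
      by (simp add: emeasure_distr[OF mc A(1)] \<nu>.emeasure_eq_measure)
  qed
  have fi: "finite_index lamplighter \<in> sets N" by (rule lamp.sets_finite_index[OF countable_lamplighter])
  have one: "(\<integral>H. indicat_real (finite_index lamplighter) (approx_sub m (int i) H) \<partial>\<mu>) = 1" for i
  proof -
    have "AE H in \<mu>. indicat_real (finite_index lamplighter) (approx_sub m (int i) H) = 1"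
      using AE_finite_index
    proof (rule AE_mp, intro AE_I2 impI)
      fix H assume "H \<in> space \<mu>" "H \<subseteq> Lamps \<or> H \<in> finite_index lamplighter"
      then have "approx_sub m (int i) H \<in> finite_index lamplighter"
        using window_finite_index[OF _ m] by (auto simp: approx_sub_def space_\<mu>)
      then show "indicat_real (finite_index lamplighter) (approx_sub m (int i) H) = 1" by simp
    qed
    moreover have "(\<lambda>H. indicat_real (finite_index lamplighter) (approx_sub m (int i) H)) \<in> borel_measurable \<mu>"
      using fi by (intro borel_\<mu> measurable_compose[OF measurable_approx_sub]) simp
    ultimately have "(\<integral>H. indicat_real (finite_index lamplighter) (approx_sub m (int i) H) \<partial>\<mu>) = (\<integral>H. 1 \<partial>\<mu>)"
      by (intro integral_cong_AE) auto
    then show ?thesis by (simp add: prob_space)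
  qed
  have "\<nu>.prob (finite_index lamplighter) = 1"
    unfolding prob_\<nu>[OF fi] using fi m by (subst int_\<nu>[OF _ bi]) (simp_all add: one)
  then have "\<nu> \<in> IRS_fi lamplighter"
    using sets_\<nu> p\<nu> conj by (simp add: IRS_fi_def IRS_def prob_measures_def)
  then show ?thesis using int_\<nu> by blast
qed

text \<open>Pointwise convergence from \<open>approx_average\<close> and the bound of
  \<open>f\<close> on the compact space allow dominated convergence; \<open>Suc n\<close> keeps the
  number of windows positive.\<close>

theorem co_sofic_\<mu>: "co_sofic lamplighter \<mu>"
proof -
  obtain \<nu> where \<nu>: "\<And>n. \<nu> n \<in> IRS_fi lamplighter" and
    int_\<nu>: "\<And>n (f :: _ \<Rightarrow> real). f \<in> borel_measurable N \<Longrightarrow> bounded (f ` space N) \<Longrightarrow>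
      (\<integral>H. f H \<partial>\<nu> n) = (\<Sum>i<Suc n. \<integral>H. f (approx_sub (Suc n) (int i) H) \<partial>\<mu>) / real (Suc n)"
    using exists_approximation[OF zero_less_Suc] by metis
  have "\<mu> \<in> weak_star lamplighter closure_of IRS_fi lamplighter"
  proof (rule weak_star_closureI)
    show "\<mu> \<in> prob_measures lamplighter" using \<mu> by (simp add: IRS_def)
    show "\<nu> n \<in> IRS_fi lamplighter" for n by (rule \<nu>)
    show "IRS_fi lamplighter \<subseteq> prob_measures lamplighter" by (auto simp: IRS_fi_def IRS_def)
    fix f assume f: "continuous_map (chabauty lamplighter) euclideanreal f"
    obtain C where C: "0 \<le> C" "\<And>H. H \<in> Sub lamplighter \<Longrightarrow> \<bar>f H\<bar> \<le> C"
      using lamp.continuous_chabauty_bounded[OF f] by metis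
    have fN: "f \<in> borel_measurable N" by (rule continuous_chabauty_measurable[OF f])
    have bf: "bounded (f ` space N)" by (rule boundedI[of _ C]) (auto simp: space_chabauty_borel C)
    define g where "g n H = (\<Sum>i<Suc n. f (approx_sub (Suc n) (int i) H)) / real (Suc n)" for n H
    have "(\<lambda>n. \<integral>H. g n H \<partial>\<mu>) \<longlonglongrightarrow> (\<integral>H. f H \<partial>\<mu>)"
    proof (rule integral_dominated_convergence[where w = "\<lambda>_. C"])
      show "f \<in> borel_measurable \<mu>" by (rule borel_\<mu>[OF fN])
      show "g n \<in> borel_measurable \<mu>" for n
        unfolding g_def
        using borel_\<mu>[OF measurable_compose[OF measurable_approx_sub fN]] by (intro borel_measurable_divide borel_measurable_sum) auto
      show "integrable \<mu> (\<lambda>_. C)" by simp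
      show "AE H in \<mu>. (\<lambda>n. g n H) \<longlonglongrightarrow> f H"
        using approx_average[OF f C(2)] by (intro AE_I2) (simp add: space_\<mu> g_def)
      show "AE H in \<mu>. norm (g n H) \<le> C" for n
      proof (rule AE_I2)
        fix H assume "H \<in> space \<mu>"
        then have "\<bar>f (approx_sub (Suc n) (int i) H)\<bar> \<le> C" for i using C(2) approx_Sub by (simp add: space_\<mu>)
        then have "\<bar>\<Sum>i<Suc n. f (approx_sub (Suc n) (int i) H)\<bar> \<le> (\<Sum>i<Suc n. C)"
          by (intro order.trans[OF sum_abs] sum_mono)
        then show "norm (g n H) \<le> C" unfolding g_def by (simp add: field_simps del: sum.lessThan_Suc)
      qed
    qed
    moreover have "(\<integral>H. g n H \<partial>\<mu>) = (\<integral>H. f H \<partial>\<nu> n)" for n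
    proof -
      have "(\<integral>H. g n H \<partial>\<mu>) = (\<Sum>i<Suc n. \<integral>H. f (approx_sub (Suc n) (int i) H) \<partial>\<mu>) / real (Suc n)"
        unfolding g_def using integrable_approx[OF fN bf]
        by (simp add: Bochner_Integration.integral_sum del: sum.lessThan_Suc)
      then show ?thesis using int_\<nu>[OF fN bf] by simp
    qed
    ultimately show "(\<lambda>n. \<integral>H. f H \<partial>\<nu> n) \<longlonglongrightarrow> (\<integral>H. f H \<partial>\<mu>)" by simp
  qed
  then show ?thesis using \<mu> by (simp add: co_sofic_def)
qed

end


theorem theorem1p3:
  shows "(\<forall>\<mu>\<in>IRS lamplighter. co_sofic lamplighter \<mu>) \<and> permutation_stable lamplighter"
  using lamp_IRS.co_sofic_\<mu>[OF lamp_IRS.intro] lamplighter_stable by blast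

end
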